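(* Let $h$ be a strict CBF of $\mathcal{C}\subset\mathbb{R}^2$ and suppose $h(\mathbf{0}_2)>0$. Let $\mathbb{R}^2\setminus\mathcal{C}$ be a (nonempty) bounded connected set. Consider the filtered system $\dot{\mathbf{x}}=\tilde f(\mathbf{x})+g(\mathbf{x})v(\mathbf{x})$ with $n=2$ and assume that its set of undesired equilibria $\hat{\mathcal{E}}=\{\mathbf{x}_*^{(i)}\}_{i=1}^{k}\subset\partial\mathcal{C}$ is such that each of them is either asymptotically stable or a saddle point. Then $k$ is odd, $\frac{k+1}{2}$ of the undesired equilibria are saddle points and $\frac{k-1}{2}$ are asymptotically stable.
   Context: Setting. $f:\mathbb{R}^n\to\mathbb{R}^n$, $g:\mathbb{R}^n\to\mathbb{R}^{n\times m}$ are locally Lipschitz and define $\dot{\mathbf{x}}=f(\mathbf{x})+g(\mathbf{x})\mathbf{u}$. A locally Lipschitz nominal controller $k(\cdot):\mathbb{R}^n\to\mathbb{R}^m$ is given such that $\dot{\mathbf{x}}=\tilde f(\mathbf{x}):=f(\mathbf{x})+g(\mathbf{x})k(\mathbf{x})$ has the origin as its unique equilibrium, which is globally asymptotically stable. (In the claim, $k$ without argument denotes the finite number of undesired equilibria.) A function $\alpha:\mathbb{R}\to\mathbb{R}$ is of extended class $\mathcal{K}_\infty$ if it is (continuous and) strictly increasing, $\alpha(0)=0$ and $\lim_{s\to\pm\infty}\alpha(s)=\pm\infty$. Let $\mathcal{C}\subset\mathbb{R}^n$ and let $h:\mathbb{R}^n\to\mathbb{R}$ be continuously differentiable with $\mathcal{C}=\{h\ge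 0\}$ and $\partial\mathcal{C}=\{h=0\}$. $h$ is a strict control barrier function (strict CBF) of $\mathcal{C}$ with associated $\alpha$ if for every $\mathbf{x}\in\mathcal{C}$ there is $\mathbf{u}\in\mathbb{R}^m$ with $\nabla h(\mathbf{x})^\top(f(\mathbf{x})+g(\mathbf{x})\mathbf{u})+\alpha(h(\mathbf{x}))>0$. Filtered system: $\dot{\mathbf{x}}=\tilde f(\mathbf{x})+g(\mathbf{x})v(\mathbf{x})$, where the safety filter $v(\mathbf{x})$ is the unique minimizer of $\boldsymbol\theta^\top G(\mathbf{x})\boldsymbol\theta$ over $\boldsymbol\theta\in\mathbb{R}^m$ subject to $\nabla h(\mathbf{x})^\top(\tilde f(\mathbf{x})+g(\mathbf{x})\boldsymbol\theta)+\alpha(h(\mathbf{x}))\ge 0$; $G:\mathbb{R}^n\to\mathbb{R}^{m\times m}$ is continuously differentiable with positive definite values. $v$ is well defined and locally Lipschitz on $\mathcal{C}$ (indeed on an open neighborhood of $\mathcal{C}$), and $\mathcal{C}$ is forward invariant. The set of undesired equilibria is $\hat{\mathcal{E}}=\{\mathbf{x}\in\mathbb{R}^n:\ h(\mathbf{x})=0 \text{ and } \exists\,\delta<0 \text{ with } \tilde f(\mathbf{x})=\delta g(\mathbf{x})G(\mathbf{x})^{-1}g(\mathbf{x})^\top\nabla h(\mathbf{x})\}$; equivalently, the equilibria of the filtered system in $\mathcal{C}$ other than the origin. Convention on stability types ($n=2$): the closed-loop vector field is taken to be continuously differentiable near each undesired equilibrium (with $\alpha$ differentiable and $\alpha'(0)>0$),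 and its Jacobian there always has the negative eigenvalue $-\alpha'(0)$. The equilibrium is a saddle point if the other eigenvalue is positive and asymptotically stable if it is negative; if the other eigenvalue is zero, it is asymptotically stable if the trajectories on its center manifold converge to it, and a saddle point if the trajectories on its center manifold diverge from it.
   Formalization: The safe set C is additionally assumed connected (the obstacle R^2\C has no holes); without this the claim fails, e.g. for h=(|x|^2-1)(|x|^2-4), f=(-x1,-2x2), g=G=I, k(x)=0, alpha(s)=s, which has four undesired equilibria, two stable and two saddles. *)

theory Defs
  imports "HOL-Analysis.Analysis"
begin

section \<open>Regularity\<close>

text \<open>The library's \<open>local_lipschitz\<close> is about families of maps indexed by time;
  a single map is the constant family.\<close>

abbreviation locally_lipschitz_on ::
  "'a::metric_space set \<Rightarrow> ('a \<Rightarrow> 'b::metric_space) \<Rightarrow> bool"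
  where "locally_lipschitz_on S F \<equiv> local_lipschitz (UNIV :: real set) S (\<lambda>_. F)"

definition C1_on ::
  "'a::real_normed_vector set \<Rightarrow> ('a \<Rightarrow> 'b::real_normed_vector) \<Rightarrow> bool"
  where "C1_on S F \<longleftrightarrow>
    (\<exists>F' :: 'a \<Rightarrow> 'a \<Rightarrow>\<^sub>L 'b.
      (\<forall>x\<in>S. (F has_derivative blinfun_apply (F' x)) (at x)) \<and> continuous_on S F')"

definition gradient :: "('a::real_inner \<Rightarrow> real) \<Rightarrow> 'a \<Rightarrow> 'a"
  where "gradient h x = (THE d. GDERIV h x :> d)"

definition extended_class_K_inf :: "(real \<Rightarrow> real) \<Rightarrow> bool"
  where "extended_class_K_inf \<alpha> \<longleftrightarrow>
    continuous_on UNIV \<alpha> \<and> strict_mono \<alpha> \<and> \<alpha> 0 = 0 \<and>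
    filterlim \<alpha> at_top at_top \<and> filterlim \<alpha> at_bot at_bot"

definition positive_definite :: "real^'m^'m \<Rightarrow> bool"
  where "positive_definite A \<longleftrightarrow>
    transpose A = A \<and> (\<forall>v. v \<noteq> 0 \<longrightarrow> v \<bullet> (A *v v) > 0)"


section \<open>Solutions and global asymptotic stability of the origin\<close>

definition solves_on ::
  "('a::real_normed_vector \<Rightarrow> 'a) \<Rightarrow> (real \<Rightarrow> 'a) \<Rightarrow> real set \<Rightarrow> bool"
  where "solves_on X \<xi> I \<longleftrightarrow>
    (\<forall>t\<in>I. (\<xi> has_vector_derivative X (\<xi> t)) (at t within I))"

text \<open>The first conjunct of the definition below is forward completeness: without it the
  other two, which speak about solutions on \<open>[0,\<infinity>)\<close>, would ignore solutions with finite
  escape time.\<close>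

definition globally_asymptotically_stable_origin ::
  "('a::real_normed_vector \<Rightarrow> 'a) \<Rightarrow> bool"
  where "globally_asymptotically_stable_origin X \<longleftrightarrow>
    (\<forall>x0. \<exists>\<xi>. solves_on X \<xi> {0..} \<and> \<xi> 0 = x0) \<and>
    (\<forall>\<epsilon>>0. \<exists>\<delta>>0. \<forall>\<xi>. solves_on X \<xi> {0..} \<and> norm (\<xi> 0) < \<delta> \<longrightarrow> (\<forall>t\<ge>0. norm (\<xi> t) < \<epsilon>)) \<and>
    (\<forall>\<xi>. solves_on X \<xi> {0..} \<longrightarrow> (\<xi> \<longlongrightarrow> 0) at_top)"


section \<open>Control barrier functions and the safety filter\<close>

definition strict_CBF ::
  "(real^'n \<Rightarrow> real^'n) \<Rightarrow> (real^'n \<Rightarrow> real^'m^'n) \<Rightarrow> (real^'n \<Rightarrow> real) \<Rightarrow> (real \<Rightarrow> real)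
    \<Rightarrow> (real^'n) set \<Rightarrow> bool"
  where "strict_CBF f g h \<alpha> C \<longleftrightarrow>
    (\<forall>x\<in>C. \<exists>u. gradient h x \<bullet> (f x + g x *v u) + \<alpha> (h x) > 0)"

definition nominal_field ::
  "(real^'n \<Rightarrow> real^'n) \<Rightarrow> (real^'n \<Rightarrow> real^'m^'n) \<Rightarrow> (real^'n \<Rightarrow> real^'m)
    \<Rightarrow> real^'n \<Rightarrow> real^'n"
  where "nominal_field f g k x = f x + g x *v k x"

text \<open>Below, \<open>F\<close> stands for the nominal closed loop \<open>nominal_field f g k\<close>.\<close>

definition filter_feasible ::
  "(real^'n \<Rightarrow> real^'n) \<Rightarrow> (real^'n \<Rightarrow> real^'m^'n) \<Rightarrow> (real^'n \<Rightarrow> real) \<Rightarrow> (real \<Rightarrow> real)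
    \<Rightarrow> real^'n \<Rightarrow> (real^'m) set"
  where "filter_feasible F g h \<alpha> x =
    {\<theta>. gradient h x \<bullet> (F x + g x *v \<theta>) + \<alpha> (h x) \<ge> 0}"

definition safety_filter ::
  "(real^'n \<Rightarrow> real^'n) \<Rightarrow> (real^'n \<Rightarrow> real^'m^'n) \<Rightarrow> (real^'n \<Rightarrow> real) \<Rightarrow> (real \<Rightarrow> real)
    \<Rightarrow> (real^'n \<Rightarrow> real^'m^'m) \<Rightarrow> real^'n \<Rightarrow> real^'m"
  where "safety_filter F g h \<alpha> G x =
    (THE \<theta>. \<theta> \<in> filter_feasible F g h \<alpha> x \<and>
       (\<forall>\<eta> \<in> filter_feasible F g h \<alpha> x. \<theta> \<bullet> (G x *v \<theta>) \<le> \<eta> \<bullet> (G x *v \<eta>)))"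

definition filtered_field ::
  "(real^'n \<Rightarrow> real^'n) \<Rightarrow> (real^'n \<Rightarrow> real^'m^'n) \<Rightarrow> (real^'n \<Rightarrow> real) \<Rightarrow> (real \<Rightarrow> real)
    \<Rightarrow> (real^'n \<Rightarrow> real^'m^'m) \<Rightarrow> real^'n \<Rightarrow> real^'n"
  where "filtered_field F g h \<alpha> G x = F x + g x *v safety_filter F g h \<alpha> G x"

definition undesired_equilibria ::
  "(real^'n \<Rightarrow> real^'n) \<Rightarrow> (real^'n \<Rightarrow> real^'m^'n) \<Rightarrow> (real^'n \<Rightarrow> real)
    \<Rightarrow> (real^'n \<Rightarrow> real^'m^'m) \<Rightarrow> (real^'n) set"
  where "undesired_equilibria F g h G =
    {x. h x = 0 \<and>
      (\<exists>\<delta><0. F x = \<delta> *\<^sub>R (g x *v (matrix_inv (G x) *v (transpose (g x) *v gradient h x))))}"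


section \<open>Stability types of planar equilibria\<close>

text \<open>\<open>l1\<close>, \<open>l2\<close> are the eigenvalues of \<open>A\<close>, counted with multiplicity: the roots of
  the characteristic polynomial.\<close>

definition eigenvalue_pair :: "real^2^2 \<Rightarrow> real \<Rightarrow> real \<Rightarrow> bool"
  where "eigenvalue_pair A l1 l2 \<longleftrightarrow> (\<forall>z. det (mat z - A) = (z - l1) * (z - l2))"

definition locally_invariant :: "(real^2 \<Rightarrow> real^2) \<Rightarrow> (real^2) set \<Rightarrow> bool"
  where "locally_invariant X M \<longleftrightarrow>
    (\<forall>x0\<in>M. \<exists>T>0. \<exists>\<xi>. solves_on X \<xi> {-T<..<T} \<and> \<xi> 0 = x0 \<and> \<xi> ` {-T<..<T} \<subseteq> M)"

text \<open>Local center manifold at an equilibrium \<open>p\<close> whose linearization has a simple eigenvalue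
  \<open>0\<close> (eigenvector \<open>c\<close>) and a nonzero eigenvalue (eigenvector \<open>w\<close>): a locally invariant
  \<open>C\<^sup>1\<close> graph over the center eigenspace, tangent to it at \<open>p\<close>.\<close>

definition center_manifold :: "(real^2 \<Rightarrow> real^2) \<Rightarrow> real^2 \<Rightarrow> (real^2) set \<Rightarrow> bool"
  where "center_manifold X p M \<longleftrightarrow>
    (\<exists>c w \<mu> r \<phi>.
      c \<noteq> 0 \<and> jacobian X (at p) *v c = 0 \<and>
      w \<noteq> 0 \<and> \<mu> \<noteq> 0 \<and> jacobian X (at p) *v w = \<mu> *\<^sub>R w \<and>
      r > 0 \<and> C1_on {-r<..<r} \<phi> \<and> \<phi> 0 = 0 \<and> (\<phi> has_real_derivative 0) (at 0) \<and>
      M = (\<lambda>s. p + s *\<^sub>R c + \<phi> s *\<^sub>R w) ` {-r<..<r}) \<and>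
    locally_invariant X M"

definition converges_on :: "(real^2 \<Rightarrow> real^2) \<Rightarrow> real^2 \<Rightarrow> (real^2) set \<Rightarrow> bool"
  where "converges_on X p M \<longleftrightarrow>
    (\<exists>\<epsilon>>0. \<forall>x0 \<in> M \<inter> ball p \<epsilon>.
      \<exists>\<xi>. solves_on X \<xi> {0..} \<and> \<xi> 0 = x0 \<and> \<xi> ` {0..} \<subseteq> M \<and> (\<xi> \<longlongrightarrow> p) at_top)"

text \<open>Divergence: no trajectory on \<open>M\<close> other than \<open>p\<close> itself stays near \<open>p\<close> for all
  future times.\<close>

definition diverges_on :: "(real^2 \<Rightarrow> real^2) \<Rightarrow> real^2 \<Rightarrow> (real^2) set \<Rightarrow> bool"
  where "diverges_on X p M \<longleftrightarrow>
    (\<exists>\<epsilon>>0. \<forall>x0 \<in> M \<inter> ball p \<epsilon> - {p}.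
      \<not> (\<exists>\<xi>. solves_on X \<xi> {0..} \<and> \<xi> 0 = x0 \<and> \<xi> ` {0..} \<subseteq> M \<inter> ball p \<epsilon>))"

text \<open>In the following two definitions \<open>-a\<close> (with \<open>a = \<alpha>'(0) > 0\<close>) is the eigenvalue which the
  Jacobian of the filtered field has at every undesired equilibrium, and \<open>\<mu>\<close> is the other one.\<close>

definition asymptotically_stable_type :: "(real^2 \<Rightarrow> real^2) \<Rightarrow> real \<Rightarrow> real^2 \<Rightarrow> bool"
  where "asymptotically_stable_type X a p \<longleftrightarrow>
    (\<exists>\<mu>. eigenvalue_pair (jacobian X (at p)) (-a) \<mu> \<and>
      (\<mu> < 0 \<or> \<mu> = 0 \<and> (\<exists>M. center_manifold X p M \<and> converges_on X p M)))"

definition saddle_type :: "(real^2 \<Rightarrow> real^2) \<Rightarrow> real \<Rightarrow> real^2 \<Rightarrow> bool"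
  where "saddle_type X a p \<longleftrightarrow>
    (\<exists>\<mu>. eigenvalue_pair (jacobian X (at p)) (-a) \<mu> \<and>
      (\<mu> > 0 \<or> \<mu> = 0 \<and> (\<exists>M. center_manifold X p M \<and> diverges_on X p M)))"

end

theory Submission
  imports Defs "HOL-Complex_Analysis.Riemann_Mapping"
begin

text \<open>Identify the plane with the complex numbers and write \<open>n = \<nabla>h\<close>. Along the curve \<open>h = 0\<close> choose
  a continuous field \<open>W\<close> with \<open>W \<bullet> n > 0\<close> that agrees with \<open>g G\<^sup>-\<^sup>1 g\<^sup>T n\<close> where \<open>n \<bullet> F \<le> 0\<close>; then the
  undesired equilibria are the points where \<open>F / W\<close> is a negative real number. The unsafe set
  \<open>h < 0\<close> is contractible, so along its boundary \<open>F\<close>, having no zero in it, has winding number \<open>0\<close>,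
  and \<open>W\<close> has the winding number \<open>1\<close> of \<open>n\<close>. Hence \<open>F / W\<close> has winding number \<open>-1\<close>, which is the
  signed number of its crossings of the negative real axis.

  At an equilibrium \<open>p\<close> the filtered field is tangent to \<open>h = 0\<close>, and the sign of the crossing says
  whether the flow on the curve leaves \<open>p\<close> or approaches it. The other eigenvalue, if nonzero, is
  the derivative of this one-dimensional flow. If it is zero, then both the curve and the given
  center manifold are invariant and tangent to each other at \<open>p\<close>, and \<open>(h \<circ> \<xi>)' = - \<alpha> (h \<circ> \<xi>)\<close> forces
  their flows to have the same direction. So there is exactly one more saddle point than there are
  asymptotically stable equilibria.\<close>

section \<open>Winding of maps into the punctured plane\<close>

text \<open>The curve h = 0 is never parametrized. Winding is treated on the compact set
  \<open>K - U\<close> itself, up to factors with a continuous logarithm, and is read off from one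
  fact: if \<open>(z - a) powi m\<close>, with a in U, has a continuous logarithm there, then m = 0.
  Crossings are not counted along a path either: each crossing p is matched with a Moebius function
  whose zero and pole lie on the two sides of the curve and which crosses only at p, in the same
  direction. Dividing by the product of these functions cancels all jumps of Ln.

  The correction that defines W is needed because g G^-1 g^T n vanishes where no input acts on h.
  The strict barrier condition gives n . F > 0 there, which leaves room to add a multiple of n
  without touching the points where F / W is negative.

  For the eigenvalue 0, convergence or divergence is known only on the given center manifold, which
  need not lie in the curve. Under divergence it does near p, since h^2 cannot grow along the flow
  out of p. Under convergence this may fail, and only the direction of the two flows is shown to
  agree, by contradiction.\<close>

text \<open>For nonvanishing continuous \<open>f\<close> and \<open>g\<close>, this is homotopy of \<open>f\<close> and \<open>g\<close> as maps into the
  punctured plane.\<close>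

definition log_equiv :: "complex set \<Rightarrow> (complex \<Rightarrow> complex) \<Rightarrow> (complex \<Rightarrow> complex) \<Rightarrow> bool"
  where "log_equiv S f g \<longleftrightarrow>
    (\<exists>q. continuous_on S q \<and> (\<forall>x\<in>S. f x = g x * exp (q x)))"

lemma log_equiv_refl [simp]: "log_equiv S f f"
  unfolding log_equiv_def by (rule exI[of _ "\<lambda>_. 0"]) simp

lemma log_equiv_cong:
  assumes "log_equiv S f g" "\<And>x. x \<in> S \<Longrightarrow> f x = f' x" "\<And>x. x \<in> S \<Longrightarrow> g x = g' x"
  shows "log_equiv S f' g'"
  using assms unfolding log_equiv_def by auto

lemma log_equiv_sym:
  assumes "log_equiv S f g"
  shows "log_equiv S g f"
proof -
  obtain q where "continuous_on S q" "\<forall>x\<in>S. f x = g x * exp (q x)"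
    using assms unfolding log_equiv_def by blast
  then show ?thesis
    unfolding log_equiv_def
    by (intro exI[of _ "\<lambda>x. - q x"]) (auto intro!: continuous_intros simp: exp_minus)
qed

lemma log_equiv_mult:
  assumes "log_equiv S f g" "log_equiv S f' g'"
  shows "log_equiv S (\<lambda>x. f x * f' x) (\<lambda>x. g x * g' x)"
proof -
  obtain q q' where "continuous_on S q" "\<forall>x\<in>S. f x = g x * exp (q x)"
    "continuous_on S q'" "\<forall>x\<in>S. f' x = g' x * exp (q' x)"
    using assms unfolding log_equiv_def by blast
  then show ?thesis
    unfolding log_equiv_def
    by (intro exI[of _ "\<lambda>x. q x + q' x"]) (auto intro!: continuous_intros simp: exp_add)
qed

lemma log_equiv_trans [trans]:
  assumes "log_equiv S f g" "log_equiv S g g'"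
  shows "log_equiv S f g'"
proof -
  obtain q q' where "continuous_on S q" "\<forall>x\<in>S. f x = g x * exp (q x)"
    "continuous_on S q'" "\<forall>x\<in>S. g x = g' x * exp (q' x)"
    using assms unfolding log_equiv_def by blast
  then show ?thesis
    unfolding log_equiv_def
    by (intro exI[of _ "\<lambda>x. q x + q' x"]) (auto intro!: continuous_intros simp: exp_add)
qed

lemma log_equiv_inverse:
  assumes "log_equiv S f g"
  shows "log_equiv S (\<lambda>x. inverse (f x)) (\<lambda>x. inverse (g x))"
proof -
  obtain q where "continuous_on S q" "\<forall>x\<in>S. f x = g x * exp (q x)"
    using assms unfolding log_equiv_def by blast
  then show ?thesis
    unfolding log_equiv_def
    by (intro exI[of _ "\<lambda>x. - q x"]) (auto intro!: continuous_intros simp: exp_minus)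
qed

lemma log_equiv_divide:
  assumes "log_equiv S f g" "log_equiv S f' g'"
  shows "log_equiv S (\<lambda>x. f x / f' x) (\<lambda>x. g x / g' x)"
  using log_equiv_mult[OF assms(1) log_equiv_inverse[OF assms(2)]] by (simp add: divide_inverse)

lemma log_equiv_prod:
  assumes "finite I" "\<And>i. i \<in> I \<Longrightarrow> log_equiv S (f i) (g i)"
  shows "log_equiv S (\<lambda>x. \<Prod>i\<in>I. f i x) (\<lambda>x. \<Prod>i\<in>I. g i x)"
  using assms by (induction I rule: finite_induct) (auto intro: log_equiv_mult)

lemma log_equiv_const:
  assumes "c \<noteq> 0" "d \<noteq> 0"
  shows "log_equiv S (\<lambda>_. c) (\<lambda>_. d)"
  using assms unfolding log_equiv_def by (intro exI[of _ "\<lambda>_. Ln (c / d)"]) auto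

text \<open>Dividing the homotopy by its final stage turns it into a homotopy to the constant 1. A
  map into the punctured plane is homotopic to a constant exactly if it has a continuous
  logarithm.\<close>

lemma log_equiv_homotopy:
  assumes "continuous_on ({0..1::real} \<times> S) H"
    and "\<And>t x. t \<in> {0..1} \<Longrightarrow> x \<in> S \<Longrightarrow> H (t, x) \<noteq> 0"
  shows "log_equiv S (\<lambda>x. H (0, x)) (\<lambda>x. H (1, x))"
proof -
  define K where "K = (\<lambda>z. H z / H (1, snd z))"
  have c1: "continuous_on ({0..1::real} \<times> S) (\<lambda>z. H (1, snd z))"
    by (rule continuous_on_compose2[OF assms(1)]) (auto intro!: continuous_intros)
  have cK: "continuous_on ({0..1} \<times> S) K"
    unfolding K_def by (rule continuous_on_divide[OF assms(1) c1]) (use assms(2) in auto)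
  have "homotopic_with_canon (\<lambda>h. True) S (-{0}) (\<lambda>x. K (0, x)) (\<lambda>x. K (1, x))"
    unfolding homotopic_with_def
    by (rule exI[of _ K]) (use cK assms(2) in
        \<open>auto simp: prod_topology_subtopology_eu K_def Pi_iff\<close>)
  then have "homotopic_with_canon (\<lambda>h. True) S (-{0}) (\<lambda>x. K (0, x)) (\<lambda>_. 1)"
    by (rule homotopic_with_eq) (use assms(2)[of 1] in \<open>auto simp: K_def\<close>)
  then obtain g where "continuous_on S g" "\<forall>x\<in>S. K (0, x) = exp (g x)"
    using inessential_eq_continuous_logarithm[THEN iffD1, OF exI] by metis
  then show ?thesis
    unfolding log_equiv_def using assms(2)[of 1]
    by (intro exI[of _ g]) (auto simp: K_def field_simps)
qed

text \<open>While the base point moves along a path in \<open>T\<close>, the difference never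
  vanishes, since \<open>T\<close> misses the values of \<open>f\<close>.\<close>

lemma log_equiv_connected:
  assumes f: "continuous_on S f" and T: "open T" "connected T" "a \<in> T" "b \<in> T" "f ` S \<inter> T = {}"
  shows "log_equiv S (\<lambda>x. f x - a) (\<lambda>x. f x - b)"
proof -
  have "path_connected T"
    using T by (simp add: connected_open_path_connected)
  then obtain \<gamma> where \<gamma>: "path \<gamma>" "path_image \<gamma> \<subseteq> T" "pathstart \<gamma> = a" "pathfinish \<gamma> = b"
    using T unfolding path_connected_def by blast
  define H where "H = (\<lambda>z. f (snd z) - \<gamma> (fst z))"
  have "log_equiv S (\<lambda>x. H (0, x)) (\<lambda>x. H (1, x))"
  proof (rule log_equiv_homotopy)
    have "continuous_on ({0..1} \<times> S) (\<lambda>z. f (snd z))"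
      by (rule continuous_on_compose2[OF f continuous_on_snd[OF continuous_on_id]]) auto
    moreover have "continuous_on ({0..1} \<times> S) (\<lambda>z. \<gamma> (fst z))"
      using \<gamma>(1) unfolding path_def
      by (rule continuous_on_compose2[OF _ continuous_on_fst[OF continuous_on_id]]) auto
    ultimately show "continuous_on ({0..1} \<times> S) H"
      unfolding H_def by (rule continuous_on_diff)
    fix t :: real and x assume t: "t \<in> {0..1}" "x \<in> S"
    then have "\<gamma> t \<in> T"
      using \<gamma>(2) by (auto simp: path_image_def)
    then show "H (t, x) \<noteq> 0"
      using T(5) t(2) by (auto simp: H_def)
  qed
  then show ?thesis
    using \<gamma> by (simp add: H_def pathstart_def pathfinish_def)
qed

text \<open>A base point that can escape to infinity without meeting the values of \<open>f\<close>
  sees no winding: move it to a \<open>c\<close> larger than all values, then shrink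
  \<open>f\<close> to 0.\<close>

lemma log_equiv_unbounded_connected:
  assumes f: "continuous_on S f" and "compact S"
    and D: "connected D" "\<not> bounded D" "b \<in> D" "f ` S \<inter> D = {}"
  shows "log_equiv S (\<lambda>x. f x - b) (\<lambda>_. 1)"
proof -
  have cpt: "compact (f ` S)"
    using f \<open>compact S\<close> by (rule compact_continuous_image)
  then obtain B where B: "\<And>x. x \<in> S \<Longrightarrow> norm (f x) \<le> B"
    using compact_imp_bounded bounded_iff by (metis imageI)
  obtain c where c: "c \<in> D" "norm c > max B 0"
    using D(2) unfolding bounded_iff by (metis not_le)
  \<comment> \<open>\<open>D\<close> need not be open, hence need not contain paths. The component
    around it in the complement of the compact image is open.\<close>
  define T where "T = connected_component_set (- f ` S) b"
  have "open T"
    unfolding T_def using cpt by (simp add: open_connected_component compact_imp_closed open_Compl)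
  moreover have "D \<subseteq> T"
    unfolding T_def using D by (intro connected_component_maximal) auto
  moreover have "T \<subseteq> - f ` S"
    unfolding T_def by (rule connected_component_subset)
  ultimately have "log_equiv S (\<lambda>x. f x - b) (\<lambda>x. f x - c)"
    using D(3) c(1) by (intro log_equiv_connected[OF f, of T]) (auto simp: T_def)
  also have "log_equiv S (\<lambda>x. f x - c) (\<lambda>_. - c)"
  proof -
    define H where "H = (\<lambda>z. of_real (1 - fst z) * f (snd z) - c)"
    have "log_equiv S (\<lambda>x. H (0, x)) (\<lambda>x. H (1, x))"
    proof (rule log_equiv_homotopy)
      have "continuous_on ({0..1} \<times> S) (\<lambda>z. f (snd z))"
        by (rule continuous_on_compose2[OF f continuous_on_snd[OF continuous_on_id]]) auto
      then show "continuous_on ({0..1} \<times> S) H"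
        unfolding H_def by (intro continuous_intros)
      show "H (t, x) \<noteq> 0" if "t \<in> {0..1}" "x \<in> S" for t x
      proof -
        have "norm (of_real (1 - t) * f x) \<le> 1 * norm (f x)"
          unfolding norm_mult norm_of_real using that by (intro mult_right_mono) auto
        also have "\<dots> < norm c"
          using B[OF that(2)] c(2) by simp
        finally show ?thesis by (auto simp: H_def)
      qed
    qed
    then show ?thesis by (simp add: H_def)
  qed
  also have "log_equiv S (\<lambda>_. - c) (\<lambda>_. 1)"
    using c(2) by (intro log_equiv_const) auto
  finally show ?thesis .
qed

text \<open>Along the circle, \<open>d\<close> compares the given logarithm with \<open>m\<close>
  times the angle. Its exponential is constant, so distinct values of \<open>d\<close> are at least
  2 pi apart and \<open>d\<close> is constant. As the circle closes up after 2 pi, \<open>m\<close>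
  times the angle must do so too.\<close>

lemma exp_circle_power_int_zero:
  fixes l :: "complex \<Rightarrow> complex"
  assumes l: "continuous_on UNIV l" and "R > 0"
    and eq: "\<And>z. norm (z - a) = R \<Longrightarrow> (z - a) powi m = exp (l z)"
  shows "m = 0"
proof -
  define \<gamma> where "\<gamma> = (\<lambda>t::real. a + of_real R * exp (\<i> * of_real t))"
  define d where "d = (\<lambda>t. l (\<gamma> t) - of_int m * (\<i> * of_real t))"
  have cd: "continuous_on UNIV d"
    unfolding d_def \<gamma>_def by (intro continuous_intros continuous_on_compose2[OF l]) auto
  have exp_d: "exp (d t) = of_real R powi m" for t
  proof -
    have "exp (l (\<gamma> t)) = (\<gamma> t - a) powi m"
      using \<open>R > 0\<close> by (intro eq[symmetric]) (auto simp: \<gamma>_def norm_mult)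
    also have "\<dots> = of_real R powi m * exp (of_int m * (\<i> * of_real t))"
      by (simp add: \<gamma>_def power_int_mult_distrib exp_power_int)
    finally show ?thesis
      by (simp add: d_def exp_diff)
  qed
  have "d constant_on UNIV"
  proof (rule continuous_discrete_range_constant[OF _ cd])
    fix t :: real
    show "\<exists>e>0. \<forall>y. y \<in> UNIV \<and> d y \<noteq> d t \<longrightarrow> e \<le> norm (d y - d t)"
    proof (intro exI[of _ "2 * pi"] conjI allI impI)
      fix y assume "y \<in> UNIV \<and> d y \<noteq> d t"
      moreover have "exp (d y) = exp (d t)"
        by (simp add: exp_d)
      then obtain n :: int where n: "d y = d t + of_int (2 * n) * pi * \<i>"
        unfolding exp_eq by blast
      ultimately have "n \<noteq> 0" by auto
      then have "1 \<le> \<bar>real_of_int n\<bar>" by simp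
      then show "2 * pi \<le> norm (d y - d t)"
        using n by (simp add: norm_mult)
    qed simp
  qed auto
  then have "d 0 = d (2 * pi)"
    unfolding constant_on_def by auto
  moreover have "\<gamma> 0 = \<gamma> (2 * pi)"
    unfolding \<gamma>_def by (simp add: cis_2pi flip: cis_conv_exp del: of_real_mult)
  ultimately show "m = 0"
    by (simp add: d_def)
qed

text \<open>This stands in for the degree of a map on a parametrized curve. A logarithm on
  \<open>K - U\<close> extends continuously to the plane, so \<open>(z - a) powi m\<close> outside
  \<open>U\<close> can be continued over \<open>U\<close> without zeros. The result has a logarithm
  on the whole plane, and a circle around \<open>K\<close> forces \<open>m = 0\<close>.\<close>

lemma log_equiv_power_int_trivial:
  assumes "open U" "a \<in> U" "bounded U" "compact K" "U \<subseteq> K"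
    and le: "log_equiv (K - U) (\<lambda>z. (z - a) powi m) (\<lambda>_. 1)"
  shows "m = 0"
proof -
  obtain q where q: "continuous_on (K - U) q" "\<And>z. z \<in> K - U \<Longrightarrow> (z - a) powi m = exp (q z)"
    using le unfolding log_equiv_def by auto
  have "closed (K - U)"
    using assms by (simp add: compact_imp_closed closed_Diff)
  then have "closedin (top_of_set UNIV) (K - U)"
    by simp
  then obtain q' where q': "continuous_on UNIV q'" "\<And>z. z \<in> K - U \<Longrightarrow> q' z = q z"
    by (rule Dugundji[OF convex_UNIV UNIV_not_empty _ q(1) subset_UNIV]) blast
  define f where "f = (\<lambda>z. if z \<in> K then exp (q' z) else (z - a) powi m)"
  have "continuous_on (K \<union> - U) f"
    unfolding f_def
  proof (rule continuous_on_cases)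
    show "closed K" "closed (- U)"
      using assms by (auto simp: compact_imp_closed closed_Compl)
    show "continuous_on K (\<lambda>z. exp (q' z))"
      by (intro continuous_intros continuous_on_subset[OF q'(1)]) auto
    show "continuous_on (- U) (\<lambda>z. (z - a) powi m)"
      using assms by (intro continuous_intros) auto
  qed (use q q' in auto)
  moreover have "K \<union> - U = UNIV"
    using assms by auto
  ultimately have "continuous_on UNIV f" by simp
  moreover have "f z \<noteq> 0" for z
    using assms by (auto simp: f_def)
  ultimately obtain l where l: "continuous_on UNIV l" "\<And>z. f z = exp (l z)"
    using continuous_logarithm_on_contractible[OF _ convex_imp_contractible[OF convex_UNIV]]
    by (metis UNIV_I)
  obtain R where R: "R > 0" "K \<subseteq> ball a R"
    using bounded_subset_ballD[OF compact_imp_bounded[OF \<open>compact K\<close>]] by blast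
  show ?thesis
  proof (rule exp_circle_power_int_zero[OF l(1) R(1)])
    fix z assume "norm (z - a) = R"
    then have "z \<notin> K"
      using R by (auto simp: dist_norm norm_minus_commute)
    then show "(z - a) powi m = exp (l z)"
      using l(2)[of z] by (simp add: f_def)
  qed
qed

text \<open>The jump of \<open>Ln\<close> at its cut depends only on the side of approach, so equal
  sides make the jumps cancel. Concretely, \<open>- f x\<close> and \<open>- g x\<close> stay off
  the cut, and passing to them shifts both logarithms by the same multiple of i pi.\<close>

lemma continuous_within_Ln_diff:
  fixes f g :: "'a::t2_space \<Rightarrow> complex"
  assumes f: "continuous (at p within S) f" "Im (f p) = 0" "Re (f p) < 0"
    and g: "continuous (at p within S) g" "Im (g p) = 0" "Re (g p) < 0"
    and sgn: "\<forall>\<^sub>F x in at p within S. sgn (Im (f x)) = sgn (Im (g x))"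
  shows "continuous (at p within S) (\<lambda>x. Ln (f x) - Ln (g x))"
proof -
  have Ln_neg: "Ln (- z) = (if Im z < 0 then Ln z + \<i> * pi else Ln z - \<i> * pi)" if "Re z < 0" for z
  proof -
    from that have "z \<noteq> 0" by auto
    then show ?thesis
      using that Ln_minus[of z] by auto
  qed
  have eq: "Ln (- z) - Ln (- w) = Ln z - Ln w"
    if "Re z < 0" "Re w < 0" "sgn (Im z) = sgn (Im w)" for z w
  proof -
    have "Im z < 0 \<longleftrightarrow> Im w < 0"
      using that(3) by (metis sgn_less)
    then show ?thesis
      using that(1,2) by (simp add: Ln_neg)
  qed
  have neg: "\<forall>\<^sub>F x in at p within S. Re (h x) < 0"
    if "continuous (at p within S) h" "Re (h p) < 0" for h :: "'a \<Rightarrow> complex"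
    using that by (intro order_tendstoD(2)[of "\<lambda>x. Re (h x)" "Re (h p)"] tendsto_intros)
      (auto simp: continuous_within)
  have "((\<lambda>x. Ln (- f x) - Ln (- g x)) \<longlongrightarrow> Ln (- f p) - Ln (- g p)) (at p within S)"
    using f g by (intro tendsto_intros)
      (auto simp: continuous_within complex_nonpos_Reals_iff)
  moreover have "\<forall>\<^sub>F x in at p within S. Ln (- f x) - Ln (- g x) = Ln (f x) - Ln (g x)"
    using sgn neg[OF f(1,3)] neg[OF g(1,3)] by eventually_elim (rule eq)
  ultimately have "((\<lambda>x. Ln (f x) - Ln (g x)) \<longlongrightarrow> Ln (- f p) - Ln (- g p)) (at p within S)"
    by (rule Lim_transform_eventually)
  moreover have "Ln (- f p) - Ln (- g p) = Ln (f p) - Ln (g p)"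
    using f g by (intro eq) auto
  ultimately show ?thesis
    unfolding continuous_within by simp
qed

text \<open>Seen from \<open>x\<close>, the points \<open>b\<close> and \<open>b'\<close> lie in
  opposite directions. So a Moebius function takes values on the branch cut only between its zero
  and its pole.\<close>

lemma quotient_nonpos_imp_segment:
  fixes x b b' :: complex
  assumes "(x - b) / (x - b') \<in> \<real>\<^sub>\<le>\<^sub>0" "x \<noteq> b'"
  shows "x \<in> closed_segment b b'"
proof -
  obtain r where r: "(x - b) / (x - b') = of_real r" "r \<le> 0"
    using assms(1) by (elim nonpos_Reals_cases)
  then have "x - b = of_real r * (x - b')"
    using assms(2) by (simp add: field_simps)
  then have "(1 - r) *\<^sub>R x = b - r *\<^sub>R b'"
    by (simp add: scaleR_conv_of_real algebra_simps)
  then have "x = (1 / (1 - r)) *\<^sub>R (b - r *\<^sub>R b')"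
    using r(2) by (metis diff_gt_0_iff_gt le_less_trans less_irrefl scaleR_one scaleR_scaleR
        nonzero_eq_divide_eq zero_less_one)
  also have "\<dots> = (1 - (- r / (1 - r))) *\<^sub>R b + (- r / (1 - r)) *\<^sub>R b'"
  proof -
    have "1 - (- r / (1 - r)) = 1 / (1 - r)"
      using r(2) by (simp add: field_simps)
    then show ?thesis
      unfolding \<open>1 - (- r / (1 - r)) = 1 / (1 - r)\<close> by (simp add: scaleR_diff_right)
  qed
  finally have "x = (1 - (- r / (1 - r))) *\<^sub>R b + (- r / (1 - r)) *\<^sub>R b'" .
  moreover have "0 \<le> - r / (1 - r)" "- r / (1 - r) \<le> 1"
    using r(2) by (simp_all add: field_simps)
  ultimately show ?thesis
    unfolding in_segment by blast
qed

lemma nonpos_Reals_divide_commute: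
  fixes z w :: complex
  shows "z / w \<in> \<real>\<^sub>\<le>\<^sub>0 \<longleftrightarrow> w / z \<in> \<real>\<^sub>\<le>\<^sub>0"
  by (metis inverse_divide nonpos_Reals_inverse_iff)

lemma sgn_Im_divide: "sgn (Im (z / w)) = sgn (Im (z * cnj w))"
proof (cases "w = 0")
  case False
  then have "(Re w)\<^sup>2 + (Im w)\<^sup>2 > 0"
    by (simp add: complex_eq_iff sum_power2_gt_zero_iff)
  then show ?thesis
    by (simp add: Im_divide sgn_divide)
qed simp

text \<open>On the straight segment from \<open>f x\<close> to \<open>g x\<close> the inner product
  with \<open>g x\<close> stays positive, so the segment avoids 0.\<close>

lemma log_equiv_inner_pos:
  assumes "continuous_on S f" "continuous_on S g" "\<And>x. x \<in> S \<Longrightarrow> Re (f x * cnj (g x)) > 0"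
  shows "log_equiv S f g"
proof -
  define H where "H = (\<lambda>z. of_real (1 - fst z) * f (snd z) + of_real (fst z) * g (snd z))"
  have "log_equiv S (\<lambda>x. H (0, x)) (\<lambda>x. H (1, x))"
  proof (rule log_equiv_homotopy)
    have "continuous_on ({0..1} \<times> S) (\<lambda>z. f (snd z))" "continuous_on ({0..1} \<times> S) (\<lambda>z. g (snd z))"
      by (rule continuous_on_compose2[OF _ continuous_on_snd[OF continuous_on_id]], use assms in auto)+
    then show "continuous_on ({0..1} \<times> S) H"
      unfolding H_def by (intro continuous_intros)
    fix t :: real and x assume t: "t \<in> {0..1}" "x \<in> S"
    then have "g x \<noteq> 0"
      using assms(3)[OF t(2)] by auto
    then have pos: "Re (f x * cnj (g x)) > 0" "Re (g x * cnj (g x)) > 0"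
      using assms(3)[OF t(2)]
      by (auto simp: complex_eq_iff sum_power2_gt_zero_iff simp flip: power2_eq_square)
    have "Re (H (t, x) * cnj (g x)) = (1 - t) * Re (f x * cnj (g x)) + t * Re (g x * cnj (g x))"
      by (simp add: H_def algebra_simps)
    also have "\<dots> > 0"
    proof (cases "t = 0")
      case False
      then show ?thesis
        using t pos by (intro add_nonneg_pos mult_nonneg_nonneg mult_pos_pos) auto
    qed (use pos in auto)
    finally show "H (t, x) \<noteq> 0" by auto
  qed
  then show ?thesis
    by (simp add: H_def)
qed

text \<open>A field \<open>n\<close> along \<open>K - U\<close> whose negative points into \<open>U\<close> pushes \<open>K - U\<close> into the
  contractible set \<open>U\<close>; contracting the pushed copy to a point shows at the same time that \<open>n\<close>
  turns like \<open>z - a\<close>, which replaces Hopf's theorem on turning tangents, and that a field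
  without zeros in \<open>K\<close> does not turn at all.\<close>

lemma
  fixes U K :: "complex set" and n F :: "complex \<Rightarrow> complex"
  assumes U: "open U" "connected U" "bounded U" "U \<noteq> {}" "connected (- U)"
    and K: "compact K" "U \<subseteq> K"
    and n: "continuous_on (K - U) n" "e > 0"
      "\<And>x t. x \<in> K - U \<Longrightarrow> 0 < t \<Longrightarrow> t \<le> e \<Longrightarrow> x - of_real t * n x \<in> U"
    and a: "a \<in> U"
  shows log_equiv_normal: "log_equiv (K - U) n (\<lambda>x. x - a)"
    and log_equiv_nonvanishing:
      "continuous_on K F \<Longrightarrow> (\<And>x. x \<in> K \<Longrightarrow> F x \<noteq> 0) \<Longrightarrow> log_equiv (K - U) F (\<lambda>_. 1)"
    and log_equiv_outside: "b' \<notin> K \<Longrightarrow> log_equiv (K - U) (\<lambda>x. x - b') (\<lambda>_. 1)"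
proof -
  define y where "y = (\<lambda>x. x - of_real e * n x)"
  have yU: "y x \<in> U" if "x \<in> K - U" for x
    using n that by (auto simp: y_def)
  have cy: "continuous_on (K - U) y"
    unfolding y_def by (intro continuous_intros n)
  have cy2: "continuous_on ({0..1::real} \<times> (K - U)) (\<lambda>z. y (snd z))"
    by (rule continuous_on_compose2[OF cy continuous_on_snd[OF continuous_on_id]]) auto
  define s where "s = (\<lambda>z::real \<times> complex. snd z - of_real (fst z * e) * n (snd z))"
  have cs: "continuous_on ({0..1} \<times> (K - U)) s"
  proof -
    have "continuous_on ({0..1::real} \<times> (K - U)) (\<lambda>z. n (snd z))"
      by (rule continuous_on_compose2[OF n(1) continuous_on_snd[OF continuous_on_id]]) auto
    then show ?thesis
      unfolding s_def by (intro continuous_intros)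
  qed
  have sK: "s (t, x) \<in> K" if "t \<in> {0..1}" "x \<in> K - U" for t x
  proof (cases "t = 0")
    case False
    then have "s (t, x) \<in> U"
      unfolding s_def fst_conv snd_conv using that n(2)
      by (intro n(3)) (auto simp: mult_le_cancel_right1)
    then show ?thesis using K by auto
  qed (use that in \<open>auto simp: s_def\<close>)
  \<comment> \<open>For a bounded open connected set in the plane, a connected complement means
    simple connectedness, hence contractibility.\<close>
  have "contractible U"
    using U simply_connected_iff_simple contractible_eq_simply_connected_2d by blast
  then obtain c where "homotopic_with_canon (\<lambda>_. True) U U id (\<lambda>_. c)"
    unfolding contractible_def by blast
  then obtain G where cont_G: "continuous_on ({0..1::real} \<times> U) G"
    and "\<forall>t\<in>{0..1}. \<forall>x\<in>U. G (t, x) \<in> U" "\<forall>x. G (0, x) = x" "\<forall>x. G (1, x) = c"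
    unfolding homotopic_with_def
    by (auto simp: prod_topology_subtopology_eu Pi_iff continuous_map_in_subtopology)
  then have G: "\<And>t x. t \<in> {0..1} \<Longrightarrow> x \<in> U \<Longrightarrow> G (t, x) \<in> U"
    "\<And>x. G (0, x) = x" "\<And>x. G (1, x) = c"
    by blast+
  have cU: "c \<in> U"
    using G(1)[of 1 a] G(3) a by auto
  have cG: "continuous_on ({0..1} \<times> (K - U)) (\<lambda>z. G (fst z, y (snd z)))"
    by (rule continuous_on_compose2[OF cont_G])
      (use yU in \<open>auto intro!: continuous_on_Pair cy2 continuous_intros\<close>)

  show "log_equiv (K - U) n (\<lambda>x. x - a)"
  proof -
    \<comment> \<open>At time 0 this is \<open>of_real e * n x\<close>, at time 1 it is
      \<open>x - c\<close>. It never vanishes, because \<open>x\<close> lies outside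
      \<open>U\<close> and the contraction stays in \<open>U\<close>.\<close>
    define H where "H = (\<lambda>z. snd z - G (fst z, y (snd z)))"
    have "log_equiv (K - U) (\<lambda>x. H (0, x)) (\<lambda>x. H (1, x))"
    proof (rule log_equiv_homotopy)
      show "continuous_on ({0..1} \<times> (K - U)) H"
        unfolding H_def by (intro continuous_on_diff cG) (auto intro!: continuous_intros)
      show "H (t, x) \<noteq> 0" if "t \<in> {0..1}" "x \<in> K - U" for t x
        using G(1)[OF that(1) yU[OF that(2)]] that by (auto simp: H_def)
    qed
    then have 1: "log_equiv (K - U) (\<lambda>x. of_real e * n x) (\<lambda>x. x - c)"
      by (simp add: H_def G y_def)
    have "log_equiv (K - U) (\<lambda>x. inverse (of_real e) * (of_real e * n x)) (\<lambda>x. 1 * (x - c))"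
      using n(2) by (intro log_equiv_mult 1 log_equiv_const) auto
    then have "log_equiv (K - U) n (\<lambda>x. x - c)"
      using n(2) by (simp add: mult.assoc[symmetric])
    also have "log_equiv (K - U) (\<lambda>x. x - c) (\<lambda>x. x - a)"
      by (rule log_equiv_connected[of _ "\<lambda>x. x" U])
        (use U a cU in \<open>auto intro: continuous_intros\<close>)
    finally show ?thesis .
  qed

  show "log_equiv (K - U) F (\<lambda>_. 1)" if F: "continuous_on K F" "\<And>x. x \<in> K \<Longrightarrow> F x \<noteq> 0"
  proof -
    have "log_equiv (K - U) (\<lambda>x. (F \<circ> s) (0, x)) (\<lambda>x. (F \<circ> s) (1, x))"
    proof (rule log_equiv_homotopy)
      show "continuous_on ({0..1} \<times> (K - U)) (F \<circ> s)"
        unfolding o_def by (rule continuous_on_compose2[OF F(1) cs]) (use sK in auto)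
    qed (use F sK in auto)
    then have "log_equiv (K - U) F (\<lambda>x. F (y x))"
      by (simp add: s_def y_def)
    also have "log_equiv (K - U) (\<lambda>x. F (y x)) (\<lambda>_. F c)"
    proof -
      define H where "H = (\<lambda>z. F (G (fst z, y (snd z))))"
      have GK: "G (t, y x) \<in> K" if "t \<in> {0..1}" "x \<in> K - U" for t x
        using G(1)[OF that(1) yU[OF that(2)]] K by auto
      have "log_equiv (K - U) (\<lambda>x. H (0, x)) (\<lambda>x. H (1, x))"
      proof (rule log_equiv_homotopy)
        show "continuous_on ({0..1} \<times> (K - U)) H"
          unfolding H_def by (rule continuous_on_compose2[OF F(1) cG]) (use GK in auto)
      qed (use F GK in \<open>auto simp: H_def\<close>)
      then show ?thesis
        by (simp add: H_def G)
    qed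
    also have "log_equiv (K - U) (\<lambda>_. F c) (\<lambda>_. 1)"
      using F cU K by (intro log_equiv_const) auto
    finally show ?thesis .
  qed

  show "log_equiv (K - U) (\<lambda>x. x - b') (\<lambda>_. 1)" if b': "b' \<notin> K"
  proof -
    define H where "H = (\<lambda>z. s z - b')"
    have "log_equiv (K - U) (\<lambda>x. H (0, x)) (\<lambda>x. H (1, x))"
    proof (rule log_equiv_homotopy)
      show "continuous_on ({0..1} \<times> (K - U)) H"
        unfolding H_def by (intro continuous_intros cs)
    qed (use sK b' in \<open>auto simp: H_def\<close>)
    then have "log_equiv (K - U) (\<lambda>x. x - b') (\<lambda>x. y x - b')"
      by (simp add: H_def s_def y_def)
    \<comment> \<open>All values of \<open>y\<close> lie in \<open>U\<close>, so \<open>b'\<close>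
      can escape through the connected unbounded set \<open>- U\<close>.\<close>
    also have "log_equiv (K - U) (\<lambda>x. y x - b') (\<lambda>_. 1)"
    proof (rule log_equiv_unbounded_connected[OF cy])
      show "compact (K - U)"
        using K U by (intro compact_diff)
      show "\<not> bounded (- U)"
        using U(3) by (metis bounded_Un Compl_partition not_bounded_UNIV)
    qed (use U K b' yU in auto)
    finally show ?thesis .
  qed
qed

section \<open>Signed crossings of the negative real axis\<close>

lemma power_int_sum:
  fixes x :: "'a::field"
  assumes "x \<noteq> 0"
  shows "x powi (\<Sum>i\<in>I. f i) = (\<Prod>i\<in>I. x powi f i)"
  using assms by (induction I rule: infinite_finite_induct) (auto simp: power_int_add)

text \<open>The field \<open>n\<close> points out of \<open>U\<close>, so a crossing with
  \<open>sg p = 1\<close> goes, counterclockwise along the curve, from negative to positive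
  imaginary part, which is clockwise about 0. The winding number of \<open>F / W\<close> is
  therefore minus the sum of the signs.\<close>

lemma sum_crossing_signs:
  fixes U K E :: "complex set" and n F W :: "complex \<Rightarrow> complex" and sg :: "complex \<Rightarrow> int"
  assumes U: "open U" "connected U" "bounded U" "U \<noteq> {}" "connected (- U)"
    and K: "compact K" "U \<subseteq> K"
    and n: "continuous_on (K - U) n" "e > 0"
      "\<And>x t. x \<in> K - U \<Longrightarrow> 0 < t \<Longrightarrow> t \<le> e \<Longrightarrow> x - of_real t * n x \<in> U"
    and F: "continuous_on K F" "\<And>x. x \<in> K \<Longrightarrow> F x \<noteq> 0"
    and W: "continuous_on (K - U) W" "\<And>x. x \<in> K - U \<Longrightarrow> Re (W x * cnj (n x)) > 0"
    and E: "finite E" "E \<subseteq> K - U" "\<And>x. x \<in> K - U \<Longrightarrow> F x / W x \<in> \<real>\<^sub>\<le>\<^sub>0 \<longleftrightarrow> x \<in> E"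
    and sg: "\<And>p. p \<in> E \<Longrightarrow> sg p = 1 \<or> sg p = -1"
      "\<And>p. p \<in> E \<Longrightarrow> \<forall>\<^sub>F x in at p within K - U.
        sgn (Im (F x / W x)) = of_int (sg p) * sgn (Im (cnj (n p) * (x - p)))"
    and \<eta>: "\<And>p. p \<in> E \<Longrightarrow> \<eta> p > 0 \<and> p - of_real (\<eta> p) * n p \<in> U \<and> p + of_real (\<eta> p) * n p \<notin> K \<and>
        (K - U) \<inter> closed_segment (p - of_real (\<eta> p) * n p) (p + of_real (\<eta> p) * n p) \<subseteq> {p}"
  shows "(\<Sum>p\<in>E. sg p) = 1"
proof -
  obtain a where a: "a \<in> U" using U by auto
  \<comment> \<open>Zero and pole of the model crossing at \<open>p\<close>: the ends of a normal
    segment centred at \<open>p\<close>, one inside \<open>U\<close> and one outside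
    \<open>K\<close>.\<close>
  define b where "b p = p - of_real (\<eta> p) * n p" for p
  define b' where "b' p = p + of_real (\<eta> p) * n p" for p
  have b: "b p \<in> U" "b' p \<notin> K" if "p \<in> E" for p
    using \<eta>[OF that] by (auto simp: b_def b'_def)
  \<comment> \<open>Only the factor with base point in \<open>U\<close> winds, so \<open>N p\<close>
    winds like \<open>(x - a) powi (- sg p)\<close>. Since \<open>p\<close> is the midpoint of the
    segment, \<open>N p p = -1\<close>.\<close>
  define N where "N p x = (if sg p = 1 then (x - b' p) / (x - b p) else (x - b p) / (x - b' p))" for p x
  define \<Theta> where "\<Theta> x = F x / W x" for x
  have W0: "W x \<noteq> 0" if "x \<in> K - U" for x
    using W(2)[OF that] by auto
  have c\<Theta>: "continuous_on (K - U) \<Theta>"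
    unfolding \<Theta>_def by (intro continuous_intros W continuous_on_subset[OF F(1)]) (use W0 in auto)
  have ne: "x \<noteq> b p" "x \<noteq> b' p" if "p \<in> E" "x \<in> K - U" for x p
    using b[OF that(1)] that K by auto
  have cN: "continuous_on (K - U) (N p)" if "p \<in> E" for p
    unfolding N_def using ne[OF that] by (cases "sg p = 1") (auto intro!: continuous_intros)
  have N_cut: "N p x \<notin> \<real>\<^sub>\<le>\<^sub>0" if "p \<in> E" "x \<in> K - U" "x \<noteq> p" for p x
  proof
    assume "N p x \<in> \<real>\<^sub>\<le>\<^sub>0"
    then have "(x - b p) / (x - b' p) \<in> \<real>\<^sub>\<le>\<^sub>0"
      unfolding N_def using nonpos_Reals_divide_commute by (metis (full_types))
    then have "x \<in> closed_segment (b p) (b' p)"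
      using ne[OF that(1,2)] by (intro quotient_nonpos_imp_segment)
    then show False
      using \<eta>[OF that(1)] that by (auto simp: b_def b'_def)
  qed
  have N_p: "N p p = -1" if "p \<in> E" for p
  proof -
    have "n p \<noteq> 0" using W(2)[of p] E(2) that by auto
    then show ?thesis
      using \<eta>[OF that] by (simp add: N_def b_def b'_def)
  qed
  have sgn_N: "sgn (Im (N p x)) = of_int (sg p) * sgn (Im (cnj (n p) * (x - p)))" if "p \<in> E" for p x
  proof -
    have "Im ((x - b' p) * cnj (x - b p)) = 2 * \<eta> p * Im (cnj (n p) * (x - p))"
      "Im ((x - b p) * cnj (x - b' p)) = - (2 * \<eta> p * Im (cnj (n p) * (x - p)))"
      by (simp_all add: b_def b'_def algebra_simps)
    then show ?thesis
      using \<eta>[OF that] sg(1)[OF that]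
      by (auto simp: N_def sgn_Im_divide sgn_mult simp del: times_complex.sel)
  qed
  txt \<open>Across \<open>p\<close>, the values of \<open>\<Theta>\<close> and \<open>N p\<close> cross the branch cut of \<open>Ln\<close> in the same direction,
    so the jumps of their logarithms cancel.\<close>
  define q where "q x = Ln (\<Theta> x) - (\<Sum>p\<in>E. Ln (N p x))" for x
  have "continuous_on (K - U) q"
    unfolding continuous_on_eq_continuous_within
  proof
    fix x assume x: "x \<in> K - U"
    have \<Theta>': "continuous (at x within K - U) \<Theta>"
      using c\<Theta> x by (simp add: continuous_on_eq_continuous_within)
    have N': "continuous (at x within K - U) (N p)" if "p \<in> E" for p
      using cN[OF that] x by (simp add: continuous_on_eq_continuous_within)
    have LnN: "continuous (at x within K - U) (\<lambda>x. Ln (N p x))" if "p \<in> E" "p \<noteq> x" for p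
      using N'[OF that(1)] N_cut[OF that(1) x] that(2) unfolding continuous_within
      by (intro tendsto_intros) auto
    show "continuous (at x within K - U) q"
    proof (cases "x \<in> E")
      case False
      then have "\<Theta> x \<notin> \<real>\<^sub>\<le>\<^sub>0"
        using E(3)[OF x] by (simp add: \<Theta>_def)
      then have "continuous (at x within K - U) (\<lambda>x. Ln (\<Theta> x))"
        using \<Theta>' unfolding continuous_within by (intro tendsto_intros)
      then show ?thesis
        unfolding q_def using False by (intro continuous_intros LnN) auto
    next
      case True
      have "\<Theta> x \<in> \<real>\<^sub>\<le>\<^sub>0" "\<Theta> x \<noteq> 0"
        using E(3)[OF x] True F(2)[of x] W0[OF x] x by (auto simp: \<Theta>_def)
      then have "Im (\<Theta> x) = 0" "Re (\<Theta> x) < 0"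
        by (auto simp: complex_nonpos_Reals_iff complex_eq_iff)
      then have "continuous (at x within K - U) (\<lambda>y. Ln (\<Theta> y) - Ln (N x y))"
        using sg(2)[OF True] N_p[OF True]
        by (intro continuous_within_Ln_diff \<Theta>' N' True)
          (auto simp: sgn_N[OF True] \<Theta>_def simp del: times_complex.sel)
      moreover have "continuous (at x within K - U) (\<lambda>y. \<Sum>p\<in>E - {x}. Ln (N p y))"
        by (intro continuous_intros LnN) auto
      ultimately have "continuous (at x within K - U)
          (\<lambda>y. Ln (\<Theta> y) - Ln (N x y) - (\<Sum>p\<in>E - {x}. Ln (N p y)))"
        by (rule continuous_diff)
      moreover have "q = (\<lambda>y. Ln (\<Theta> y) - Ln (N x y) - (\<Sum>p\<in>E - {x}. Ln (N p y)))"
        by (rule ext) (simp add: q_def sum.remove[OF E(1) True])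
      ultimately show ?thesis by simp
    qed
  qed
  moreover have "\<Theta> x = (\<Prod>p\<in>E. N p x) * exp (q x)" if "x \<in> K - U" for x
  proof -
    have "\<Theta> x \<noteq> 0"
      using F(2)[of x] W0[OF that] that by (auto simp: \<Theta>_def)
    moreover have "N p x \<noteq> 0" if "p \<in> E" for p
      using ne[OF that \<open>x \<in> K - U\<close>] by (auto simp: N_def)
    ultimately show ?thesis
      using E(1) by (simp add: q_def exp_diff exp_sum)
  qed
  ultimately have "log_equiv (K - U) \<Theta> (\<lambda>x. \<Prod>p\<in>E. N p x)"
    unfolding log_equiv_def by blast
  also have "log_equiv (K - U) (\<lambda>x. \<Prod>p\<in>E. N p x) (\<lambda>x. \<Prod>p\<in>E. (x - a) powi (- sg p))"
  proof (rule log_equiv_prod[OF E(1)])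
    fix p assume p: "p \<in> E"
    have 1: "log_equiv (K - U) (\<lambda>x. x - b p) (\<lambda>x. x - a)"
      by (rule log_equiv_connected[of _ "\<lambda>x. x" U])
        (use U a b[OF p] in \<open>auto intro: continuous_intros\<close>)
    have 2: "log_equiv (K - U) (\<lambda>x. x - b' p) (\<lambda>_. 1)"
      by (rule log_equiv_outside[OF U K n a]) (use b[OF p] in auto)
    show "log_equiv (K - U) (N p) (\<lambda>x. (x - a) powi (- sg p))"
      using log_equiv_divide[OF 1 2] log_equiv_divide[OF 2 1] sg(1)[OF p]
      unfolding N_def by (auto simp: power_int_minus divide_inverse)
  qed
  also have "(\<lambda>x. \<Prod>p\<in>E. (x - a) powi (- sg p)) = (\<lambda>x. \<Prod>p\<in>E. inverse (x - a) powi (sg p))"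
    by (simp add: power_int_minus power_int_inverse)
  finally have 1: "log_equiv (K - U) \<Theta> (\<lambda>x. \<Prod>p\<in>E. inverse (x - a) powi (sg p))" .
  have "log_equiv (K - U) W n"
    by (rule log_equiv_inner_pos[OF W(1) n(1) W(2)])
  also have "log_equiv (K - U) n (\<lambda>x. x - a)"
    by (rule log_equiv_normal[OF U K n a])
  finally have "log_equiv (K - U) \<Theta> (\<lambda>x. 1 / (x - a))"
    unfolding \<Theta>_def by (intro log_equiv_divide log_equiv_nonvanishing[OF U K n a] F)
  then have "log_equiv (K - U) \<Theta> (\<lambda>x. inverse (x - a))"
    by (simp add: divide_inverse)
  \<comment> \<open>Dividing the two descriptions of \<open>\<Theta>\<close> leaves a power of
    \<open>x - a\<close> with a continuous logarithm, so its exponent is 0.\<close>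
  then have "log_equiv (K - U) (\<lambda>x. (\<Prod>p\<in>E. inverse (x - a) powi (sg p)) / inverse (x - a))
      (\<lambda>x. \<Theta> x / \<Theta> x)"
    by (rule log_equiv_divide[OF log_equiv_sym[OF 1] log_equiv_sym])
  then have "log_equiv (K - U) (\<lambda>x. (x - a) powi (1 - (\<Sum>p\<in>E. sg p))) (\<lambda>_. 1)"
  proof (rule log_equiv_cong)
    fix x assume x: "x \<in> K - U"
    then have "x \<noteq> a" using a by auto
    then have "(\<Prod>p\<in>E. inverse (x - a) powi (sg p)) = inverse (x - a) powi (\<Sum>p\<in>E. sg p)"
      by (simp add: power_int_sum)
    then show "(\<Prod>p\<in>E. inverse (x - a) powi (sg p)) / inverse (x - a) = (x - a) powi (1 - (\<Sum>p\<in>E. sg p))"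
      using \<open>x \<noteq> a\<close> by (simp add: power_int_diff power_int_inverse divide_inverse)
    show "\<Theta> x / \<Theta> x = 1"
      using F(2)[of x] W0[OF x] x by (auto simp: \<Theta>_def)
  qed
  then have "1 - (\<Sum>p\<in>E. sg p) = 0"
    by (rule log_equiv_power_int_trivial[OF U(1) a U(3) K])
  then show ?thesis by simp
qed

section \<open>Flow along a center manifold\<close>

lemma connected_nonzero_sign:
  fixes f :: "'a::topological_space \<Rightarrow> real"
  assumes "connected S" "continuous_on S f" "\<And>x. x \<in> S \<Longrightarrow> f x \<noteq> 0"
  shows "(\<forall>x\<in>S. f x > 0) \<or> (\<forall>x\<in>S. f x < 0)"
proof (rule ccontr)
  assume "\<not> ?thesis"
  then obtain x y where "x \<in> S" "y \<in> S" "f x \<le> 0" "f y \<ge> 0"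
    by (auto simp: not_less)
  moreover have "connected (f ` S)"
    using assms by (intro connected_continuous_image)
  ultimately have "0 \<in> f ` S"
    unfolding connected_iff_interval by blast
  then show False using assms(3) by auto
qed

text \<open>Separation of variables: \<open>H s\<close> is the time needed to go from
  \<open>s0\<close> to \<open>s\<close>, and the solution is its inverse. The linear bound on the
  speed makes this time at least \<open>(ln s0 - ln s) / L\<close>, which is unbounded near 0, so
  the solution lasts for all \<open>t \<ge> 0\<close> without reaching 0.\<close>

lemma scalar_ode_decreasing_solution:
  fixes \<rho> :: "real \<Rightarrow> real"
  assumes \<rho>: "continuous_on {0<..<r} \<rho>" "\<And>s. s \<in> {0<..<r} \<Longrightarrow> \<rho> s < 0"
    "\<And>s. s \<in> {0<..<r} \<Longrightarrow> - \<rho> s \<le> L * s"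
    and s0: "s0 \<in> {0<..<r}"
  obtains \<sigma> where "\<sigma> 0 = s0" "\<And>t. t \<ge> 0 \<Longrightarrow> \<sigma> t \<in> {0<..s0}"
    "\<And>t. t \<ge> 0 \<Longrightarrow> (\<sigma> has_real_derivative \<rho> (\<sigma> t)) (at t)"
proof -
  have "L * s0 > 0"
    using \<rho>(2,3)[OF s0] by linarith
  then have L: "L > 0"
    using s0 by (simp add: zero_less_mult_iff)
  have "isCont (\<lambda>s. 1 / \<rho> s) s" if "0 < s" "s < r" for s
    using \<rho>(1,2) that
    by (intro continuous_intros) (auto simp: continuous_on_eq_continuous_at dest: less_imp_neq)
  then obtain H0 where H0: "\<And>s. 0 < s \<Longrightarrow> s < r \<Longrightarrow> (H0 has_real_derivative 1 / \<rho> s) (at s)"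
    using einterval_antiderivative[of 0 r "\<lambda>s. 1 / \<rho> s"] s0
    by (auto simp: has_real_derivative_iff_has_vector_derivative)
  define H where "H s = H0 s - H0 s0" for s
  have H: "(H has_real_derivative 1 / \<rho> s) (at s)" if "s \<in> {0<..<r}" for s
    unfolding H_def using H0[of s] that by (auto intro!: derivative_eq_intros)
  have contH: "continuous_on {0<..<r} H"
    using H by (meson DERIV_isCont continuous_at_imp_continuous_on)
  have dec: "H s > H s'" if "0 < s" "s < s'" "s' < r" for s s'
    by (rule DERIV_neg_imp_decreasing_open[OF that(2)])
      (use H \<rho>(2) that in \<open>force, auto intro: continuous_on_subset[OF contH]\<close>)
  then have inj: "inj_on H {0<..<r}"
    by (auto simp: inj_on_def) (metis less_irrefl linorder_less_linear)
  have low: "H s \<ge> (ln s0 - ln s) / L" if "0 < s" "s \<le> s0" for s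
  proof -
    have "H s + ln s / L \<ge> H s0 + ln s0 / L"
    proof (rule DERIV_nonpos_imp_nonincreasing[OF that(2)])
      fix x assume x: "s \<le> x" "x \<le> s0"
      then have x': "x \<in> {0<..<r}" using that s0 by auto
      have "((\<lambda>s. H s + ln s / L) has_real_derivative 1 / \<rho> x + 1 / x / L) (at x)"
        using H[OF x'] x' L by (auto intro!: derivative_eq_intros)
      moreover have "1 / (L * x) \<le> 1 / (- \<rho> x)"
        using \<rho>(2,3)[OF x'] x' L by (intro divide_left_mono mult_pos_pos) auto
      then have "1 / \<rho> x + 1 / x / L \<le> 0"
        by (simp add: mult.commute)
      ultimately show "\<exists>y. ((\<lambda>s. H s + ln s / L) has_real_derivative y) (at x) \<and> y \<le> 0"
        by blast
    qed
    then show ?thesis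
      by (simp add: H_def diff_divide_distrib)
  qed
  define \<sigma> where "\<sigma> = inv_into {0<..<r} H"
  have ex: "\<exists>s \<in> {0<..s0}. H s = t" if "t \<ge> 0" for t
  proof -
    \<comment> \<open>The solution of \<open>s' = - L * s\<close> at time \<open>t\<close>, which
      bounds the sought solution from below.\<close>
    define s1 where "s1 = s0 * exp (- L * t)"
    have s1: "0 < s1" "s1 \<le> s0"
      using s0 L that by (auto simp: s1_def mult_le_cancel_left2)
    have "ln s1 = ln s0 - L * t"
      using s0 by (simp add: s1_def ln_mult)
    then have "H s1 \<ge> t"
      using low[OF s1] L by simp
    moreover have "H s0 \<le> t"
      using that by (simp add: H_def)
    moreover have "continuous_on {s1..s0} H"
      using s1 s0 by (intro continuous_on_subset[OF contH]) auto
    ultimately obtain s where "s1 \<le> s" "s \<le> s0" "H s = t"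
      using IVT2'[of H s0 t s1] s1 by auto
    then show ?thesis using s1 by auto
  qed
  have \<sigma>_H: "\<sigma> (H s) = s" if "s \<in> {0<..<r}" for s
    unfolding \<sigma>_def using inj that by (rule inv_into_f_f)
  show ?thesis
  proof
    show "\<sigma> 0 = s0"
      using \<sigma>_H[OF s0] by (simp add: H_def)
    fix t :: real assume "t \<ge> 0"
    then obtain s where s: "s \<in> {0<..s0}" "H s = t"
      using ex by blast
    then have s': "s \<in> {0<..<r}" using s0 by auto
    show "\<sigma> t \<in> {0<..s0}"
      using s \<sigma>_H[OF s'] by auto
    have "(\<sigma> has_real_derivative inverse (1 / \<rho> s)) (at (H s))"
      unfolding has_field_derivative_def
    proof (rule has_derivative_inverse_strong[of "{0<..<r}" s H \<sigma> "(*) (1 / \<rho> s)"])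
      show "(*) (1 / \<rho> s) \<circ> (*) (inverse (1 / \<rho> s)) = id"
        using \<rho>(2)[OF s'] by (auto simp: fun_eq_iff)
    qed (use s' contH \<sigma>_H H[OF s'] in \<open>auto simp: has_field_derivative_def\<close>)
    then show "(\<sigma> has_real_derivative \<rho> (\<sigma> t)) (at t)"
      using s \<sigma>_H[OF s'] by simp
  qed
qed

text \<open>Here \<open>y\<close> is the barrier function along a center manifold on which the flow runs towards the
  equilibrium, while the flow on the level set \<open>h = 0\<close> runs away from it, which is why the inward
  speed \<open>-\<rho>\<close> is at most of order \<open>\<bar>y\<bar>\<close>. Then \<open>s - K \<bar>y s\<bar>\<close> cannot increase with \<open>s\<close>, contradicting
  the tangency \<open>y s = o(s)\<close>.\<close>

lemma decay_along_inflow_contradiction: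
  fixes y \<rho> \<alpha> :: "real \<Rightarrow> real"
  assumes "r > 0"
    and y: "\<And>s. s \<in> {0<..<r} \<Longrightarrow> (y has_real_derivative - \<alpha> (y s) / \<rho> s) (at s)"
      "y 0 = 0" "(y has_real_derivative 0) (at 0)"
    and \<rho>: "\<And>s. s \<in> {0<..<r} \<Longrightarrow> \<rho> s < 0" "\<And>s. s \<in> {0<..<r} \<Longrightarrow> \<rho> s \<ge> - L * \<bar>y s\<bar>"
    and \<alpha>: "\<alpha> 0 = 0" "(\<alpha> has_real_derivative a) (at 0)" "a > 0"
  shows False
proof -
  \<comment> \<open>Near 0 we have \<open>\<alpha> u / u > a / 2\<close>, and
    \<open>K * (a / 2) = max L 1\<close> balances this against the bound on \<open>\<rho>\<close>.
    The maximum with 1 keeps \<open>K\<close> positive.\<close>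
  define K where "K = 2 * max L 1 / a"
  have K: "K > 0" using \<alpha>(3) by (simp add: K_def)
  have lim_\<alpha>: "((\<lambda>u. \<alpha> u / u) \<longlongrightarrow> a) (at 0)"
    using \<alpha> by (simp add: has_field_derivative_iff)
  have "\<forall>\<^sub>F u in at 0. \<alpha> u / u > a / 2"
    using \<alpha>(3) by (intro order_tendstoD(1)[OF lim_\<alpha>]) auto
  then obtain e where e: "e > 0" "\<And>u. u \<noteq> 0 \<Longrightarrow> \<bar>u\<bar> < e \<Longrightarrow> \<alpha> u / u > a / 2"
    by (auto simp: eventually_at dist_real_def)
  have lim_y: "((\<lambda>s. y s / s) \<longlongrightarrow> 0) (at 0)"
    using y by (simp add: has_field_derivative_iff)
  have "\<forall>\<^sub>F s in at 0. \<bar>y s / s\<bar> < 1 / (2 * K)"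
    using tendsto_rabs[OF lim_y] K by (intro order_tendstoD(2)) auto
  moreover have "\<forall>\<^sub>F s in at 0. \<bar>y s\<bar> < e"
  proof -
    have "(y \<longlongrightarrow> 0) (at 0)"
      using DERIV_isCont[OF y(3)] y(2) by (simp add: isCont_def)
    then show ?thesis
      using tendsto_rabs[of y 0 "at 0"] e(1) by (intro order_tendstoD(2)) auto
  qed
  ultimately have "\<forall>\<^sub>F s in at 0. \<bar>y s / s\<bar> < 1 / (2 * K) \<and> \<bar>y s\<bar> < e"
    by eventually_elim auto
  then obtain d where d: "d > 0" "\<And>s. s \<noteq> 0 \<Longrightarrow> \<bar>s\<bar> < d \<Longrightarrow> \<bar>y s / s\<bar> < 1 / (2 * K) \<and> \<bar>y s\<bar> < e"
    by (auto simp: eventually_at dist_real_def)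
  define r' where "r' = min d r"
  have r': "r' > 0" "r' \<le> r" "r' \<le> d" using d \<open>r > 0\<close> by (auto simp: r'_def)
  have y0: "y s \<noteq> 0" if "s \<in> {0<..<r}" for s
    using \<rho>[OF that] by auto
  have cont_y: "continuous_on {0<..<r} y"
    using y(1) by (meson DERIV_isCont continuous_at_imp_continuous_on)
  have "(\<forall>s\<in>{0<..<r}. y s > 0) \<or> (\<forall>s\<in>{0<..<r}. y s < 0)"
    by (rule connected_nonzero_sign[OF _ cont_y y0]) auto
  \<comment> \<open>The constant sign of \<open>y\<close> makes its absolute value
    differentiable.\<close>
  then obtain \<sigma> :: real where \<sigma>: "\<sigma> = 1 \<or> \<sigma> = -1" "\<And>s. s \<in> {0<..<r} \<Longrightarrow> \<bar>y s\<bar> = \<sigma> * y s"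
    by (metis abs_of_neg abs_of_pos minus_mult_minus mult_1 mult_minus_left)
  define Q where "Q s = s - K * (\<sigma> * y s)" for s
  have Q_dec: "Q s' \<le> Q s" if "0 < s" "s \<le> s'" "s' < r'" for s s'
  proof (rule DERIV_nonpos_imp_nonincreasing[OF that(2)])
    fix x assume x: "s \<le> x" "x \<le> s'"
    then have x': "x \<in> {0<..<r}" "x \<noteq> 0" "\<bar>x\<bar> < d" using that r' by auto
    have "(Q has_real_derivative 1 - K * (\<sigma> * (- \<alpha> (y x) / \<rho> x))) (at x)"
      unfolding Q_def using y(1)[OF x'(1)] by (auto intro!: derivative_eq_intros)
    moreover have "1 - K * (\<sigma> * (- \<alpha> (y x) / \<rho> x)) \<le> 0"
    proof -
      have "\<alpha> (y x) / y x > a / 2"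
        using e(2)[OF y0[OF x'(1)]] d(2)[OF x'(2,3)] by auto
      then have "a / 2 * \<bar>y x\<bar> \<le> \<alpha> (y x) / y x * \<bar>y x\<bar>"
        by (intro mult_right_mono) auto
      also have "\<dots> = \<sigma> * \<alpha> (y x)"
        unfolding \<sigma>(2)[OF x'(1)] using y0[OF x'(1)] by simp
      finally have "K * (a / 2 * \<bar>y x\<bar>) \<le> K * (\<sigma> * \<alpha> (y x))"
        using K by (intro mult_left_mono) auto
      then have "max L 1 * \<bar>y x\<bar> \<le> K * (\<sigma> * \<alpha> (y x))"
        using \<alpha>(3) by (simp add: K_def)
      moreover have "\<rho> x \<ge> - max L 1 * \<bar>y x\<bar>"
        using \<rho>(2)[OF x'(1)] mult_right_mono[of L "max L 1" "\<bar>y x\<bar>"] by auto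
      ultimately have "\<rho> x + K * (\<sigma> * \<alpha> (y x)) \<ge> 0" by simp
      then have "(\<rho> x + K * (\<sigma> * \<alpha> (y x))) / \<rho> x \<le> 0"
        using \<rho>(1)[OF x'(1)] by (intro divide_nonneg_neg)
      then show ?thesis
        using \<rho>(1)[OF x'(1)] by (simp add: add_divide_distrib)
    qed
    ultimately show "\<exists>y. (Q has_real_derivative y) (at x) \<and> y \<le> 0" by blast
  qed
  have lim_Q: "(Q \<longlongrightarrow> 0) (at_right 0)"
  proof -
    have "isCont Q 0"
      unfolding Q_def using DERIV_isCont[OF y(3)] by (intro continuous_intros)
    then show ?thesis
      using y(2) by (simp add: isCont_def Q_def filterlim_at_split)
  qed
  define s where "s = r' / 2"
  have s: "0 < s" "s < r'" using r' by (auto simp: s_def)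
  have "Q s \<le> 0"
  proof (rule tendsto_lowerbound[OF lim_Q])
    show "\<forall>\<^sub>F x in at_right 0. Q s \<le> Q x"
      using eventually_at_right_real[OF s(1)] by eventually_elim (use Q_dec s in auto)
  qed simp
  then have "s \<le> K * \<bar>y s\<bar>"
    using \<sigma>(2)[of s] s r' by (simp add: Q_def)
  moreover have "\<bar>y s / s\<bar> < 1 / (2 * K)"
    using d(2)[of s] s r' by auto
  then have "K * \<bar>y s\<bar> < s / 2"
    using s K by (simp add: field_simps abs_divide)
  ultimately show False using s by simp
qed

text \<open>With \<open>\<rho> > 0\<close>, increasing \<open>s\<close> is forward time, along which
  the square of \<open>y\<close> cannot grow, and it starts from the limit 0. A center manifold with
  outflow on one side thus lies in \<open>h = 0\<close> on that side.\<close>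

lemma barrier_vanishes_along_outflow:
  fixes y \<rho> \<alpha> :: "real \<Rightarrow> real"
  assumes y: "\<And>s. s \<in> {0<..<r} \<Longrightarrow> (y has_real_derivative - \<alpha> (y s) / \<rho> s) (at s)"
      "(y \<longlongrightarrow> 0) (at_right 0)"
    and \<rho>: "\<And>s. s \<in> {0<..<r} \<Longrightarrow> \<rho> s > 0"
    and \<alpha>: "strict_mono \<alpha>" "\<alpha> 0 = 0"
    and s: "s \<in> {0<..<r}"
  shows "y s = 0"
proof -
  have pos: "u * \<alpha> u \<ge> 0" for u
    using \<alpha> strict_mono_less_eq[OF \<alpha>(1), of 0 u] strict_mono_less_eq[OF \<alpha>(1), of u 0]
    by (auto simp: zero_le_mult_iff)
  have dec: "(y s)\<^sup>2 \<le> (y x)\<^sup>2" if "0 < x" "x < s" for x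
  proof (rule DERIV_nonpos_imp_nonincreasing[OF less_imp_le[OF that(2)]])
    fix u assume "x \<le> u" "u \<le> s"
    then have u: "u \<in> {0<..<r}" using s that by auto
    have "((\<lambda>s. (y s)\<^sup>2) has_real_derivative 2 * y u * (- \<alpha> (y u) / \<rho> u)) (at u)"
      using y(1)[OF u] by (auto intro!: derivative_eq_intros)
    moreover have "2 * y u * (- \<alpha> (y u) / \<rho> u) \<le> 0"
      using pos[of "y u"] \<rho>[OF u] by (simp add: field_simps)
    ultimately show "\<exists>z. ((\<lambda>s. (y s)\<^sup>2) has_real_derivative z) (at u) \<and> z \<le> 0" by blast
  qed
  have "(y s)\<^sup>2 \<le> 0\<^sup>2"
  proof (rule tendsto_lowerbound[OF tendsto_power[OF y(2)]])
    show "\<forall>\<^sub>F x in at_right 0. (y s)\<^sup>2 \<le> (y x)\<^sup>2"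
      using eventually_at_right_real[of 0 s] s by (auto elim!: eventually_mono intro: dec)
  qed simp
  then show ?thesis by simp
qed

text \<open>\<open>l\<close> and \<open>l'\<close> form the basis dual to \<open>c\<close> and
  \<open>w\<close>, so \<open>l\<close> recovers the parameter \<open>s\<close> from a point of the
  curve. The flow is studied only for \<open>s > 0\<close>; \<open>reversed\<close> gives the other
  side.\<close>

locale center_curve =
  fixes X :: "real^2 \<Rightarrow> real^2" and p c w l l' :: "real^2" and r :: real
    and \<phi> \<phi>' :: "real \<Rightarrow> real" and M :: "(real^2) set"
  assumes dual: "l \<bullet> c = 1" "l \<bullet> w = 0" "l' \<bullet> c = 0" "l' \<bullet> w = 1"
    and r_pos: "r > 0"
    and \<phi>_deriv: "\<And>s. s \<in> {-r<..<r} \<Longrightarrow> (\<phi> has_real_derivative \<phi>' s) (at s)"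
    and \<phi>_0: "\<phi> 0 = 0" "\<phi>' 0 = 0"
    and M_eq: "M = (\<lambda>s. p + s *\<^sub>R c + \<phi> s *\<^sub>R w) ` {-r<..<r}"
    and M_inv: "locally_invariant X M"
begin

definition m :: "real \<Rightarrow> real^2"
  where "m s = p + s *\<^sub>R c + \<phi> s *\<^sub>R w"

text \<open>By \<open>tangent\<close>, the flow on \<open>M\<close> reads
  \<open>s' = \<rho> s\<close> in the parameter.\<close>

definition \<rho> :: "real \<Rightarrow> real"
  where "\<rho> s = l \<bullet> X (m s)"

lemma m_0 [simp]: "m 0 = p"
  by (simp add: m_def \<phi>_0)

lemma M_eq_m: "M = m ` {-r<..<r}"
  unfolding M_eq m_def by simp

lemma coordinate_m: "l \<bullet> (m s - p) = s"
  by (simp add: m_def inner_add_right dual)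

lemma m_coordinate:
  assumes "x \<in> M"
  shows "m (l \<bullet> (x - p)) = x" "l \<bullet> (x - p) \<in> {-r<..<r}"
  using assms coordinate_m unfolding M_eq_m by auto

lemma m_deriv:
  assumes "s \<in> {-r<..<r}"
  shows "(m has_vector_derivative c + \<phi>' s *\<^sub>R w) (at s)"
  unfolding m_def using \<phi>_deriv[OF assms]
  by (auto intro!: derivative_eq_intros simp: has_real_derivative_iff_has_vector_derivative)

lemma isCont_m:
  assumes "s \<in> {-r<..<r}"
  shows "isCont m s"
  using m_deriv[OF assms] by (rule has_vector_derivative_continuous)

text \<open>A trajectory in \<open>M\<close> is \<open>m\<close> composed with its own coordinate
  \<open>\<sigma>\<close>; differentiating at time 0 gives the velocity in two ways.\<close>

lemma tangent:
  assumes s: "s \<in> {-r<..<r}"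
  shows "X (m s) = \<rho> s *\<^sub>R (c + \<phi>' s *\<^sub>R w)"
proof -
  have "m s \<in> M" using s by (simp add: M_eq_m)
  then obtain T \<xi> where T: "T > 0" and \<xi>: "solves_on X \<xi> {-T<..<T}" "\<xi> 0 = m s" "\<xi> ` {-T<..<T} \<subseteq> M"
    using M_inv unfolding locally_invariant_def by blast
  define \<sigma> where "\<sigma> t = l \<bullet> (\<xi> t - p)" for t
  have 0: "0 \<in> {-T<..<T}" using T by simp
  have \<xi>0: "(\<xi> has_vector_derivative X (m s)) (at 0)"
    using \<xi>(1,2) 0 unfolding solves_on_def
    by (metis at_within_open open_greaterThanLessThan)
  have "(\<sigma> has_vector_derivative l \<bullet> X (m s)) (at 0)"
    unfolding \<sigma>_def has_vector_derivative_def using \<xi>0[unfolded has_vector_derivative_def]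
    by (auto intro!: derivative_eq_intros)
  then have \<sigma>': "(\<sigma> has_vector_derivative \<rho> s) (at 0)"
    by (simp add: \<rho>_def)
  have "\<sigma> 0 = s"
    using \<xi>(2) by (simp add: \<sigma>_def coordinate_m)
  then have "(m \<circ> \<sigma> has_vector_derivative \<rho> s *\<^sub>R (c + \<phi>' s *\<^sub>R w)) (at 0)"
    using vector_diff_chain_at[OF \<sigma>', of m "c + \<phi>' s *\<^sub>R w"] m_deriv[OF s] by simp
  then have "(\<xi> has_vector_derivative \<rho> s *\<^sub>R (c + \<phi>' s *\<^sub>R w)) (at 0)"
  proof (rule has_vector_derivative_transform_within_open[OF _ open_greaterThanLessThan 0])
    show "(m \<circ> \<sigma>) t = \<xi> t" if "t \<in> {-T<..<T}" for t
      using \<xi>(3) that by (auto simp: \<sigma>_def intro!: m_coordinate)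
  qed
  with \<xi>0 show ?thesis
    by (rule vector_derivative_unique_at)
qed

text \<open>A trajectory that starts at parameter \<open>s0\<close> and tends to \<open>p\<close>
  would have to pass \<open>s0\<close> downwards, where the speed is positive.\<close>

lemma converges_not_outflow:
  assumes conv: "converges_on X p M" and r1: "0 < r1" "r1 \<le> r"
    and pos: "\<And>s. s \<in> {0<..<r1} \<Longrightarrow> \<rho> s > 0"
  shows False
proof -
  obtain \<epsilon> where \<epsilon>: "\<epsilon> > 0" "\<And>x0. x0 \<in> M \<inter> ball p \<epsilon> \<Longrightarrow>
      \<exists>\<xi>. solves_on X \<xi> {0..} \<and> \<xi> 0 = x0 \<and> \<xi> ` {0..} \<subseteq> M \<and> (\<xi> \<longlongrightarrow> p) at_top"
    using conv unfolding converges_on_def by blast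
  have "\<forall>\<^sub>F s in at 0. dist (m s) p < \<epsilon>"
    using isCont_m[of 0] r_pos \<epsilon>(1) by (auto simp: isCont_def intro!: tendstoD)
  then obtain d where d: "d > 0" "\<And>s. s \<noteq> 0 \<Longrightarrow> \<bar>s\<bar> < d \<Longrightarrow> dist (m s) p < \<epsilon>"
    by (auto simp: eventually_at dist_real_def)
  define s0 where "s0 = min d r1 / 2"
  have s0: "s0 \<in> {0<..<r1}" "s0 < d" "s0 \<in> {-r<..<r}" using d r1 by (auto simp: s0_def)
  then have "m s0 \<in> M \<inter> ball p \<epsilon>"
    using d(2)[of s0] by (auto simp: M_eq_m dist_commute)
  then obtain \<xi> where \<xi>: "solves_on X \<xi> {0..}" "\<xi> 0 = m s0" "\<xi> ` {0..} \<subseteq> M" "(\<xi> \<longlongrightarrow> p) at_top"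
    using \<epsilon>(2) by blast
  define \<sigma> where "\<sigma> t = l \<bullet> (\<xi> t - p)" for t
  have \<sigma>': "(\<sigma> has_real_derivative \<rho> (\<sigma> t)) (at t within {0..})" if "t \<ge> 0" for t
  proof -
    have "m (\<sigma> t) = \<xi> t"
      unfolding \<sigma>_def by (rule m_coordinate) (use \<xi>(3) that in auto)
    moreover have "(\<xi> has_vector_derivative X (\<xi> t)) (at t within {0..})"
      using \<xi>(1) that unfolding solves_on_def by auto
    then have "(\<sigma> has_vector_derivative l \<bullet> X (\<xi> t)) (at t within {0..})"
      unfolding \<sigma>_def has_vector_derivative_def by (auto intro!: derivative_eq_intros)
    ultimately show ?thesis
      by (simp add: \<rho>_def has_real_derivative_iff_has_vector_derivative)
  qed
  have cont: "continuous_on {0..} \<sigma>"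
    using \<sigma>' by (meson DERIV_continuous atLeast_iff continuous_on_eq_continuous_within)
  have "(\<sigma> \<longlongrightarrow> l \<bullet> (p - p)) at_top"
    unfolding \<sigma>_def by (intro tendsto_intros \<xi>(4))
  then have "\<forall>\<^sub>F t in at_top. \<sigma> t < s0"
    using s0 by (intro order_tendstoD(2)[of \<sigma> 0]) auto
  then obtain t1 where t1: "t1 > 0" "\<sigma> t1 < s0"
    using eventually_conj[OF _ eventually_gt_at_top[of 0]] eventually_happens'[OF trivial_limit_at_top_linorder]
    by (metis (mono_tags, lifting))
  \<comment> \<open>Its maximum \<open>t2\<close> is the last time up to \<open>t1\<close> with
    coordinate at least \<open>s0\<close>. The coordinate then equals \<open>s0\<close> and
    increases, which yields a later time in \<open>S\<close>.\<close>
  define S where "S = {0..t1} \<inter> \<sigma> -` {s0..}"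
  have "closed S"
    unfolding S_def by (intro continuous_closed_preimage continuous_on_subset[OF cont]) auto
  then have "compact S"
    unfolding compact_eq_bounded_closed by (auto simp: S_def intro: bounded_subset[OF bounded_closed_interval])
  moreover have "0 \<in> S"
    using t1 \<xi>(2) by (simp add: S_def \<sigma>_def coordinate_m)
  ultimately obtain t2 where t2: "t2 \<in> S" "\<And>t. t \<in> S \<Longrightarrow> t \<le> t2"
    using compact_attains_sup[of S] by auto
  then have t2': "0 \<le> t2" "t2 < t1" "s0 \<le> \<sigma> t2"
    using t1 by (auto simp: S_def le_less)
  have "\<sigma> t2 = s0"
  proof (rule antisym)
    obtain t where t: "t2 \<le> t" "t \<le> t1" "\<sigma> t = s0"
      using IVT2'[of \<sigma> t1 s0 t2] t2' t1 continuous_on_subset[OF cont, of "{t2..t1}"] by auto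
    then have "t \<in> S" using t2' by (auto simp: S_def)
    then have "t = t2" using t t2(2) by force
    then show "\<sigma> t2 \<le> s0" using t by simp
  qed (use t2' in auto)
  then have "\<rho> (\<sigma> t2) > 0"
    using pos[OF s0(1)] by simp
  then obtain d' where d': "d' > 0" "\<And>h. 0 < h \<Longrightarrow> t2 + h \<in> {0..} \<Longrightarrow> h < d' \<Longrightarrow> \<sigma> t2 < \<sigma> (t2 + h)"
    using has_real_derivative_pos_inc_right[OF \<sigma>'[OF t2'(1)]] by blast
  define h where "h = min (d' / 2) (t1 - t2)"
  have h: "0 < h" "h < d'" "t2 + h \<le> t1" using d'(1) t2' by (auto simp: h_def)
  then have "t2 + h \<in> S"
    using d'(2)[of h] t2' by (auto simp: S_def)
  then show False
    using t2(2) h(1) by force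
qed

text \<open>Inflow yields a scalar solution that stays in \<open>{0<..s0}\<close> forever. Lifted by
  \<open>m\<close>, it is a trajectory on \<open>M\<close> that remains near \<open>p\<close>, which
  divergence excludes.\<close>

lemma diverges_not_inflow:
  assumes div: "diverges_on X p M" and r1: "0 < r1" "r1 \<le> r"
    and neg: "\<And>s. s \<in> {0<..<r1} \<Longrightarrow> \<rho> s < 0"
    and \<rho>: "continuous_on {0<..<r1} \<rho>" "\<And>s. s \<in> {0<..<r1} \<Longrightarrow> - \<rho> s \<le> L * s"
  shows False
proof -
  obtain \<epsilon> where \<epsilon>: "\<epsilon> > 0" "\<And>x0. x0 \<in> M \<inter> ball p \<epsilon> - {p} \<Longrightarrow>
      \<not> (\<exists>\<xi>. solves_on X \<xi> {0..} \<and> \<xi> 0 = x0 \<and> \<xi> ` {0..} \<subseteq> M \<inter> ball p \<epsilon>)"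
    using div unfolding diverges_on_def by blast
  have "\<forall>\<^sub>F s in at 0. dist (m s) p < \<epsilon>"
    using isCont_m[of 0] r_pos \<epsilon>(1) by (auto simp: isCont_def intro!: tendstoD)
  then obtain d where d: "d > 0" "\<And>s. s \<noteq> 0 \<Longrightarrow> \<bar>s\<bar> < d \<Longrightarrow> dist (m s) p < \<epsilon>"
    by (auto simp: eventually_at dist_real_def)
  define s0 where "s0 = min d r1 / 2"
  have s0: "s0 \<in> {0<..<r1}" "s0 < d" using d r1 by (auto simp: s0_def)
  have in_M: "m s \<in> M \<inter> ball p \<epsilon>" if "s \<in> {0<..s0}" for s
    using d(2)[of s] that s0 r1 by (auto simp: M_eq_m dist_commute)
  obtain \<sigma> where \<sigma>: "\<sigma> 0 = s0" "\<And>t. t \<ge> 0 \<Longrightarrow> \<sigma> t \<in> {0<..s0}"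
    "\<And>t. t \<ge> 0 \<Longrightarrow> (\<sigma> has_real_derivative \<rho> (\<sigma> t)) (at t)"
    using scalar_ode_decreasing_solution[OF \<rho>(1) neg \<rho>(2) s0(1)] by blast
  have "solves_on X (m \<circ> \<sigma>) {0..}"
    unfolding solves_on_def
  proof
    fix t :: real assume "t \<in> {0..}"
    then have t: "t \<ge> 0" by simp
    have s: "\<sigma> t \<in> {-r<..<r}" using \<sigma>(2)[OF t] s0 r1 by auto
    have "(m \<circ> \<sigma> has_vector_derivative \<rho> (\<sigma> t) *\<^sub>R (c + \<phi>' (\<sigma> t) *\<^sub>R w)) (at t)"
      using \<sigma>(3)[OF t] m_deriv[OF s]
      by (intro vector_diff_chain_at) (simp_all add: has_real_derivative_iff_has_vector_derivative)
    then show "(m \<circ> \<sigma> has_vector_derivative X ((m \<circ> \<sigma>) t)) (at t within {0..})"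
      using tangent[OF s] by (simp add: has_vector_derivative_at_within)
  qed
  moreover have "(m \<circ> \<sigma>) ` {0..} \<subseteq> M \<inter> ball p \<epsilon>"
    using in_M \<sigma>(2) by auto
  moreover have "m s0 \<noteq> p"
    using coordinate_m[of s0] s0 by auto
  then have "m s0 \<in> M \<inter> ball p \<epsilon> - {p}"
    using in_M[of s0] s0 by auto
  ultimately show False
    using \<epsilon>(2)[of "m s0"] \<sigma>(1) by (metis comp_apply)
qed

lemma reversed:
  "center_curve X p (- c) w (- l) l' r (\<lambda>s. \<phi> (- s)) (\<lambda>s. - \<phi>' (- s)) M"
proof
  show "((\<lambda>s. \<phi> (- s)) has_real_derivative - \<phi>' (- s)) (at s)" if "s \<in> {-r<..<r}" for s
    using DERIV_chain'[OF DERIV_minus[OF DERIV_ident], of \<phi> "\<phi>' (- s)" s] \<phi>_deriv[of "- s"] that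
    by simp
  have "(\<lambda>s. p + s *\<^sub>R - c + \<phi> (- s) *\<^sub>R w) ` {-r<..<r} =
      (\<lambda>s. p + s *\<^sub>R c + \<phi> s *\<^sub>R w) ` (uminus ` {-r<..<r})"
    unfolding image_image by simp
  also have "uminus ` {-r<..<r} = {-r<..<r}"
    by simp
  finally show "M = (\<lambda>s. p + s *\<^sub>R - c + \<phi> (- s) *\<^sub>R w) ` {-r<..<r}"
    by (simp only: M_eq)
qed (use dual r_pos \<phi>_0 M_inv in auto)

end

section \<open>Equilibria on the boundary of the safe set\<close>

definition rot :: "real^2 \<Rightarrow> real^2"
  where "rot v = vector [- v $ 2, v $ 1]"

lemma rot_nth [simp]: "rot v $ 1 = - v $ 2" "rot v $ 2 = v $ 1"
  by (simp_all add: rot_def)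

lemma inner_real2: "u \<bullet> v = u $ 1 * v $ 1 + u $ 2 * v $ 2" for u v :: "real^2"
  by (simp add: inner_vec_def sum_2)

lemma vec2_eq_iff: "u = v \<longleftrightarrow> u $ 1 = v $ 1 \<and> u $ 2 = v $ 2" for u v :: "real^2"
  by (simp add: vec_eq_iff forall_2)

lemma rot_inner [simp]: "rot v \<bullet> v = 0" "v \<bullet> rot v = 0" "rot u \<bullet> rot v = u \<bullet> v"
  by (simp_all add: inner_real2)

lemma rot_eq_0 [simp]: "rot v = 0 \<longleftrightarrow> v = 0"
  by (auto simp: vec2_eq_iff)

lemma rot_0 [simp]: "rot 0 = 0"
  by simp

lemma inner_normal_tangent: "(n \<bullet> n) * (l \<bullet> v) = (v \<bullet> n) * (l \<bullet> n) + (v \<bullet> rot n) * (l \<bullet> rot n)"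
  by (simp add: inner_real2 algebra_simps)

lemma normal_tangent_decomp:
  "(n \<bullet> n) *\<^sub>R v = (v \<bullet> n) *\<^sub>R n + (v \<bullet> rot n) *\<^sub>R rot n"
  by (simp add: vec2_eq_iff inner_real2 algebra_simps)

lemma bounded_linear_rot: "bounded_linear rot"
  unfolding linear_conv_bounded_linear[symmetric]
  by (rule linearI) (simp_all add: vec2_eq_iff)

lemmas continuous_on_rot [continuous_intros] = bounded_linear.continuous_on[OF bounded_linear_rot]
lemmas tendsto_rot [tendsto_intros] = bounded_linear.tendsto[OF bounded_linear_rot]

lemma planar_dual_basis:
  fixes c w :: "real^2"
  assumes "rot w \<bullet> c \<noteq> 0"
  obtains l l' where "l \<bullet> c = 1" "l \<bullet> w = 0" "l' \<bullet> c = 0" "l' \<bullet> w = 1"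
    "\<And>v. v = (l \<bullet> v) *\<^sub>R c + (l' \<bullet> v) *\<^sub>R w"
proof
  define D where "D = rot w \<bullet> c"
  have D: "D \<noteq> 0" "rot c \<bullet> w = - D" using assms by (auto simp: D_def inner_real2)
  define l where "l = (1 / D) *\<^sub>R rot w"
  define l' where "l' = (- 1 / D) *\<^sub>R rot c"
  show "l \<bullet> c = 1" "l \<bullet> w = 0" "l' \<bullet> c = 0" "l' \<bullet> w = 1"
    using D by (simp_all add: l_def l'_def flip: D_def)
  fix v
  have "D *\<^sub>R v = (rot w \<bullet> v) *\<^sub>R c - (rot c \<bullet> v) *\<^sub>R w"
    by (simp add: D_def vec2_eq_iff inner_real2 algebra_simps)
  then have "(1 / D) *\<^sub>R (D *\<^sub>R v) = (1 / D) *\<^sub>R ((rot w \<bullet> v) *\<^sub>R c - (rot c \<bullet> v) *\<^sub>R w)"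
    by simp
  then show "v = (l \<bullet> v) *\<^sub>R c + (l' \<bullet> v) *\<^sub>R w"
    using D by (simp add: l_def l'_def scaleR_diff_right)
qed

text \<open>Near an undesired equilibrium the filter constraint is active, so the barrier inequality
  becomes the equality \<open>barrier\<close>. It makes \<open>X\<close> tangent to
  \<open>h = 0\<close>, and through it the filter enters the local analysis.\<close>

locale barrier_equilibrium =
  fixes X n :: "real^2 \<Rightarrow> real^2" and h :: "real^2 \<Rightarrow> real" and \<alpha> :: "real \<Rightarrow> real"
    and a R L :: real and p :: "real^2" and A :: "real^2 \<Rightarrow> real^2"
  assumes R_pos: "R > 0"
    and X_lipschitz: "\<And>x y. x \<in> ball p R \<Longrightarrow> y \<in> ball p R \<Longrightarrow> norm (X x - X y) \<le> L * norm (x - y)"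
    and X_p: "X p = 0"
    and X_nonzero: "\<And>x. x \<in> ball p R \<Longrightarrow> x \<noteq> p \<Longrightarrow> X x \<noteq> 0"
    and X_deriv: "(X has_derivative A) (at p)"
    and h_deriv: "\<And>x. GDERIV h x :> n x"
    and n_cont: "continuous_on UNIV n"
    and h_p: "h p = 0"
    and n_p: "n p \<noteq> 0"
    and \<alpha>: "strict_mono \<alpha>" "\<alpha> 0 = 0" "(\<alpha> has_real_derivative a) (at 0)" "a > 0"
    and barrier: "\<And>x. x \<in> ball p R \<Longrightarrow> n x \<bullet> X x = - \<alpha> (h x)"
begin

text \<open>On the level set, \<open>rot (n p)\<close> measures the position relative to \<open>p\<close>: the flow on the curve
  leaves \<open>p\<close> on both sides for \<open>\<sigma> = 1\<close> and approaches it on both sides for \<open>\<sigma> = -1\<close>.\<close>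

definition crossing :: "real \<Rightarrow> bool"
  where "crossing \<sigma> \<longleftrightarrow> (\<forall>\<^sub>F x in at p within {x. h x = 0}.
    sgn (X x \<bullet> rot (n x)) = \<sigma> * sgn ((x - p) \<bullet> rot (n p)))"

lemma n_tendsto: "(n \<longlongrightarrow> n p) (at p within S)"
  using n_cont by (metis UNIV_I continuous_on_eq_continuous_within continuous_within continuous_within_subset subset_UNIV)

lemma eventually_near: "\<forall>\<^sub>F x in at p within S. x \<in> ball p e" if "e > 0"
  using that by (auto simp: eventually_at dist_commute)

lemma X_continuous: "continuous_on (ball p R) X"
proof (rule continuous_onI)
  fix x e :: "real^2" and \<epsilon> :: real assume x: "x \<in> ball p R" and \<epsilon>: "\<epsilon> > 0"
  define K where "K = max L 1"
  show "\<exists>d>0. \<forall>x'\<in>ball p R. dist x' x < d \<longrightarrow> dist (X x') (X x) \<le> \<epsilon>"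
  proof (intro exI[of _ "\<epsilon> / K"] conjI ballI impI)
    show "\<epsilon> / K > 0" using \<epsilon> by (simp add: K_def)
    fix x' assume x': "x' \<in> ball p R" "dist x' x < \<epsilon> / K"
    have "norm (X x' - X x) \<le> L * norm (x' - x)"
      using X_lipschitz x x' by blast
    also have "\<dots> \<le> K * norm (x' - x)"
      by (rule mult_right_mono) (auto simp: K_def)
    also have "\<dots> \<le> \<epsilon>"
      using x'(2) by (simp add: K_def dist_norm field_simps)
    finally show "dist (X x') (X x) \<le> \<epsilon>" by (simp add: dist_norm)
  qed
qed

text \<open>As \<open>n\<close> is merely continuous, \<open>n x \<bullet> X x\<close> cannot be
  differentiated as a product. But \<open>X p = 0\<close> and \<open>X\<close> is Lipschitz, so
  replacing \<open>n x\<close> by \<open>n p\<close> costs only o(|x - p|). The outcome says that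
  \<open>n p\<close> is a left eigenvector for \<open>- a\<close>.\<close>

lemma derivative_normal: "n p \<bullet> A v = - a * (n p \<bullet> v)"
proof -
  have bl: "bounded_linear A" using X_deriv by (rule has_derivative_bounded_linear)
  have "((\<lambda>x. (n x - n p) \<bullet> X x) has_derivative (\<lambda>_. 0)) (at p)"
  proof (rule has_derivative_within[THEN iffD2], rule conjI)
    have "((\<lambda>x. norm (n x - n p) * L) \<longlongrightarrow> norm (n p - n p) * L) (at p)"
      by (intro tendsto_intros n_tendsto)
    then have lim: "((\<lambda>x. norm (n x - n p) * L) \<longlongrightarrow> 0) (at p)" by simp
    show "((\<lambda>x. (1 / norm (x - p)) *\<^sub>R ((n x - n p) \<bullet> X x - ((n p - n p) \<bullet> X p + 0))) \<longlongrightarrow> 0) (at p)"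
    proof (rule Lim_null_comparison[OF _ lim])
      show "\<forall>\<^sub>F x in at p. norm ((1 / norm (x - p)) *\<^sub>R ((n x - n p) \<bullet> X x - ((n p - n p) \<bullet> X p + 0)))
          \<le> norm (n x - n p) * L"
        using eventually_near[OF R_pos] eventually_neq_at_within[of p p]
      proof eventually_elim
        case (elim x)
        have "norm (X x - X p) \<le> L * norm (x - p)"
          using elim R_pos by (intro X_lipschitz) auto
        then have "\<bar>(n x - n p) \<bullet> X x\<bar> \<le> norm (n x - n p) * (L * norm (x - p))"
          using Cauchy_Schwarz_ineq2[of "n x - n p" "X x"] X_p
          by (smt (verit) diff_zero mult_left_mono norm_ge_zero)
        then show ?case
          using elim by (simp add: divide_simps abs_mult mult_ac)
      qed
    qed
  qed simp
  moreover have "((\<lambda>x. n p \<bullet> X x) has_derivative (\<lambda>v. n p \<bullet> A v)) (at p)"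
    using X_deriv by (auto intro!: derivative_eq_intros)
  ultimately have "((\<lambda>x. (n x - n p) \<bullet> X x + n p \<bullet> X x) has_derivative (\<lambda>v. 0 + n p \<bullet> A v)) (at p)"
    by (rule has_derivative_add)
  then have 1: "((\<lambda>x. - \<alpha> (h x)) has_derivative (\<lambda>v. n p \<bullet> A v)) (at p)"
    unfolding add_0
  proof (rule has_derivative_transform_within_open[OF _ open_ball])
    show "p \<in> ball p R" using R_pos by simp
    show "(n x - n p) \<bullet> X x + n p \<bullet> X x = - \<alpha> (h x)" if "x \<in> ball p R" for x
      using barrier[OF that] by (simp add: inner_diff_left)
  qed
  have "(h has_derivative (\<lambda>v. v \<bullet> n p)) (at p)"
    using h_deriv[of p] by (simp add: gderiv_def)
  then have "((\<lambda>x. \<alpha> (h x)) has_derivative (\<lambda>v. a * (v \<bullet> n p))) (at p)"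
    using has_derivative_compose[of h _ p UNIV \<alpha> "(*) a"] \<alpha>(3) h_p
    by (simp add: has_field_derivative_def)
  then have "((\<lambda>x. - \<alpha> (h x)) has_derivative (\<lambda>v. - (a * (v \<bullet> n p)))) (at p)"
    by (rule has_derivative_minus)
  from has_derivative_unique[OF 1 this] show ?thesis
    by (simp add: fun_eq_iff inner_commute)
qed

lemma level_set_tangent:
  assumes "e > 0"
  shows "\<forall>\<^sub>F x in at p within {x. h x = 0}. \<bar>(x - p) \<bullet> n p\<bar> \<le> e * norm (x - p)"
proof -
  have "(h has_derivative (\<lambda>v. v \<bullet> n p)) (at p)"
    using h_deriv[of p] by (simp add: gderiv_def)
  then have lim: "((\<lambda>x. (1 / norm (x - p)) *\<^sub>R (h x - (h p + (x - p) \<bullet> n p))) \<longlongrightarrow> 0) (at p)"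
    by (simp add: has_derivative_within)
  have "\<forall>\<^sub>F x in at p within {x. h x = 0}. norm ((1 / norm (x - p)) *\<^sub>R (h x - (h p + (x - p) \<bullet> n p)) - 0) < e"
    by (rule tendstoD[OF tendsto_within_subset[OF lim subset_UNIV] assms, unfolded dist_norm])
  moreover have "\<forall>\<^sub>F x in at p within {x. h x = 0}. h x = 0"
    by (simp add: eventually_at_filter)
  ultimately show ?thesis
    using eventually_neq_at_within[of p p]
  proof eventually_elim
    case (elim x)
    then show ?case using h_p by (simp add: field_simps)
  qed
qed

text \<open>Near \<open>p\<close> the normal part of \<open>x - p\<close> is at most half of its
  length, so Pythagoras leaves at least the fraction sqrt 3 / 2 for the tangential part; the factor
  2 is a round bound.\<close>

lemma level_set_norm_le:
  "\<forall>\<^sub>F x in at p within {x. h x = 0}. norm (n p) * norm (x - p) \<le> 2 * \<bar>(x - p) \<bullet> rot (n p)\<bar>"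
proof -
  have "norm (n p) / 2 > 0" using n_p by simp
  from level_set_tangent[OF this] show ?thesis
  proof eventually_elim
    case (elim x)
    let ?v = "x - p"
    have "(norm (n p) * norm ?v)\<^sup>2 = (?v \<bullet> n p)\<^sup>2 + (?v \<bullet> rot (n p))\<^sup>2"
      using inner_normal_tangent[of "n p" ?v ?v]
      by (simp add: dot_square_norm power2_eq_square mult_ac)
    moreover have "(?v \<bullet> n p)\<^sup>2 \<le> (norm (n p) / 2 * norm ?v)\<^sup>2"
      using elim by (intro abs_le_square_iff[THEN iffD1]) simp
    ultimately have "3 / 4 * (norm (n p) * norm ?v)\<^sup>2 \<le> (?v \<bullet> rot (n p))\<^sup>2"
      by (simp add: power_mult_distrib power_divide)
    then have "(norm (n p) * norm ?v)\<^sup>2 \<le> (2 * (?v \<bullet> rot (n p)))\<^sup>2"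
    proof -
      have "(2 * (?v \<bullet> rot (n p)))\<^sup>2 = 4 * (?v \<bullet> rot (n p))\<^sup>2"
        by (simp add: power_mult_distrib)
      then show ?thesis
        using \<open>3 / 4 * _ \<le> _\<close> zero_le_power2[of "norm (n p) * norm ?v"] by linarith
    qed
    then show ?case
      using abs_le_square_iff[of "norm (n p) * norm ?v" "2 * (?v \<bullet> rot (n p))"] by (simp add: abs_mult)
  qed
qed

lemma sgn_add_small: "sgn (x + y) = sgn x" if "\<bar>y\<bar> < \<bar>x\<bar>" for x y :: real
  using that by (auto simp: sgn_real_def)

text \<open>Any functional that does not annihilate the tangent is a coordinate on the curve near
  \<open>p\<close>, up to a fixed sign. This lets the coordinate \<open>l\<close> of a center
  manifold replace \<open>rot (n p)\<close>.\<close>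

lemma level_set_coordinate:
  "\<forall>\<^sub>F x in at p within {x. h x = 0}. sgn (l \<bullet> (x - p)) = sgn (l \<bullet> rot (n p)) * sgn ((x - p) \<bullet> rot (n p))"
  if l: "l \<bullet> rot (n p) \<noteq> 0"
proof -
  \<comment> \<open>With this \<open>e\<close> the normal contribution to
    \<open>l \<bullet> (x - p)\<close> is less than the tangential one; the summand 1 avoids
    division by 0.\<close>
  define e where "e = norm (n p) * \<bar>l \<bullet> rot (n p)\<bar> / (4 * (\<bar>l \<bullet> n p\<bar> + 1))"
  have e: "e > 0" using l n_p by (auto simp: e_def intro!: divide_pos_pos mult_pos_pos add_nonneg_pos)
  show ?thesis
    using level_set_tangent[OF e] level_set_norm_le eventually_neq_at_within[of p p]
  proof eventually_elim
    case (elim x)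
    let ?v = "x - p"
    have nv: "norm (n p) * norm ?v > 0" using elim n_p by simp
    have "\<bar>(?v \<bullet> n p) * (l \<bullet> n p)\<bar> \<le> e * norm ?v * (\<bar>l \<bullet> n p\<bar> + 1)"
      unfolding abs_mult using elim e by (intro mult_mono) auto
    also have "\<dots> = (norm (n p) * norm ?v) * \<bar>l \<bullet> rot (n p)\<bar> / 4"
      by (simp add: e_def field_simps)
    also have "\<dots> \<le> 2 * \<bar>?v \<bullet> rot (n p)\<bar> * \<bar>l \<bullet> rot (n p)\<bar> / 4"
      using elim by (intro divide_right_mono mult_right_mono) auto
    also have "\<dots> < \<bar>(?v \<bullet> rot (n p)) * (l \<bullet> rot (n p))\<bar>"
      using nv elim l by (simp add: abs_mult)
    finally have "sgn ((n p \<bullet> n p) * (l \<bullet> ?v)) = sgn ((?v \<bullet> rot (n p)) * (l \<bullet> rot (n p)))"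
      unfolding inner_normal_tangent[of "n p" l ?v]
      by (subst add.commute) (rule sgn_add_small)
    then show ?case
      using n_p by (simp add: sgn_mult mult.commute)
  qed
qed

text \<open>On \<open>h = 0\<close>, \<open>barrier\<close> leaves \<open>X x\<close> a multiple of
  \<open>rot (n x)\<close>, and \<open>l \<bullet> rot (n x)\<close> keeps its sign near
  \<open>p\<close>.\<close>

lemma level_set_velocity:
  assumes l: "l \<bullet> rot (n p) \<noteq> 0"
  shows "\<forall>\<^sub>F x in at p within {x. h x = 0}. sgn (l \<bullet> X x) = sgn (l \<bullet> rot (n p)) * sgn (X x \<bullet> rot (n x))"
proof -
  have "((\<lambda>x. l \<bullet> rot (n x)) \<longlongrightarrow> l \<bullet> rot (n p)) (at p within {x. h x = 0})"
    by (intro tendsto_intros n_tendsto)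
  then have "((\<lambda>x. (l \<bullet> rot (n x)) * (l \<bullet> rot (n p))) \<longlongrightarrow> (l \<bullet> rot (n p)) * (l \<bullet> rot (n p))) (at p within {x. h x = 0})"
    by (rule tendsto_mult[OF _ tendsto_const])
  then have "\<forall>\<^sub>F x in at p within {x. h x = 0}. (l \<bullet> rot (n x)) * (l \<bullet> rot (n p)) > 0"
    by (rule order_tendstoD(1)) (use l in \<open>auto simp: zero_less_mult_iff\<close>)
  moreover have "\<forall>\<^sub>F x in at p within {x. h x = 0}. h x = 0"
    by (simp add: eventually_at_filter)
  ultimately show ?thesis
    using eventually_near[OF R_pos]
  proof eventually_elim
    case (elim x)
    have "n x \<noteq> 0" using elim by auto
    moreover have "X x \<bullet> n x = 0"
      using barrier[of x] elim \<alpha> by (simp add: inner_commute)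
    then have "(n x \<bullet> n x) * (l \<bullet> X x) = (X x \<bullet> rot (n x)) * (l \<bullet> rot (n x))"
      using inner_normal_tangent[of "n x" l "X x"] by simp
    then have "sgn ((n x \<bullet> n x) * (l \<bullet> X x)) = sgn (X x \<bullet> rot (n x)) * sgn (l \<bullet> rot (n x))"
      by (simp only: sgn_mult)
    moreover have "sgn (l \<bullet> rot (n x)) = sgn (l \<bullet> rot (n p))"
      using elim by (auto simp: sgn_real_def zero_less_mult_iff)
    ultimately show ?case
      by (simp add: sgn_mult mult.commute)
  qed
qed

lemma crossingI:
  assumes l: "l \<bullet> rot (n p) \<noteq> 0"
    and "\<forall>\<^sub>F x in at p within {x. h x = 0}. sgn (l \<bullet> X x) = \<sigma> * sgn (l \<bullet> (x - p))"
  shows "crossing \<sigma>"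
  unfolding crossing_def using assms(2) level_set_coordinate[OF l] level_set_velocity[OF l]
proof eventually_elim
  case (elim x)
  then have "sgn (l \<bullet> rot (n p)) * sgn (X x \<bullet> rot (n x)) = sgn (l \<bullet> rot (n p)) * (\<sigma> * sgn ((x - p) \<bullet> rot (n p)))"
    by simp
  moreover have "sgn (l \<bullet> rot (n p)) \<noteq> 0" using l by (simp add: sgn_0_0)
  ultimately show ?case by (metis mult_left_cancel)
qed

lemma crossing_hyperbolic:
  assumes \<mu>: "A (rot (n p)) = \<mu> *\<^sub>R rot (n p)" "\<mu> \<noteq> 0"
  shows "crossing (sgn \<mu>)"
proof (rule crossingI)
  let ?l = "rot (n p)"
  show "?l \<bullet> rot (n p) \<noteq> 0" using n_p by simp
  have lin: "linear A" using X_deriv by (rule has_derivative_linear)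
  \<comment> \<open>After scaling by \<open>n p \<bullet> n p\<close>, the tangential linear term is
    at least \<open>D / 2 * norm (x - p)\<close>. The constants \<open>e1\<close> and
    \<open>e2\<close> limit the effect of the normal displacement and the remainder of the
    derivative to \<open>D / 8 * norm (x - p)\<close> each.\<close>
  define D where "D = \<bar>\<mu>\<bar> * norm (n p) * (n p \<bullet> n p)"
  have D: "D > 0" using \<mu> n_p by (simp add: D_def)
  define e1 where "e1 = D / (8 * (\<bar>A (n p) \<bullet> ?l\<bar> + 1))"
  define e2 where "e2 = D / (8 * (norm ?l * (n p \<bullet> n p)))"
  have e: "e1 > 0" "e2 > 0"
    using D n_p by (auto simp: e1_def e2_def intro!: divide_pos_pos mult_pos_pos add_nonneg_pos)
  have lim: "((\<lambda>x. (1 / norm (x - p)) *\<^sub>R (X x - (X p + A (x - p)))) \<longlongrightarrow> 0) (at p)"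
    using X_deriv by (simp add: has_derivative_within)
  have "\<forall>\<^sub>F x in at p within {x. h x = 0}. norm ((1 / norm (x - p)) *\<^sub>R (X x - (X p + A (x - p))) - 0) < e2"
    by (rule tendstoD[OF tendsto_within_subset[OF lim subset_UNIV] e(2), unfolded dist_norm])
  then show "\<forall>\<^sub>F x in at p within {x. h x = 0}. sgn (?l \<bullet> X x) = sgn \<mu> * sgn (?l \<bullet> (x - p))"
    using level_set_tangent[OF e(1)] level_set_norm_le eventually_neq_at_within[of p p]
  proof eventually_elim
    case (elim x)
    let ?v = "x - p" and ?N = "n p \<bullet> n p"
    have N: "?N > 0" using n_p by simp
    have "norm (X x - A ?v) / norm ?v < e2"
      using elim(1) by (simp add: X_p)
    then have "norm (X x - A ?v) \<le> e2 * norm ?v"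
      using elim by (simp add: field_simps)
    then have "\<bar>?l \<bullet> (X x - A ?v)\<bar> \<le> norm ?l * (e2 * norm ?v)"
      by (meson Cauchy_Schwarz_ineq2 mult_left_mono norm_ge_zero order_trans)
    then have b1: "\<bar>?N * (?l \<bullet> (X x - A ?v))\<bar> \<le> D / 8 * norm ?v"
      using N n_p by (simp add: abs_mult e2_def field_simps)
    have "A (?N *\<^sub>R ?v) = (?v \<bullet> n p) *\<^sub>R A (n p) + (?v \<bullet> ?l) *\<^sub>R (\<mu> *\<^sub>R ?l)"
      unfolding normal_tangent_decomp[of "n p" ?v] using \<mu>(1) lin
      by (simp add: linear_add linear_scale)
    then have "?N *\<^sub>R A ?v = (?v \<bullet> n p) *\<^sub>R A (n p) + (?v \<bullet> ?l) *\<^sub>R (\<mu> *\<^sub>R ?l)"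
      using lin by (simp add: linear_scale)
    then have "?l \<bullet> (?N *\<^sub>R A ?v) = ?l \<bullet> ((?v \<bullet> n p) *\<^sub>R A (n p) + (?v \<bullet> ?l) *\<^sub>R (\<mu> *\<^sub>R ?l))"
      by simp
    then have eqA: "?N * (?l \<bullet> A ?v) = (?v \<bullet> n p) * (A (n p) \<bullet> ?l) + \<mu> * (?v \<bullet> ?l) * ?N"
      by (simp add: inner_add_right inner_commute mult_ac)
    have "\<bar>(?v \<bullet> n p) * (A (n p) \<bullet> ?l)\<bar> \<le> e1 * norm ?v * (\<bar>A (n p) \<bullet> ?l\<bar> + 1)"
      unfolding abs_mult using elim e by (intro mult_mono) auto
    also have "\<dots> = D / 8 * norm ?v"
      by (simp add: e1_def field_simps)
    finally have b2: "\<bar>(?v \<bullet> n p) * (A (n p) \<bullet> ?l)\<bar> \<le> D / 8 * norm ?v" .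
    have "?N * (?l \<bullet> X x) = \<mu> * (?v \<bullet> ?l) * ?N + ((?v \<bullet> n p) * (A (n p) \<bullet> ?l) + ?N * (?l \<bullet> (X x - A ?v)))"
      using eqA by (simp add: inner_diff_right algebra_simps)
    moreover have "\<bar>(?v \<bullet> n p) * (A (n p) \<bullet> ?l) + ?N * (?l \<bullet> (X x - A ?v))\<bar> < \<bar>\<mu> * (?v \<bullet> ?l) * ?N\<bar>"
    proof -
      have "\<bar>\<mu>\<bar> * ?N * (norm (n p) * norm ?v) \<le> \<bar>\<mu>\<bar> * ?N * (2 * \<bar>?v \<bullet> ?l\<bar>)"
        using elim N by (intro mult_left_mono) auto
      then have "D / 2 * norm ?v \<le> \<bar>\<mu> * (?v \<bullet> ?l) * ?N\<bar>"
        using N by (simp add: D_def abs_mult mult_ac)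
      moreover have "D * norm ?v > 0" using D elim by simp
      ultimately show ?thesis
        using b1 b2 by (simp add: abs_le_iff)
    qed
    ultimately have "sgn (?N * (?l \<bullet> X x)) = sgn (\<mu> * (?v \<bullet> ?l) * ?N)"
      by (simp only: sgn_add_small)
    then show ?case
      using N by (simp add: sgn_mult inner_commute)
  qed
qed

section \<open>The level set as a graph near the equilibrium\<close>

lemma h_has_derivative: "(h has_derivative (\<lambda>v. v \<bullet> n x)) (at x within S)"
  using h_deriv[of x] unfolding gderiv_def by (rule has_derivative_at_withinI)

text \<open>An implicit function theorem: along \<open>w\<close>, \<open>h\<close> is strictly
  monotone with slope at least \<open>d\<close> in absolute value, so it has one zero on each short
  segment. The same slope gives the last estimate, which turns a value of \<open>h\<close> into a
  bound on the distance from the curve along \<open>w\<close>.\<close>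

lemma level_set_graph:
  assumes w: "n p \<bullet> w \<noteq> 0" and "\<epsilon> > 0"
  obtains \<eta> \<zeta> d \<kappa> where "\<eta> > 0" "\<zeta> > 0" "d > 0" "continuous_on {-\<eta>..\<eta>} \<kappa>"
    "\<And>s. \<bar>s\<bar> \<le> \<eta> \<Longrightarrow> \<bar>\<kappa> s\<bar> \<le> \<zeta> \<and> h (p + s *\<^sub>R c + \<kappa> s *\<^sub>R w) = 0"
    "\<And>s z. \<bar>s\<bar> \<le> \<eta> \<Longrightarrow> \<bar>z\<bar> \<le> \<zeta> \<Longrightarrow> p + s *\<^sub>R c + z *\<^sub>R w \<in> ball p \<epsilon> \<and>
      d * \<bar>z - \<kappa> s\<bar> \<le> \<bar>h (p + s *\<^sub>R c + z *\<^sub>R w)\<bar>"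
proof -
  define P where "P s z = p + s *\<^sub>R c + z *\<^sub>R w" for s z :: real
  \<comment> \<open>This sign makes \<open>i * h\<close> increasing along \<open>w\<close>.\<close>
  define i where "i = sgn (n p \<bullet> w)"
  define d where "d = \<bar>n p \<bullet> w\<bar> / 2"
  have d: "d > 0" using w by (simp add: d_def)
  have i: "i * (n p \<bullet> w) = 2 * d" "\<bar>i\<bar> = 1" using w by (auto simp: i_def d_def sgn_real_def)
  have "((\<lambda>x. i * (n x \<bullet> w)) \<longlongrightarrow> i * (n p \<bullet> w)) (at p)"
    by (intro tendsto_intros n_tendsto)
  then have "\<forall>\<^sub>F x in at p. i * (n x \<bullet> w) > d"
    by (rule order_tendstoD(1)) (use d i in auto)
  moreover have "((\<lambda>x. norm (n x)) \<longlongrightarrow> norm (n p)) (at p)"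
    by (intro tendsto_intros n_tendsto)
  then have "\<forall>\<^sub>F x in at p. norm (n x) < norm (n p) + 1"
    by (rule order_tendstoD(2)) auto
  ultimately have "\<forall>\<^sub>F x in at p. i * (n x \<bullet> w) > d \<and> norm (n x) < norm (n p) + 1"
    by eventually_elim auto
  then obtain \<delta>0 where \<delta>0: "\<delta>0 > 0" "\<And>x. x \<noteq> p \<Longrightarrow> dist x p < \<delta>0 \<Longrightarrow> i * (n x \<bullet> w) > d \<and> norm (n x) < norm (n p) + 1"
    by (auto simp: eventually_at)
  define \<delta> where "\<delta> = min \<delta>0 \<epsilon>"
  have \<delta>: "\<delta> > 0" "i * (n x \<bullet> w) > d" "norm (n x) \<le> norm (n p) + 1" "x \<in> ball p \<epsilon>"
    if "x \<in> ball p \<delta>" for x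
    using that \<delta>0(2)[of x] \<delta>0(1) \<open>\<epsilon> > 0\<close> d i by (cases "x = p"; auto simp: \<delta>_def dist_commute)+
  have "\<delta> > 0" using \<delta>0 \<open>\<epsilon> > 0\<close> by (simp add: \<delta>_def)
  have cw: "norm c + norm w > 0" using w by (auto intro!: add_nonneg_pos)
  define \<zeta> where "\<zeta> = \<delta> / (2 * (norm c + norm w))"
  have \<zeta>: "\<zeta> > 0" using \<open>\<delta> > 0\<close> cw by (simp add: \<zeta>_def)
  have P_ball: "P s z \<in> ball p \<delta>" if "\<bar>s\<bar> \<le> \<zeta>" "\<bar>z\<bar> \<le> \<zeta>" for s z
  proof -
    have "norm (s *\<^sub>R c + z *\<^sub>R w) \<le> \<bar>s\<bar> * norm c + \<bar>z\<bar> * norm w"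
      by (rule norm_triangle_le) simp
    also have "\<dots> \<le> \<zeta> * norm c + \<zeta> * norm w"
      using that by (intro add_mono mult_right_mono) auto
    also have "\<dots> = \<zeta> * (norm c + norm w)"
      by (simp add: algebra_simps)
    also have "\<dots> = \<delta> / 2"
      using cw by (simp add: \<zeta>_def field_simps)
    also have "\<dots> < \<delta>"
      using \<open>\<delta> > 0\<close> by simp
    finally have "norm (- (s *\<^sub>R c + z *\<^sub>R w)) < \<delta>"
      by (simp only: norm_minus_cancel)
    then show ?thesis
      by (simp add: P_def dist_norm)
  qed
  have dz: "((\<lambda>z. h (P s z)) has_real_derivative n (P s z) \<bullet> w) (at z)" for s z
  proof -
    have "((\<lambda>z. P s z) has_derivative (\<lambda>t. t *\<^sub>R w)) (at z)"
      unfolding P_def by (auto intro!: derivative_eq_intros)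
    then have "((\<lambda>z. h (P s z)) has_derivative (\<lambda>t. (t *\<^sub>R w) \<bullet> n (P s z))) (at z)"
      by (rule has_derivative_compose[OF _ h_has_derivative])
    then show ?thesis
      unfolding has_field_derivative_def
      by (rule has_derivative_eq_rhs) (simp add: fun_eq_iff inner_commute mult.commute)
  qed
  have ds: "((\<lambda>s. h (P s z)) has_real_derivative n (P s z) \<bullet> c) (at s)" for s z
  proof -
    have "((\<lambda>s. P s z) has_derivative (\<lambda>t. t *\<^sub>R c)) (at s)"
      unfolding P_def by (auto intro!: derivative_eq_intros)
    then have "((\<lambda>s. h (P s z)) has_derivative (\<lambda>t. (t *\<^sub>R c) \<bullet> n (P s z))) (at s)"
      by (rule has_derivative_compose[OF _ h_has_derivative])
    then show ?thesis
      unfolding has_field_derivative_def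
      by (rule has_derivative_eq_rhs) (simp add: fun_eq_iff inner_commute mult.commute)
  qed
  have mono: "i * h (P s z1) + d * (z2 - z1) \<le> i * h (P s z2)"
    if "\<bar>s\<bar> \<le> \<zeta>" "- \<zeta> \<le> z1" "z1 \<le> z2" "z2 \<le> \<zeta>" for s z1 z2
  proof -
    have "i * h (P s z1) - d * z1 \<le> i * h (P s z2) - d * z2"
    proof (rule DERIV_nonneg_imp_nondecreasing[OF that(3)])
      fix z assume "z1 \<le> z" "z \<le> z2"
      then have "P s z \<in> ball p \<delta>" using that by (intro P_ball) auto
      then have "i * (n (P s z) \<bullet> w) - d \<ge> 0" using \<delta> by force
      moreover have "((\<lambda>z. i * h (P s z) - d * z) has_real_derivative i * (n (P s z) \<bullet> w) - d) (at z)"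
        using dz by (auto intro!: derivative_eq_intros)
      ultimately show "\<exists>y. ((\<lambda>z. i * h (P s z) - d * z) has_real_derivative y) (at z) \<and> 0 \<le> y"
        by blast
    qed
    then show ?thesis by (simp add: algebra_simps)
  qed
  have expand: "d * \<bar>z2 - z1\<bar> \<le> \<bar>h (P s z2) - h (P s z1)\<bar>"
    if "\<bar>s\<bar> \<le> \<zeta>" "\<bar>z1\<bar> \<le> \<zeta>" "\<bar>z2\<bar> \<le> \<zeta>" for s z1 z2
  proof -
    have "d * \<bar>z2 - z1\<bar> \<le> \<bar>i * h (P s z2) - i * h (P s z1)\<bar>"
    proof (cases "z1 \<le> z2")
      case True
      then have "i * h (P s z1) + d * (z2 - z1) \<le> i * h (P s z2)"
        using that by (intro mono) auto
      then show ?thesis using True by simp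
    next
      case False
      then have "i * h (P s z2) + d * (z1 - z2) \<le> i * h (P s z1)"
        using that by (intro mono) auto
      then show ?thesis using False by simp
    qed
    then have "d * \<bar>z2 - z1\<bar> \<le> \<bar>i * (h (P s z2) - h (P s z1))\<bar>"
      by (simp add: right_diff_distrib)
    then show ?thesis using i by (simp add: abs_mult)
  qed
  have P00: "P 0 0 = p" by (simp add: P_def)
  have lim: "((\<lambda>s. i * h (P s z)) \<longlongrightarrow> i * h (P 0 z)) (at 0)" for z
    using DERIV_isCont[OF ds[of z 0]] by (intro tendsto_intros) (auto simp: isCont_def)
  have "d * \<zeta> > 0" using d \<zeta> by simp
  then have "i * h (P 0 \<zeta>) > 0" "i * h (P 0 (- \<zeta>)) < 0"
    using mono[of 0 0 \<zeta>] mono[of 0 "- \<zeta>" 0] \<zeta> h_p P00 by simp_all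
  from order_tendstoD(1)[OF lim this(1)] order_tendstoD(2)[OF lim this(2)]
  have "\<forall>\<^sub>F s in at 0. i * h (P s \<zeta>) > 0 \<and> i * h (P s (- \<zeta>)) < 0"
    by eventually_elim auto
  then obtain \<eta>0 where \<eta>0: "\<eta>0 > 0" "\<And>s. s \<noteq> 0 \<Longrightarrow> \<bar>s\<bar> < \<eta>0 \<Longrightarrow> i * h (P s \<zeta>) > 0 \<and> i * h (P s (- \<zeta>)) < 0"
    by (auto simp: eventually_at dist_real_def)
  define \<eta> where "\<eta> = min (\<eta>0 / 2) \<zeta>"
  have \<eta>: "\<eta> > 0" "\<eta> < \<eta>0" "\<eta> \<le> \<zeta>" using \<eta>0 \<zeta> by (auto simp: \<eta>_def)
  have "\<exists>z. \<bar>z\<bar> \<le> \<zeta> \<and> h (P s z) = 0" if "\<bar>s\<bar> \<le> \<eta>" for s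
  proof (cases "s = 0")
    case True
    then show ?thesis using h_p P00 \<zeta> by (intro exI[of _ 0]) auto
  next
    case False
    then have "i * h (P s (- \<zeta>)) \<le> 0" "0 \<le> i * h (P s \<zeta>)"
      using \<eta>0(2)[of s] that \<eta> by auto
    moreover have "continuous_on {-\<zeta>..\<zeta>} (\<lambda>z. i * h (P s z))"
      using dz by (intro continuous_intros) (meson DERIV_isCont continuous_at_imp_continuous_on)
    ultimately obtain z where "- \<zeta> \<le> z" "z \<le> \<zeta>" "i * h (P s z) = 0"
      using IVT'[of "\<lambda>z. i * h (P s z)" "- \<zeta>" 0 \<zeta>] \<zeta> by auto
    then show ?thesis using i by (intro exI[of _ z]) auto
  qed
  then obtain \<kappa> where \<kappa>: "\<And>s. \<bar>s\<bar> \<le> \<eta> \<Longrightarrow> \<bar>\<kappa> s\<bar> \<le> \<zeta> \<and> h (P s (\<kappa> s)) = 0"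
    by metis
  define B where "B = (norm (n p) + 1) * norm c"
  have lip: "\<bar>h (P s z) - h (P s' z)\<bar> \<le> B * \<bar>s - s'\<bar>" if "\<bar>s\<bar> \<le> \<zeta>" "\<bar>s'\<bar> \<le> \<zeta>" "\<bar>z\<bar> \<le> \<zeta>" for s s' z
  proof -
    have "norm (h (P s z) - h (P s' z)) \<le> B * norm (s - s')"
    proof (rule field_differentiable_bound[of "{-\<zeta>..\<zeta>}" "\<lambda>s. h (P s z)" "\<lambda>s. n (P s z) \<bullet> c"])
      fix u assume "u \<in> {-\<zeta>..\<zeta>}"
      then have "norm (n (P u z)) \<le> norm (n p) + 1"
        using that by (intro \<delta>(3) P_ball) auto
      then show "norm (n (P u z) \<bullet> c) \<le> B"
        unfolding B_def using Cauchy_Schwarz_ineq2[of "n (P u z)" c]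
        by (smt (verit, ccfv_SIG) mult_right_mono norm_ge_zero real_norm_def)
      show "((\<lambda>s. h (P s z)) has_field_derivative n (P u z) \<bullet> c) (at u within {-\<zeta>..\<zeta>})"
        using ds by (rule has_field_derivative_at_within)
    qed (use that in auto)
    then show ?thesis by simp
  qed
  have \<kappa>_lip: "d * \<bar>\<kappa> s - \<kappa> s'\<bar> \<le> B * \<bar>s - s'\<bar>" if "\<bar>s\<bar> \<le> \<eta>" "\<bar>s'\<bar> \<le> \<eta>" for s s'
  proof -
    have "d * \<bar>\<kappa> s - \<kappa> s'\<bar> \<le> \<bar>h (P s' (\<kappa> s)) - h (P s' (\<kappa> s'))\<bar>"
      using \<kappa> that \<eta> by (intro expand) auto
    also have "\<dots> = \<bar>h (P s (\<kappa> s)) - h (P s' (\<kappa> s))\<bar>"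
      using \<kappa> that by simp
    also have "\<dots> \<le> B * \<bar>s - s'\<bar>"
      using \<kappa> that \<eta> by (intro lip) auto
    finally show ?thesis .
  qed
  have "continuous_on {-\<eta>..\<eta>} \<kappa>"
  proof (rule continuous_onI)
    fix s e :: real assume s: "s \<in> {-\<eta>..\<eta>}" and e: "e > 0"
    show "\<exists>\<delta>>0. \<forall>s'\<in>{-\<eta>..\<eta>}. dist s' s < \<delta> \<longrightarrow> dist (\<kappa> s') (\<kappa> s) \<le> e"
    proof (intro exI[of _ "d * e / (B + 1)"] conjI ballI impI)
      have B: "B \<ge> 0" by (simp add: B_def)
      then show "d * e / (B + 1) > 0" using d e by simp
      fix s' assume s': "s' \<in> {-\<eta>..\<eta>}" "dist s' s < d * e / (B + 1)"
      then have "(B + 1) * \<bar>s' - s\<bar> \<le> d * e"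
        using B by (simp add: dist_real_def field_simps)
      then have "B * \<bar>s' - s\<bar> \<le> d * e"
        using abs_ge_zero[of "s' - s"] by (simp only: distrib_right mult_1)
      moreover have "\<bar>s'\<bar> \<le> \<eta>" "\<bar>s\<bar> \<le> \<eta>"
        using s s'(1) by auto
      ultimately have "d * \<bar>\<kappa> s' - \<kappa> s\<bar> \<le> d * e"
        using \<kappa>_lip[of s' s] by linarith
      then show "dist (\<kappa> s') (\<kappa> s) \<le> e"
        using d by (simp add: dist_real_def)
    qed
  qed
  moreover have "d * \<bar>z - \<kappa> s\<bar> \<le> \<bar>h (P s z)\<bar>" if "\<bar>s\<bar> \<le> \<eta>" "\<bar>z\<bar> \<le> \<zeta>" for s z
    using expand[of s "\<kappa> s" z] \<kappa>[of s] that \<eta> by auto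
  moreover have "P s z \<in> ball p \<epsilon>" if "\<bar>s\<bar> \<le> \<eta>" "\<bar>z\<bar> \<le> \<zeta>" for s z
    using \<delta>(4) P_ball that \<eta> by auto
  ultimately show ?thesis
    using that[OF \<eta>(1) \<zeta> d, of \<kappa>] \<kappa> unfolding P_def by blast
qed

text \<open>If \<open>p\<close> were isolated in \<open>h = 0\<close>, \<open>crossing\<close> would
  hold vacuously for every sign and could not separate the two stability types.\<close>

lemma level_set_not_isolated: "p islimpt {x. h x = 0}"
  unfolding islimpt_approachable
proof (intro allI impI)
  fix e :: real assume "e > 0"
  have "n p \<bullet> n p \<noteq> 0" using n_p by simp
  from level_set_graph[OF this \<open>e > 0\<close>, of "rot (n p)"]
  obtain \<eta> \<zeta> d \<kappa> where g: "\<eta> > 0" "\<zeta> > 0" "d > 0"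
    "\<And>s. \<bar>s\<bar> \<le> \<eta> \<Longrightarrow> \<bar>\<kappa> s\<bar> \<le> \<zeta> \<and> h (p + s *\<^sub>R rot (n p) + \<kappa> s *\<^sub>R n p) = 0"
    "\<And>s z. \<bar>s\<bar> \<le> \<eta> \<Longrightarrow> \<bar>z\<bar> \<le> \<zeta> \<Longrightarrow> p + s *\<^sub>R rot (n p) + z *\<^sub>R n p \<in> ball p e \<and>
      d * \<bar>z - \<kappa> s\<bar> \<le> \<bar>h (p + s *\<^sub>R rot (n p) + z *\<^sub>R n p)\<bar>"
    by metis
  let ?x = "p + \<eta> *\<^sub>R rot (n p) + \<kappa> \<eta> *\<^sub>R n p"
  have "(?x - p) \<bullet> rot (n p) = \<eta> * (n p \<bullet> n p)"
    by (simp add: inner_add_left)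
  then have "?x \<noteq> p" using g n_p by force
  moreover have "h ?x = 0" "dist ?x p < e"
    using g(4)[of \<eta>] g(5)[of \<eta> "\<kappa> \<eta>"] g(1) by (auto simp: dist_commute)
  ultimately show "\<exists>x'\<in>{x. h x = 0}. x' \<noteq> p \<and> dist x' p < e"
    by blast
qed

lemma crossing_unique:
  assumes "crossing \<sigma>" "crossing \<tau>"
  shows "\<sigma> = \<tau>"
proof -
  have "\<forall>\<^sub>F x in at p within {x. h x = 0}. \<sigma> = \<tau>"
    using assms[unfolded crossing_def] level_set_norm_le eventually_neq_at_within[of p p]
  proof eventually_elim
    case (elim x)
    then have "norm (n p) * norm (x - p) > 0" using n_p by simp
    then have "sgn ((x - p) \<bullet> rot (n p)) \<noteq> 0" using elim by (auto simp: sgn_0_0)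
    then show ?case using elim by simp
  qed
  moreover have "at p within {x. h x = 0} \<noteq> bot"
    using level_set_not_isolated by (simp add: trivial_limit_within)
  ultimately show ?thesis
    by (simp add: eventually_const)
qed

text \<open>\<open>M\<close> and the level set are graphs over \<open>c\<close> in direction
  \<open>w\<close>, so they are compared at equal \<open>s\<close>. Divergence forces outflow on
  \<open>M\<close>; then \<open>h\<close> vanishes on \<open>M\<close> and both agree for small
  \<open>s > 0\<close>. Convergence forces inflow on \<open>M\<close>; outflow on the level set
  would bound the speed on \<open>M\<close> by a multiple of the absolute value of \<open>h\<close>,
  which \<open>decay_along_inflow_contradiction\<close> excludes.\<close>

lemma center_side:
  assumes cc: "center_curve X p c w l l' r \<phi> \<phi>' M"
    and dec: "\<And>v. v = (l \<bullet> v) *\<^sub>R c + (l' \<bullet> v) *\<^sub>R w"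
    and c: "n p \<bullet> c = 0" and w: "n p \<bullet> w \<noteq> 0"
  shows "(converges_on X p M \<longrightarrow>
      (\<forall>\<^sub>F x in at p within {x. h x = 0}. l \<bullet> (x - p) > 0 \<longrightarrow> l \<bullet> X x < 0)) \<and>
    (diverges_on X p M \<longrightarrow>
      (\<forall>\<^sub>F x in at p within {x. h x = 0}. l \<bullet> (x - p) > 0 \<longrightarrow> l \<bullet> X x > 0))"
proof -
  interpret cc: center_curve X p c w l l' r \<phi> \<phi>' M by (rule cc)
  have m_eq: "cc.m s = p + s *\<^sub>R c + \<phi> s *\<^sub>R w" for s by (rule cc.m_def)
  have lrot: "l \<bullet> rot (n p) \<noteq> 0"
  proof
    assume "l \<bullet> rot (n p) = 0"
    then have "(n p \<bullet> n p) * (l \<bullet> c) = 0"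
      using inner_normal_tangent[of "n p" l c] c by (simp add: inner_commute)
    then show False using n_p cc.dual by simp
  qed
  have "((\<lambda>x. (l \<bullet> rot (n x)) * (l \<bullet> rot (n p))) \<longlongrightarrow> (l \<bullet> rot (n p)) * (l \<bullet> rot (n p))) (at p)"
    by (intro tendsto_mult tendsto_const tendsto_inner tendsto_rot n_tendsto)
  then have "\<forall>\<^sub>F x in at p. (l \<bullet> rot (n x)) * (l \<bullet> rot (n p)) > 0"
    by (rule order_tendstoD(1)) (use lrot in \<open>auto simp: zero_less_mult_iff\<close>)
  then have "\<forall>\<^sub>F x in at p. l \<bullet> rot (n x) \<noteq> 0"
    by eventually_elim auto
  then obtain e0 where e0: "e0 > 0" "\<And>x. x \<noteq> p \<Longrightarrow> dist x p < e0 \<Longrightarrow> l \<bullet> rot (n x) \<noteq> 0"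
    by (auto simp: eventually_at)
  define e where "e = min e0 R"
  have e: "e > 0" "e \<le> R" using e0 R_pos by (auto simp: e_def)
  \<comment> \<open>On the curve, \<open>X x\<close> is a nonzero multiple of
    \<open>rot (n x)\<close>, which \<open>l\<close> does not annihilate near \<open>p\<close>.
    Hence \<open>\<tau>\<close> below has a constant sign.\<close>
  have lX: "l \<bullet> X x \<noteq> 0" if x: "x \<in> ball p e" "x \<noteq> p" "h x = 0" for x
  proof
    assume 0: "l \<bullet> X x = 0"
    have lr: "l \<bullet> rot (n x) \<noteq> 0" "x \<in> ball p R" using e0(2)[of x] x by (auto simp: e_def dist_commute)
    have nx: "X x \<bullet> n x = 0"
      using barrier[of x] lr x \<alpha> by (simp add: inner_commute)
    then have "(X x \<bullet> rot (n x)) * (l \<bullet> rot (n x)) = 0"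
      using inner_normal_tangent[of "n x" l "X x"] 0 by simp
    then have "(n x \<bullet> n x) *\<^sub>R X x = 0"
      using normal_tangent_decomp[of "n x" "X x"] nx lr by simp
    moreover have "n x \<noteq> 0" using lr by auto
    ultimately show False using X_nonzero[OF lr(2) x(2)] by simp
  qed

  obtain \<eta> \<zeta> d \<kappa> where g: "\<eta> > 0" "\<zeta> > 0" "d > 0" "continuous_on {-\<eta>..\<eta>} \<kappa>"
    "\<And>s. \<bar>s\<bar> \<le> \<eta> \<Longrightarrow> \<bar>\<kappa> s\<bar> \<le> \<zeta> \<and> h (p + s *\<^sub>R c + \<kappa> s *\<^sub>R w) = 0"
    "\<And>s z. \<bar>s\<bar> \<le> \<eta> \<Longrightarrow> \<bar>z\<bar> \<le> \<zeta> \<Longrightarrow> p + s *\<^sub>R c + z *\<^sub>R w \<in> ball p e \<and>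
      d * \<bar>z - \<kappa> s\<bar> \<le> \<bar>h (p + s *\<^sub>R c + z *\<^sub>R w)\<bar>"
    using level_set_graph[OF w e(1), of c] by metis
  define \<gamma> where "\<gamma> s = p + s *\<^sub>R c + \<kappa> s *\<^sub>R w" for s
  have \<gamma>: "\<gamma> s \<in> ball p e" "h (\<gamma> s) = 0" if "\<bar>s\<bar> \<le> \<eta>" for s
    using g(5)[OF that] g(6)[OF that, of "\<kappa> s"] by (auto simp: \<gamma>_def)
  have l_\<gamma>: "l \<bullet> (\<gamma> s - p) = s" for s
    by (simp add: \<gamma>_def inner_add_right cc.dual)
  define \<tau> where "\<tau> s = l \<bullet> X (\<gamma> s)" for s
  have "continuous_on {0<..<\<eta>} \<tau>"
  proof -
    have "continuous_on {0<..<\<eta>} \<gamma>"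
      unfolding \<gamma>_def by (intro continuous_intros continuous_on_subset[OF g(4)]) auto
    then have "continuous_on {0<..<\<eta>} (\<lambda>s. X (\<gamma> s))"
      by (rule continuous_on_compose2[OF X_continuous]) (use \<gamma>(1) subset_ball[OF e(2), of p] in \<open>auto simp: subset_iff\<close>)
    then show ?thesis
      unfolding \<tau>_def by (intro continuous_intros)
  qed
  moreover have "\<tau> s \<noteq> 0" if "s \<in> {0<..<\<eta>}" for s
    unfolding \<tau>_def using \<gamma>[of s] that l_\<gamma>[of s] by (intro lX) auto
  ultimately have \<tau>_sign: "(\<forall>s\<in>{0<..<\<eta>}. \<tau> s > 0) \<or> (\<forall>s\<in>{0<..<\<eta>}. \<tau> s < 0)"
    by (intro connected_nonzero_sign) auto

  \<comment> \<open>The estimate on \<open>h\<close> leaves \<open>\<gamma> s\<close> as the only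
    point of \<open>h = 0\<close> near \<open>p\<close> with coordinate \<open>s\<close>.\<close>
  have on_graph: "\<forall>\<^sub>F x in at p within {x. h x = 0}. \<bar>l \<bullet> (x - p)\<bar> < u \<and> x = \<gamma> (l \<bullet> (x - p))"
    if "0 < u" for u
  proof -
    have small: "\<forall>\<^sub>F x in at p within {x. h x = 0}. \<bar>k \<bullet> (x - p)\<bar> < \<theta>" if "\<theta> > 0" for k \<theta>
    proof (rule order_tendstoD(2))
      show "((\<lambda>x. \<bar>k \<bullet> (x - p)\<bar>) \<longlongrightarrow> \<bar>k \<bullet> (p - p)\<bar>) (at p within {x. h x = 0})"
        by (intro tendsto_intros)
    qed (use that in simp)
    have "min u \<eta> > 0" using that g by simp
    from small[OF this, of l] small[OF g(2), of l']
    have "\<forall>\<^sub>F x in at p within {x. h x = 0}. \<bar>l \<bullet> (x - p)\<bar> < min u \<eta> \<and> \<bar>l' \<bullet> (x - p)\<bar> < \<zeta>"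
      by eventually_elim simp
    moreover have "\<forall>\<^sub>F x in at p within {x. h x = 0}. h x = 0"
      by (simp add: eventually_at_filter)
    ultimately show ?thesis
    proof eventually_elim
      case (elim x)
      let ?s = "l \<bullet> (x - p)" and ?z = "l' \<bullet> (x - p)"
      have x: "x = p + ?s *\<^sub>R c + ?z *\<^sub>R w"
        using dec[of "x - p"] by (simp add: algebra_simps)
      have "d * \<bar>?z - \<kappa> ?s\<bar> \<le> \<bar>h (p + ?s *\<^sub>R c + ?z *\<^sub>R w)\<bar>"
        using g(6)[of ?s ?z] elim by auto
      then have "d * \<bar>?z - \<kappa> ?s\<bar> \<le> 0"
        using x elim by simp
      then have "?z = \<kappa> ?s"
        using g(3) by (simp add: mult_le_0_iff)
      then show ?case
        using x elim by (simp add: \<gamma>_def)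
    qed
  qed

  have "(cc.m \<longlongrightarrow> p) (at 0)"
    using cc.isCont_m[of 0] cc.r_pos by (auto simp: isCont_def)
  then have "\<forall>\<^sub>F s in at 0. dist (cc.m s) p < R"
    using R_pos by (rule tendstoD)
  moreover have "\<forall>\<^sub>F s in at 0. \<bar>\<phi> s / s\<bar> < 1"
  proof -
    have "((\<lambda>s. \<phi> s / s) \<longlongrightarrow> 0) (at 0)"
      using cc.\<phi>_deriv[of 0] cc.r_pos cc.\<phi>_0 by (simp add: has_field_derivative_iff)
    then show ?thesis
      using tendsto_rabs[of "\<lambda>s. \<phi> s / s" 0 "at 0"] by (intro order_tendstoD(2)) auto
  qed
  ultimately have "\<forall>\<^sub>F s in at 0. dist (cc.m s) p < R \<and> \<bar>\<phi> s / s\<bar> < 1"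
    by eventually_elim auto
  then obtain r0 where r0: "r0 > 0" "\<And>s. s \<noteq> 0 \<Longrightarrow> \<bar>s\<bar> < r0 \<Longrightarrow> dist (cc.m s) p < R \<and> \<bar>\<phi> s / s\<bar> < 1"
    by (auto simp: eventually_at dist_real_def)
  define r1 where "r1 = Min {r0, r, \<eta>, \<zeta>}"
  have r1: "0 < r1" "r1 \<le> r" "r1 \<le> \<eta>" "r1 \<le> \<zeta>" using r0 cc.r_pos g by (auto simp: r1_def)
  have m: "cc.m s \<in> ball p R" "\<bar>\<phi> s\<bar> \<le> s" if "s \<in> {0<..<r1}" for s
    using r0(2)[of s] that by (auto simp: r1_def dist_commute)
  have in_r: "s \<in> {-r<..<r}" if "s \<in> {0<..<r1}" for s
    using that r1 by auto
  have X_tan: "X (cc.m s) = cc.\<rho> s *\<^sub>R (c + \<phi>' s *\<^sub>R w)" if "s \<in> {0<..<r1}" for s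
    by (rule cc.tangent[OF in_r[OF that]])
  have \<rho>0: "cc.\<rho> s \<noteq> 0" if "s \<in> {0<..<r1}" for s
  proof -
    have "cc.m s \<noteq> p"
      using cc.coordinate_m[of s] that by auto
    then show ?thesis
      using X_nonzero[OF m(1)[OF that]] X_tan[OF that] by auto
  qed
  have \<rho>_cont: "continuous_on {0<..<r1} cc.\<rho>"
  proof -
    have "continuous_on {0<..<r1} cc.m"
      using cc.isCont_m in_r by (meson continuous_at_imp_continuous_on)
    then have "continuous_on {0<..<r1} (\<lambda>s. X (cc.m s))"
      by (rule continuous_on_compose2[OF X_continuous]) (use m(1) in auto)
    then show ?thesis
      unfolding cc.\<rho>_def[abs_def] by (intro continuous_intros)
  qed
  have \<rho>_sign: "(\<forall>s\<in>{0<..<r1}. cc.\<rho> s > 0) \<or> (\<forall>s\<in>{0<..<r1}. cc.\<rho> s < 0)"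
    by (rule connected_nonzero_sign[OF _ \<rho>_cont \<rho>0]) auto
  define y where "y s = h (cc.m s)" for s
  have y_deriv: "(y has_real_derivative (c + \<phi>' s *\<^sub>R w) \<bullet> n (cc.m s)) (at s)" if "s \<in> {-r<..<r}" for s
    unfolding y_def has_field_derivative_def
    by (rule has_derivative_eq_rhs[OF has_derivative_compose[OF
            cc.m_deriv[OF that, unfolded has_vector_derivative_def] h_has_derivative]])
      (simp add: fun_eq_iff mult.commute)
  \<comment> \<open>In time, \<open>h\<close> decays along \<open>M\<close> with rate
    \<open>- \<alpha> (y s)\<close>; division by the speed passes to the parameter
    \<open>s\<close>.\<close>
  have y': "(y has_real_derivative - \<alpha> (y s) / cc.\<rho> s) (at s)" if "s \<in> {0<..<r1}" for s
  proof -
    have "cc.\<rho> s * ((c + \<phi>' s *\<^sub>R w) \<bullet> n (cc.m s)) = - \<alpha> (y s)"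
      using barrier[OF m(1)[OF that]] X_tan[OF that] by (simp add: y_def inner_commute)
    then have "(c + \<phi>' s *\<^sub>R w) \<bullet> n (cc.m s) = - \<alpha> (y s) / cc.\<rho> s"
      using \<rho>0[OF that] by (simp add: field_simps)
    then show ?thesis
      using y_deriv[OF in_r[OF that]] by simp
  qed
  have y0: "y 0 = 0" "(y has_real_derivative 0) (at 0)"
    using y_deriv[of 0] cc.r_pos cc.\<phi>_0 c h_p by (auto simp: y_def inner_commute)

  have "\<forall>\<^sub>F x in at p within {x. h x = 0}. l \<bullet> (x - p) > 0 \<longrightarrow> l \<bullet> X x < 0"
    if conv: "converges_on X p M"
  proof -
    have neg: "\<forall>s\<in>{0<..<r1}. cc.\<rho> s < 0"
      using \<rho>_sign cc.converges_not_outflow[OF conv r1(1,2)] by blast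
    have "\<not> (\<forall>s\<in>{0<..<\<eta>}. \<tau> s > 0)"
    proof
      assume pos: "\<forall>s\<in>{0<..<\<eta>}. \<tau> s > 0"
      \<comment> \<open>\<open>cc.m s\<close> and \<open>\<gamma> s\<close> differ along
        \<open>w\<close> by at most \<open>\<bar>y s\<bar> / d\<close> in the coefficient, so by the
        Lipschitz bound \<open>cc.\<rho> s\<close> and \<open>\<tau> s\<close> differ by at most
        \<open>K * \<bar>y s\<bar>\<close>.\<close>
      define K where "K = norm l * (max L 0 * norm w) / d"
      have "cc.\<rho> s \<ge> - K * \<bar>y s\<bar>" if s: "s \<in> {0<..<r1}" for s
      proof -
        have s': "\<bar>s\<bar> \<le> \<eta>" "\<bar>\<phi> s\<bar> \<le> \<zeta>" "s \<in> {0<..<\<eta>}" using s r1 m(2)[OF s] by auto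
        have "norm (X (cc.m s) - X (\<gamma> s)) \<le> L * norm (cc.m s - \<gamma> s)"
          using m(1)[OF s] \<gamma>(1)[OF s'(1)] e by (intro X_lipschitz) auto
        also have "\<dots> \<le> max L 0 * norm (cc.m s - \<gamma> s)"
          by (intro mult_right_mono) auto
        also have "cc.m s - \<gamma> s = (\<phi> s - \<kappa> s) *\<^sub>R w"
          by (simp add: m_eq \<gamma>_def algebra_simps)
        also have "max L 0 * norm ((\<phi> s - \<kappa> s) *\<^sub>R w) = max L 0 * norm w * \<bar>\<phi> s - \<kappa> s\<bar>"
          by simp
        also have "\<dots> \<le> max L 0 * norm w * (\<bar>y s\<bar> / d)"
        proof (rule mult_left_mono)
          have "d * \<bar>\<phi> s - \<kappa> s\<bar> \<le> \<bar>y s\<bar>"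
            using g(6)[OF s'(1,2)] by (simp add: y_def m_eq)
          then show "\<bar>\<phi> s - \<kappa> s\<bar> \<le> \<bar>y s\<bar> / d"
            using g(3) by (simp add: field_simps)
        qed simp
        finally have "norm l * norm (X (cc.m s) - X (\<gamma> s)) \<le> norm l * (max L 0 * norm w * (\<bar>y s\<bar> / d))"
          by (rule mult_left_mono) simp
        then have "\<bar>l \<bullet> (X (cc.m s) - X (\<gamma> s))\<bar> \<le> K * \<bar>y s\<bar>"
          using Cauchy_Schwarz_ineq2[of l "X (cc.m s) - X (\<gamma> s)"] by (simp add: K_def)
        moreover have "\<tau> s > 0" using pos s' by auto
        ultimately show ?thesis
          by (simp add: inner_diff_right \<tau>_def cc.\<rho>_def abs_le_iff)
      qed
      then show False
        using decay_along_inflow_contradiction[OF r1(1) y' y0 _ _ \<alpha>(2-4)] neg by blast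
    qed
    then have \<tau>_neg: "\<forall>s\<in>{0<..<\<eta>}. \<tau> s < 0" using \<tau>_sign by blast
    show ?thesis
      using on_graph[OF g(1)]
    proof eventually_elim
      case (elim x)
      show ?case
      proof
        assume "l \<bullet> (x - p) > 0"
        then have "\<tau> (l \<bullet> (x - p)) < 0" using \<tau>_neg elim by auto
        then show "l \<bullet> X x < 0" using elim by (simp add: \<tau>_def)
      qed
    qed
  qed
  moreover have "\<forall>\<^sub>F x in at p within {x. h x = 0}. l \<bullet> (x - p) > 0 \<longrightarrow> l \<bullet> X x > 0"
    if div: "diverges_on X p M"
  proof -
    define K where "K = norm l * (max L 0 * (norm c + norm w))"
    have bound: "- cc.\<rho> s \<le> K * s" if s: "s \<in> {0<..<r1}" for s
    proof -
      have "norm (X (cc.m s) - X p) \<le> L * norm (cc.m s - p)"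
        using m(1)[OF s] R_pos by (intro X_lipschitz) auto
      also have "\<dots> \<le> max L 0 * norm (cc.m s - p)"
        by (intro mult_right_mono) auto
      also have "\<dots> \<le> max L 0 * ((norm c + norm w) * s)"
      proof (rule mult_left_mono)
        have "norm (cc.m s - p) \<le> \<bar>s\<bar> * norm c + \<bar>\<phi> s\<bar> * norm w"
          unfolding m_eq by (simp add: norm_triangle_le)
        also have "\<dots> \<le> s * norm c + s * norm w"
          using m(2)[OF s] s by (intro add_mono mult_right_mono) auto
        finally show "norm (cc.m s - p) \<le> (norm c + norm w) * s"
          by (simp add: algebra_simps)
      qed simp
      finally have "norm l * norm (X (cc.m s)) \<le> K * s"
        by (simp add: K_def X_p mult.assoc mult_left_mono)
      then show ?thesis
        using Cauchy_Schwarz_ineq2[of l "X (cc.m s)"] by (simp add: cc.\<rho>_def)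
    qed
    have pos: "\<forall>s\<in>{0<..<r1}. cc.\<rho> s > 0"
      using \<rho>_sign cc.diverges_not_inflow[OF div r1(1,2) _ \<rho>_cont bound] by blast
    have y_lim: "(y \<longlongrightarrow> 0) (at_right 0)"
      using DERIV_isCont[OF y0(2)] y0(1) by (simp add: isCont_def filterlim_at_split)
    have y_zero: "y s = 0" if "s \<in> {0<..<r1}" for s
      by (rule barrier_vanishes_along_outflow[OF y' y_lim _ \<alpha>(1,2) that]) (use pos in auto)
    show ?thesis
      using on_graph[OF r1(1)]
    proof eventually_elim
      case (elim x)
      show ?case
      proof
        assume "l \<bullet> (x - p) > 0"
        then have s: "l \<bullet> (x - p) \<in> {0<..<r1}" using elim by auto
        let ?s = "l \<bullet> (x - p)"
        have "d * \<bar>\<phi> ?s - \<kappa> ?s\<bar> \<le> \<bar>y ?s\<bar>"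
          using g(6)[of ?s "\<phi> ?s"] m(2)[OF s] s r1 by (simp add: y_def m_eq)
        then have "\<phi> ?s = \<kappa> ?s"
          using y_zero[OF s] g(3) by (simp add: mult_le_0_iff)
        then have "x = cc.m ?s"
          using elim by (metis \<gamma>_def m_eq)
        then have "l \<bullet> X x = cc.\<rho> ?s"
          unfolding cc.\<rho>_def by simp
        then show "l \<bullet> X x > 0" using pos s by simp
      qed
    qed
  qed
  ultimately show ?thesis by blast
qed

text \<open>Since \<open>n p\<close> is a left eigenvector for \<open>- a\<close>, which is not 0,
  the kernel vector \<open>c\<close> is tangent to \<open>h = 0\<close>. If \<open>w\<close> were
  tangent too, \<open>A\<close> would annihilate it, against \<open>\<mu> \<noteq> 0\<close>. So
  \<open>center_side\<close> applies to \<open>M\<close> and, with \<open>- c\<close> for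
  \<open>c\<close>, to the other side of \<open>p\<close>.\<close>

lemma crossing_center:
  assumes cm: "center_manifold X p M" and A: "A = (*v) (jacobian X (at p))"
  shows "converges_on X p M \<Longrightarrow> crossing (-1)" "diverges_on X p M \<Longrightarrow> crossing 1"
proof -
  obtain c w \<mu> r \<phi> where cw: "c \<noteq> 0" "A c = 0" "w \<noteq> 0" "\<mu> \<noteq> 0" "A w = \<mu> *\<^sub>R w"
    and r: "r > 0" "C1_on {-r<..<r} \<phi>" "\<phi> 0 = 0" "(\<phi> has_real_derivative 0) (at 0)"
    and M: "M = (\<lambda>s. p + s *\<^sub>R c + \<phi> s *\<^sub>R w) ` {-r<..<r}" and inv: "locally_invariant X M"
    using cm unfolding center_manifold_def A by blast
  have lin: "linear A" using X_deriv by (rule has_derivative_linear)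
  have nc: "n p \<bullet> c = 0"
    using derivative_normal[of c] cw \<alpha>(4) by simp
  have nw: "n p \<bullet> w \<noteq> 0"
  proof
    assume "n p \<bullet> w = 0"
    then have "(n p \<bullet> n p) *\<^sub>R w = (w \<bullet> rot (n p)) *\<^sub>R rot (n p)"
      "(n p \<bullet> n p) *\<^sub>R c = (c \<bullet> rot (n p)) *\<^sub>R rot (n p)"
      using normal_tangent_decomp[of "n p" w] normal_tangent_decomp[of "n p" c] nc by (simp_all add: inner_commute)
    then have w': "A ((n p \<bullet> n p) *\<^sub>R w) = A ((w \<bullet> rot (n p)) *\<^sub>R rot (n p))"
      and c': "A ((n p \<bullet> n p) *\<^sub>R c) = A ((c \<bullet> rot (n p)) *\<^sub>R rot (n p))"
      by simp_all
    have "c \<bullet> rot (n p) \<noteq> 0"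
      using \<open>(n p \<bullet> n p) *\<^sub>R c = _\<close> n_p cw by auto
    then have "A (rot (n p)) = 0"
      using c' cw(2) by (simp add: linear_scale[OF lin])
    then show False
      using w' cw n_p by (simp add: linear_scale[OF lin])
  qed
  have "rot w \<bullet> c \<noteq> 0"
  proof
    assume "rot w \<bullet> c = 0"
    then have "(n p \<bullet> w) *\<^sub>R c = (n p \<bullet> c) *\<^sub>R w"
      by (simp add: vec2_eq_iff inner_real2) algebra
    then show False using nc nw cw by simp
  qed
  then obtain l l' where dual: "l \<bullet> c = 1" "l \<bullet> w = 0" "l' \<bullet> c = 0" "l' \<bullet> w = 1"
    and dec: "\<And>v. v = (l \<bullet> v) *\<^sub>R c + (l' \<bullet> v) *\<^sub>R w"
    using planar_dual_basis by metis
  obtain F' :: "real \<Rightarrow> real \<Rightarrow>\<^sub>L real" where F': "\<And>s. s \<in> {-r<..<r} \<Longrightarrow> (\<phi> has_derivative blinfun_apply (F' s)) (at s)"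
    using r(2) unfolding C1_on_def by blast
  define \<phi>' where "\<phi>' s = blinfun_apply (F' s) 1" for s
  have \<phi>': "(\<phi> has_real_derivative \<phi>' s) (at s)" if "s \<in> {-r<..<r}" for s
  proof -
    have "blinfun_apply (F' s) = (*) (\<phi>' s)"
    proof
      fix u
      show "blinfun_apply (F' s) u = \<phi>' s * u"
        using blinfun.scaleR_right[of "F' s" u 1] by (simp add: \<phi>'_def mult.commute)
    qed
    then show ?thesis
      using F'[OF that] by (simp add: has_field_derivative_def)
  qed
  have "\<phi>' 0 = 0"
    using DERIV_unique[OF \<phi>'[of 0] r(4)] r(1) by simp
  then have cc: "center_curve X p c w l l' r \<phi> \<phi>' M"
    using dual r \<phi>' M inv by unfold_locales auto
  have cc': "center_curve X p (- c) w (- l) l' r (\<lambda>s. \<phi> (- s)) (\<lambda>s. - \<phi>' (- s)) M"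
    by (rule center_curve.reversed[OF cc])
  note side = center_side[OF cc dec nc nw]
  have dec': "v = (- l \<bullet> v) *\<^sub>R (- c) + (l' \<bullet> v) *\<^sub>R w" for v
    using dec[of v] by simp
  have nc': "n p \<bullet> (- c) = 0" using nc by simp
  note side' = center_side[OF cc' dec' nc' nw]
  have lrot: "l \<bullet> rot (n p) \<noteq> 0"
  proof
    assume "l \<bullet> rot (n p) = 0"
    then have "(n p \<bullet> n p) * (l \<bullet> c) = 0"
      using inner_normal_tangent[of "n p" l c] nc by (simp add: inner_commute)
    then show False using n_p dual by simp
  qed
  have ne: "\<forall>\<^sub>F x in at p within {x. h x = 0}. l \<bullet> (x - p) \<noteq> 0"
    using level_set_coordinate[OF lrot] level_set_norm_le eventually_neq_at_within[of p p]
  proof eventually_elim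
    case (elim x)
    then have "norm (n p) * norm (x - p) > 0" using n_p by simp
    then have "sgn (l \<bullet> (x - p)) \<noteq> 0" using elim lrot by (auto simp: sgn_0_0)
    then show ?case by auto
  qed
  show "crossing (-1)" if "converges_on X p M"
  proof (rule crossingI[OF lrot])
    from that side side' have "\<forall>\<^sub>F x in at p within {x. h x = 0}. l \<bullet> (x - p) > 0 \<longrightarrow> l \<bullet> X x < 0"
      "\<forall>\<^sub>F x in at p within {x. h x = 0}. - l \<bullet> (x - p) > 0 \<longrightarrow> - l \<bullet> X x < 0"
      by blast+
    then show "\<forall>\<^sub>F x in at p within {x. h x = 0}. sgn (l \<bullet> X x) = - 1 * sgn (l \<bullet> (x - p))"
      using ne by eventually_elim (auto simp: sgn_real_def)
  qed
  show "crossing 1" if "diverges_on X p M"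
  proof (rule crossingI[OF lrot])
    from that side side' have "\<forall>\<^sub>F x in at p within {x. h x = 0}. l \<bullet> (x - p) > 0 \<longrightarrow> l \<bullet> X x > 0"
      "\<forall>\<^sub>F x in at p within {x. h x = 0}. - l \<bullet> (x - p) > 0 \<longrightarrow> - l \<bullet> X x > 0"
      by blast+
    then show "\<forall>\<^sub>F x in at p within {x. h x = 0}. sgn (l \<bullet> X x) = 1 * sgn (l \<bullet> (x - p))"
      using ne by eventually_elim (auto simp: sgn_real_def)
  qed
qed

text \<open>The trace splits into the shares of \<open>n p\<close> and \<open>rot (n p)\<close>. The
  first is \<open>- a\<close>, which leaves \<open>\<mu>\<close> for the second; and
  \<open>A (rot (n p))\<close> has no normal part, so the tangent is an eigenvector for
  \<open>\<mu>\<close>.\<close>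

lemma crossing_eigenvalue:
  assumes ev: "eigenvalue_pair (jacobian X (at p)) (- a) \<mu>" and A: "A = (*v) (jacobian X (at p))"
    and "\<mu> \<noteq> 0"
  shows "crossing (sgn \<mu>)"
proof (rule crossing_hyperbolic[OF _ \<open>\<mu> \<noteq> 0\<close>])
  define B where "B = jacobian X (at p)"
  have AB: "A v = B *v v" for v by (simp add: A B_def)
  have "det (mat z - B) = (z + a) * (z - \<mu>)" for z
    using ev by (simp add: eigenvalue_pair_def B_def)
  then have "(z - B $ 1 $ 1) * (z - B $ 2 $ 2) - B $ 1 $ 2 * B $ 2 $ 1 = (z + a) * (z - \<mu>)" for z
    by (simp add: det_2 mat_def)
  \<comment> \<open>The difference of the values of a monic quadratic at 1 and 0 isolates the
    trace.\<close>
  from this[of 0] this[of 1] have tr: "B $ 1 $ 1 + B $ 2 $ 2 = \<mu> - a"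
    by (simp add: algebra_simps)
  let ?n = "n p"
  have "?n \<bullet> A ?n + rot ?n \<bullet> A (rot ?n) = (B $ 1 $ 1 + B $ 2 $ 2) * (?n \<bullet> ?n)"
    by (simp add: AB inner_real2 matrix_vector_mult_def sum_2 algebra_simps)
  then have "rot ?n \<bullet> A (rot ?n) = \<mu> * (?n \<bullet> ?n)"
    unfolding tr derivative_normal by (simp add: algebra_simps)
  moreover have "?n \<bullet> A (rot ?n) = 0"
    unfolding derivative_normal by simp
  ultimately have "(?n \<bullet> ?n) *\<^sub>R A (rot ?n) = (?n \<bullet> ?n) *\<^sub>R (\<mu> *\<^sub>R rot ?n)"
    using normal_tangent_decomp[of ?n "A (rot ?n)"] by (simp add: inner_commute)
  then show "A (rot ?n) = \<mu> *\<^sub>R rot ?n"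
    using n_p by (metis inner_eq_zero_iff scaleR_cancel_left)
qed

lemma crossing_stable_saddle:
  assumes A: "A = (*v) (jacobian X (at p))"
  shows "asymptotically_stable_type X a p \<Longrightarrow> crossing (-1)"
    and "saddle_type X a p \<Longrightarrow> crossing 1"
proof -
  show "crossing (-1)" if st: "asymptotically_stable_type X a p"
  proof -
    obtain \<mu> where ev: "eigenvalue_pair (jacobian X (at p)) (- a) \<mu>"
      and \<mu>: "\<mu> < 0 \<or> \<mu> = 0 \<and> (\<exists>M. center_manifold X p M \<and> converges_on X p M)"
      using st unfolding asymptotically_stable_type_def by blast
    from \<mu> show ?thesis
    proof
      assume "\<mu> < 0"
      then show ?thesis using crossing_eigenvalue[OF ev A] by simp
    qed (use crossing_center(1)[OF _ A] in blast)
  qed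
  show "crossing 1" if st: "saddle_type X a p"
  proof -
    obtain \<mu> where ev: "eigenvalue_pair (jacobian X (at p)) (- a) \<mu>"
      and \<mu>: "\<mu> > 0 \<or> \<mu> = 0 \<and> (\<exists>M. center_manifold X p M \<and> diverges_on X p M)"
      using st unfolding saddle_type_def by blast
    from \<mu> show ?thesis
    proof
      assume "\<mu> > 0"
      then show ?thesis using crossing_eigenvalue[OF ev A] by simp
    qed (use crossing_center(2)[OF _ A] in blast)
  qed
qed

end

section \<open>The safety filter\<close>

lemma C1_on_gradient:
  fixes h :: "'a::euclidean_space \<Rightarrow> real"
  assumes "C1_on UNIV h"
  shows "GDERIV h x :> gradient h x" "continuous_on UNIV (gradient h)"
proof -
  obtain F' :: "'a \<Rightarrow> 'a \<Rightarrow>\<^sub>L real" where F': "\<And>x. (h has_derivative blinfun_apply (F' x)) (at x)"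
    and cont: "continuous_on UNIV F'"
    using assms unfolding C1_on_def by auto
  define d where "d x = (\<Sum>i\<in>Basis. blinfun_apply (F' x) i *\<^sub>R i)" for x
  have "blinfun_apply (F' x) v = v \<bullet> d x" for x v
  proof -
    have "blinfun_apply (F' x) v = blinfun_apply (F' x) (\<Sum>i\<in>Basis. (v \<bullet> i) *\<^sub>R i)"
      by (simp only: euclidean_representation)
    also have "\<dots> = v \<bullet> d x"
      by (simp add: d_def blinfun.sum_right blinfun.scaleR_right inner_sum_right mult.commute)
    finally show ?thesis .
  qed
  then have d: "GDERIV h x :> d x" for x
    using F'[of x] unfolding gderiv_def by (metis (no_types, lifting) has_derivative_eq_rhs ext)
  have "gradient h x = d x" for x
    unfolding gradient_def
  proof (rule the_equality)
    fix e assume "GDERIV h x :> e"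
    then have "(\<lambda>v. v \<bullet> e) = (\<lambda>v. v \<bullet> d x)"
      using d[of x] unfolding gderiv_def by (rule has_derivative_unique)
    then show "e = d x"
      by (metis vector_eq_ldot)
  qed (rule d)
  then have "gradient h = d" by auto
  then show "GDERIV h x :> gradient h x" "continuous_on UNIV (gradient h)"
    using d cont unfolding d_def by (auto intro!: continuous_intros)
qed

lemma C1_on_imp_lipschitz_ball:
  fixes X :: "'a::real_normed_vector \<Rightarrow> 'b::real_normed_vector"
  assumes "open U" "p \<in> U" "C1_on U X"
  obtains R L where "R > 0" "ball p R \<subseteq> U"
    "\<And>x y. x \<in> ball p R \<Longrightarrow> y \<in> ball p R \<Longrightarrow> norm (X x - X y) \<le> L * norm (x - y)"
proof -
  obtain F' :: "'a \<Rightarrow> 'a \<Rightarrow>\<^sub>L 'b" where F': "\<And>x. x \<in> U \<Longrightarrow> (X has_derivative blinfun_apply (F' x)) (at x)"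
    and cont: "continuous_on U F'"
    using assms(3) unfolding C1_on_def by auto
  have "isCont F' p"
    using cont assms by (simp add: continuous_on_eq_continuous_at)
  then have "((\<lambda>x. norm (F' x)) \<longlongrightarrow> norm (F' p)) (at p)"
    unfolding isCont_def by (rule tendsto_norm)
  then have "\<forall>\<^sub>F x in at p. norm (F' x) < norm (F' p) + 1"
    by (rule order_tendstoD(2)) auto
  then obtain d where d: "d > 0" "\<And>x. x \<noteq> p \<Longrightarrow> dist x p < d \<Longrightarrow> norm (F' x) < norm (F' p) + 1"
    by (auto simp: eventually_at)
  obtain r where r: "r > 0" "ball p r \<subseteq> U"
    using assms open_contains_ball by blast
  define R where "R = min d r"
  have R: "R > 0" "ball p R \<subseteq> U" using d r by (auto simp: R_def)
  have bound: "norm (F' x) \<le> norm (F' p) + 1" if "x \<in> ball p R" for x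
    using d(2)[of x] that by (cases "x = p") (auto simp: R_def dist_commute)
  have "norm (X x - X y) \<le> (norm (F' p) + 1) * norm (x - y)" if "x \<in> ball p R" "y \<in> ball p R" for x y
  proof (rule differentiable_bound[OF convex_ball _ _ that])
    show "(X has_derivative blinfun_apply (F' x)) (at x within ball p R)" if "x \<in> ball p R" for x
      using F' R that by (blast intro: has_derivative_at_withinI)
    show "onorm (blinfun_apply (F' x)) \<le> norm (F' p) + 1" if "x \<in> ball p R" for x
      using bound[OF that] by (simp add: norm_blinfun.rep_eq)
  qed
  with R show ?thesis by (rule that)
qed

section \<open>Positive definite weights and the minimizing input\<close>

lemma positive_definite_invertible:
  assumes "positive_definite A"
  shows "det A \<noteq> 0" "A *v (matrix_inv A *v b) = b"
proof -
  have "\<forall>x. A *v x = 0 \<longrightarrow> x = 0"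
    using assms unfolding positive_definite_def by (metis inner_zero_right less_irrefl)
  then have inv: "invertible A"
    using matrix_left_invertible_ker invertible_left_inverse by blast
  then show "det A \<noteq> 0"
    by (simp add: invertible_det_nz)
  have "A ** matrix_inv A = mat 1"
    using inv unfolding invertible_def matrix_inv_def by (rule someI2_ex) blast
  then show "A *v (matrix_inv A *v b) = b"
    by (simp add: matrix_vector_mul_assoc)
qed

lemma positive_definite_inv_pos:
  assumes "positive_definite A" "b \<noteq> 0"
  shows "b \<bullet> (matrix_inv A *v b) > 0"
proof -
  let ?y = "matrix_inv A *v b"
  have y: "A *v ?y = b" by (rule positive_definite_invertible[OF assms(1)])
  then have "?y \<noteq> 0" using assms(2) by auto
  then have "?y \<bullet> (A *v ?y) > 0"
    using assms(1) unfolding positive_definite_def by blast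
  then show ?thesis using y by (simp add: inner_commute)
qed

lemma continuous_on_det:
  fixes A :: "'a::topological_space \<Rightarrow> real^'n^'n"
  assumes "\<And>i j. continuous_on S (\<lambda>x. A x $ i $ j)"
  shows "continuous_on S (\<lambda>x. det (A x))"
  unfolding det_def by (intro continuous_intros assms)

lemma continuous_on_matrix_vector_mult:
  fixes A :: "'a::topological_space \<Rightarrow> real^'n^'m"
  assumes "continuous_on S A" "continuous_on S v"
  shows "continuous_on S (\<lambda>x. A x *v v x)"
  unfolding matrix_vector_mult_def
  by (intro continuous_on_vec_lambda continuous_intros assms)

text \<open>Cramer's rule writes the entries of the solution as quotients of determinants.\<close>

lemma continuous_on_matrix_inv_mult:
  fixes A :: "'a::topological_space \<Rightarrow> real^'n^'n"
  assumes A: "continuous_on S A" and b: "continuous_on S b" and pd: "\<And>x. positive_definite (A x)"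
  shows "continuous_on S (\<lambda>x. matrix_inv (A x) *v b x)"
proof -
  have "matrix_inv (A x) *v b x =
      (\<chi> k. det (\<chi> i j. if j = k then b x $ i else A x $ i $ j) / det (A x))" for x
    using cramer[OF positive_definite_invertible(1)[OF pd]] positive_definite_invertible(2)[OF pd] by blast
  moreover have "continuous_on S (\<lambda>x. (\<chi> k. det (\<chi> i j. if j = k then b x $ i else A x $ i $ j) / det (A x)))"
  proof (intro continuous_on_vec_lambda continuous_on_divide continuous_on_det)
    show "continuous_on S (\<lambda>x. (\<chi> i j. if j = k then b x $ i else A x $ i $ j) $ i $ j)" for i j k
      using A b by (cases "j = k") (auto intro!: continuous_intros)
  qed (use A positive_definite_invertible(1)[OF pd] in \<open>auto intro!: continuous_intros\<close>)
  ultimately show ?thesis by simp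
qed

lemma inner_transpose_mult: "(transpose A *v u) \<bullet> v = u \<bullet> (A *v v)" for A :: "real^'n^'m"
  by (simp add: dot_lmul_matrix)

text \<open>The Lagrange condition \<open>A *v v = \<beta> *\<^sub>R q\<close> with
  \<open>\<beta> > 0\<close> makes the linear term at \<open>v\<close> nonnegative on the half
  space, while the quadratic term is strictly positive. Strictness gives the uniqueness that
  \<open>THE\<close> asks for.\<close>

lemma positive_definite_half_space_minimizer:
  assumes pd: "positive_definite A" and "q \<noteq> 0" "c > 0"
  shows "(THE \<theta>. \<theta> \<in> {\<theta>. c \<le> q \<bullet> \<theta>} \<and> (\<forall>\<eta>\<in>{\<theta>. c \<le> q \<bullet> \<theta>}. \<theta> \<bullet> (A *v \<theta>) \<le> \<eta> \<bullet> (A *v \<eta>))) =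
    (c / (q \<bullet> (matrix_inv A *v q))) *\<^sub>R (matrix_inv A *v q)"
proof -
  define y where "y = matrix_inv A *v q"
  define \<beta> where "\<beta> = c / (q \<bullet> y)"
  define v where "v = \<beta> *\<^sub>R y"
  have qy: "q \<bullet> y > 0"
    unfolding y_def by (rule positive_definite_inv_pos) fact+
  have Av: "A *v v = \<beta> *\<^sub>R q"
    unfolding v_def y_def by (simp add: matrix_vector_mult_scaleR positive_definite_invertible(2)[OF pd])
  have \<beta>: "\<beta> > 0" using qy \<open>c > 0\<close> by (simp add: \<beta>_def)
  have qv: "q \<bullet> v = c" using qy by (simp add: v_def \<beta>_def)
  have sym: "v \<bullet> (A *v d) = \<beta> * (q \<bullet> d)" for d
    using pd inner_transpose_mult[of A v d] Av unfolding positive_definite_def by simp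
  have expand: "(v + d) \<bullet> (A *v (v + d)) = v \<bullet> (A *v v) + 2 * (\<beta> * (q \<bullet> d)) + d \<bullet> (A *v d)" for d
    using sym[of d] Av
    by (simp add: matrix_vector_right_distrib inner_add_left inner_add_right inner_commute distrib_left)
  have pos: "d \<bullet> (A *v d) > 0" if "d \<noteq> 0" for d
    using pd that unfolding positive_definite_def by blast
  have less: "v \<bullet> (A *v v) < \<eta> \<bullet> (A *v \<eta>)" if "c \<le> q \<bullet> \<eta>" "\<eta> \<noteq> v" for \<eta>
  proof -
    have "\<beta> * (q \<bullet> (\<eta> - v)) \<ge> 0"
      using that(1) \<beta> qv by (simp add: inner_diff_right)
    moreover have "(\<eta> - v) \<bullet> (A *v (\<eta> - v)) > 0"
      using that(2) by (intro pos) simp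
    ultimately show ?thesis
      using expand[of "\<eta> - v"] by simp
  qed
  have "(THE \<theta>. \<theta> \<in> {\<theta>. c \<le> q \<bullet> \<theta>} \<and> (\<forall>\<eta>\<in>{\<theta>. c \<le> q \<bullet> \<theta>}. \<theta> \<bullet> (A *v \<theta>) \<le> \<eta> \<bullet> (A *v \<eta>))) = v"
  proof (rule the_equality)
    show "v \<in> {\<theta>. c \<le> q \<bullet> \<theta>} \<and> (\<forall>\<eta>\<in>{\<theta>. c \<le> q \<bullet> \<theta>}. v \<bullet> (A *v v) \<le> \<eta> \<bullet> (A *v \<eta>))"
      using qv less by (auto intro: less_imp_le)
    show "\<theta> = v" if "\<theta> \<in> {\<theta>. c \<le> q \<bullet> \<theta>} \<and> (\<forall>\<eta>\<in>{\<theta>. c \<le> q \<bullet> \<theta>}. \<theta> \<bullet> (A *v \<theta>) \<le> \<eta> \<bullet> (A *v \<eta>))" for \<theta>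
      using that qv less[of \<theta>] by force
  qed
  then show ?thesis by (simp only: v_def \<beta>_def y_def)
qed

lemma safety_filter_active:
  assumes pd: "positive_definite (G x)"
    and q: "transpose (g x) *v gradient h x \<noteq> 0" (is "?q \<noteq> 0")
    and neg: "gradient h x \<bullet> F x + \<alpha> (h x) < 0"
  shows "safety_filter F g h \<alpha> G x =
    (- (gradient h x \<bullet> F x + \<alpha> (h x)) / (?q \<bullet> (matrix_inv (G x) *v ?q))) *\<^sub>R (matrix_inv (G x) *v ?q)"
proof -
  have "filter_feasible F g h \<alpha> x = {\<theta>. - (gradient h x \<bullet> F x + \<alpha> (h x)) \<le> ?q \<bullet> \<theta>}"
    unfolding filter_feasible_def inner_transpose_mult inner_add_right by (intro Collect_cong) linarith
  then show ?thesis
    unfolding safety_filter_def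
    by (simp only:) (rule positive_definite_half_space_minimizer[OF pd q], use neg in simp)
qed

text \<open>At \<open>t = 0\<close> the derivative of \<open>h\<close> along \<open>n x\<close> is
  the positive number \<open>n x \<bullet> n x\<close>; compactness of \<open>S\<close> makes the
  length \<open>e\<close> uniform.\<close>

lemma uniform_gradient_transversal:
  fixes h :: "'a::euclidean_space \<Rightarrow> real"
  assumes h: "\<And>x. GDERIV h x :> n x" and n: "continuous_on UNIV n"
    and S: "compact S" "\<And>x. x \<in> S \<Longrightarrow> h x = 0" "\<And>x. x \<in> S \<Longrightarrow> n x \<noteq> 0"
  shows "\<exists>e>0. \<forall>x\<in>S. \<forall>t. 0 < t \<longrightarrow> t \<le> e \<longrightarrow> h (x - t *\<^sub>R n x) < 0 \<and> h (x + t *\<^sub>R n x) > 0"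
proof -
  define f where "f = (\<lambda>z. n (fst z + snd z *\<^sub>R n (fst z)) \<bullet> n (fst z))"
  have cf: "continuous_on (S \<times> {-1..1}) f"
    unfolding f_def
    by (intro continuous_intros continuous_on_compose2[OF n]) (auto intro!: continuous_intros)
  have cpt: "compact (S \<times> {-1..1::real})"
    using S by (intro compact_Times) auto
  have "\<exists>e>0. \<forall>x\<in>S. \<forall>t\<in>{-1..1}. \<bar>t\<bar> \<le> e \<longrightarrow> f (x, t) > 0"
  proof -
    \<comment> \<open>Here the derivative fails to be positive. \<open>Z\<close> is compact and
      avoids \<open>t = 0\<close>, so if it is nonempty, \<open>\<bar>t\<bar>\<close> has a positive
      minimum on it; half of that minimum is safe.\<close>
    define Z where "Z = (S \<times> {-1..1}) \<inter> f -` {..0}"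
    have "closed Z"
      unfolding Z_def by (rule continuous_closed_preimage[OF cf compact_imp_closed[OF cpt] closed_atMost])
    then have "compact ((S \<times> {-1..1}) \<inter> Z)"
      using cpt by (rule_tac compact_Int_closed)
    then have "compact Z"
      by (simp add: Z_def Int_assoc[symmetric])
    show ?thesis
    proof (cases "Z = {}")
      case True
      then show ?thesis unfolding Z_def by (intro exI[of _ 1]) force
    next
      case False
      have "continuous_on Z (\<lambda>z. \<bar>snd z\<bar>)"
        by (intro continuous_intros)
      from continuous_attains_inf[OF \<open>compact Z\<close> False this]
      obtain z where z: "z \<in> Z" "\<And>z'. z' \<in> Z \<Longrightarrow> \<bar>snd z\<bar> \<le> \<bar>snd z'\<bar>"
        by blast
      have "snd z \<noteq> 0"
      proof
        assume "snd z = 0"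
        then have "n (fst z) \<bullet> n (fst z) \<le> 0" "fst z \<in> S" using z(1) by (auto simp: Z_def f_def)
        then show False using S(3) by (metis inner_gt_zero_iff not_le)
      qed
      have "f (x, t) > 0" if "x \<in> S" "t \<in> {-1..1}" "\<bar>t\<bar> \<le> \<bar>snd z\<bar> / 2" for x t
      proof (rule ccontr)
        assume "\<not> ?thesis"
        then have "(x, t) \<in> Z" using that by (auto simp: Z_def)
        from z(2)[OF this] show False using that \<open>snd z \<noteq> 0\<close> by auto
      qed
      then show ?thesis using \<open>snd z \<noteq> 0\<close> by (intro exI[of _ "\<bar>snd z\<bar> / 2"]) auto
    qed
  qed
  then obtain e0 where e0: "e0 > 0" "\<And>x t. x \<in> S \<Longrightarrow> t \<in> {-1..1} \<Longrightarrow> \<bar>t\<bar> \<le> e0 \<Longrightarrow> f (x, t) > 0"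
    by blast
  define e where "e = min e0 1"
  have inc: "h (x + s *\<^sub>R n x) < h (x + t *\<^sub>R n x)" if "x \<in> S" "- e \<le> s" "s < t" "t \<le> e" for x s t
  proof (rule DERIV_pos_imp_increasing[OF that(3)])
    fix u assume u: "s \<le> u" "u \<le> t"
    have "((\<lambda>u. x + u *\<^sub>R n x) has_derivative (\<lambda>u. u *\<^sub>R n x)) (at u)"
      by (auto intro!: derivative_eq_intros)
    then have "((\<lambda>u. h (x + u *\<^sub>R n x)) has_derivative (\<lambda>v. (v *\<^sub>R n x) \<bullet> n (x + u *\<^sub>R n x))) (at u)"
      by (rule has_derivative_compose) (rule h[unfolded gderiv_def])
    then have "((\<lambda>u. h (x + u *\<^sub>R n x)) has_real_derivative f (x, u)) (at u)"
      unfolding has_field_derivative_def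
      by (rule has_derivative_eq_rhs) (simp add: fun_eq_iff f_def inner_commute mult.commute)
    moreover have "f (x, u) > 0"
      using that u by (intro e0(2)) (auto simp: e_def)
    ultimately show "\<exists>y. ((\<lambda>u. h (x + u *\<^sub>R n x)) has_real_derivative y) (at u) \<and> 0 < y" by blast
  qed
  show ?thesis
  proof (intro exI[of _ e] conjI ballI allI impI)
    show "e > 0" using e0 by (simp add: e_def)
    fix x t assume x: "x \<in> S" "0 < t" "t \<le> e"
    show "h (x - t *\<^sub>R n x) < 0" "h (x + t *\<^sub>R n x) > 0"
      using inc[OF x(1), of "- t" 0] inc[OF x(1), of 0 t] x S(2)[OF x(1)] by auto
  qed
qed

section \<open>Transfer to the complex plane\<close>

definition cx :: "real^2 \<Rightarrow> complex"
  where "cx v = Complex (v $ 1) (v $ 2)"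

definition rv :: "complex \<Rightarrow> real^2"
  where "rv z = vector [Re z, Im z]"

lemma cx_rv [simp]: "cx (rv z) = z"
  by (simp add: cx_def rv_def)

lemma rv_cx [simp]: "rv (cx v) = v"
  by (simp add: cx_def rv_def vec2_eq_iff)

lemma inj_cx: "inj cx"
  by (metis injI rv_cx)

lemma cx_simps [simp]: "cx (u + v) = cx u + cx v" "cx (u - v) = cx u - cx v"
    "cx (r *\<^sub>R v) = of_real r * cx v" "cx v = 0 \<longleftrightarrow> v = 0"
  by (simp_all add: cx_def complex_eq_iff vec2_eq_iff)

lemma cx_inner: "Re (cx u * cnj (cx v)) = u \<bullet> v" "Im (cx u * cnj (cx v)) = u \<bullet> rot v"
  by (simp_all add: cx_def inner_real2)

lemma norm_cx: "norm (cx v) = norm v"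
  by (simp add: cx_def norm_eq_sqrt_inner[of v] inner_real2 cmod_def power2_eq_square)

lemma dist_cx: "dist (cx u) (cx v) = dist u v"
  by (simp only: dist_norm norm_cx flip: cx_simps)

lemma bounded_linear_cx: "bounded_linear cx"
  unfolding linear_conv_bounded_linear[symmetric]
  by (rule linearI) (simp, metis cx_simps(3) scaleR_conv_of_real)

lemma bounded_linear_rv: "bounded_linear rv"
  unfolding linear_conv_bounded_linear[symmetric]
  by (rule linearI) (simp_all add: rv_def vec2_eq_iff)

lemmas continuous_on_cx [continuous_intros] = bounded_linear.continuous_on[OF bounded_linear_cx]
lemmas continuous_on_rv [continuous_intros] = bounded_linear.continuous_on[OF bounded_linear_rv]

lemma cx_image: "z \<in> cx ` S \<longleftrightarrow> rv z \<in> S"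
  by (metis cx_rv image_eqI image_iff rv_cx)

lemma cx_image_vimage: "cx ` S = rv -` S"
  using cx_image by auto

text \<open>The uniform \<open>e\<close> serves twice: as the distance by which the curve is pushed
  into \<open>U\<close>, and as the half-length \<open>\<eta>\<close> that places zero and pole of
  each model crossing.\<close>

lemma sum_crossing_signs_planar:
  fixes U K E :: "(real^2) set" and n F W :: "real^2 \<Rightarrow> real^2" and sg :: "real^2 \<Rightarrow> int"
  assumes U: "open U" "connected U" "bounded U" "U \<noteq> {}" "connected (- U)"
    and K: "compact K" "U \<subseteq> K"
    and n: "continuous_on (K - U) n"
    and e: "e > 0" "\<And>x t. x \<in> K - U \<Longrightarrow> 0 < t \<Longrightarrow> t \<le> e \<Longrightarrow>
      x - t *\<^sub>R n x \<in> U \<and> x + t *\<^sub>R n x \<notin> K"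
    and F: "continuous_on K F" "\<And>x. x \<in> K \<Longrightarrow> F x \<noteq> 0"
    and W: "continuous_on (K - U) W" "\<And>x. x \<in> K - U \<Longrightarrow> W x \<bullet> n x > 0"
    and E: "finite E" "E \<subseteq> K - U" "\<And>x. x \<in> K - U \<Longrightarrow> (\<exists>r\<le>0. F x = r *\<^sub>R W x) \<longleftrightarrow> x \<in> E"
    and sg: "\<And>p. p \<in> E \<Longrightarrow> sg p = 1 \<or> sg p = -1"
      "\<And>p. p \<in> E \<Longrightarrow> \<forall>\<^sub>F x in at p within K - U.
        sgn (F x \<bullet> rot (W x)) = of_int (sg p) * sgn ((x - p) \<bullet> rot (n p))"
  shows "(\<Sum>p\<in>E. sg p) = 1"
proof -
  have KU: "cx ` K - cx ` U = cx ` (K - U)"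
    using inj_cx by (simp add: image_set_diff)
  have cont: "continuous_on (cx ` S) (\<lambda>z. cx (v (rv z)))" if "continuous_on S v" for S and v :: "real^2 \<Rightarrow> real^2"
    by (intro continuous_on_cx continuous_on_compose2[OF that] continuous_on_rv continuous_on_id)
      (auto simp: cx_image)
  have "(\<Sum>z\<in>cx ` E. sg (rv z)) = 1"
  proof (rule sum_crossing_signs[where U = "cx ` U" and K = "cx ` K" and n = "\<lambda>z. cx (n (rv z))"
        and F = "\<lambda>z. cx (F (rv z))" and W = "\<lambda>z. cx (W (rv z))" and \<eta> = "\<lambda>_. e" and e = e])
    show "open (cx ` U)"
      unfolding cx_image_vimage using continuous_on_rv[OF continuous_on_id] U(1)
      by (intro open_vimage) auto
    show "connected (cx ` U)"
      using U(2) by (intro connected_continuous_image continuous_on_cx continuous_on_id)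
    show "bounded (cx ` U)"
      using U(3) bounded_linear_cx by (rule bounded_linear_image)
    have "- cx ` U = cx ` (- U)"
      unfolding cx_image_vimage by auto
    then show "connected (- cx ` U)"
      using U(5) by (auto intro!: connected_continuous_image continuous_on_cx continuous_on_id)
    show "compact (cx ` K)"
      using K(1) by (intro compact_continuous_image continuous_on_cx continuous_on_id)
    fix z assume z: "z \<in> cx ` K - cx ` U"
    then have x: "rv z \<in> K - U" by (simp add: cx_image)
    show "Re (cx (W (rv z)) * cnj (cx (n (rv z)))) > 0"
      unfolding cx_inner using W(2)[OF x] .
    have "cx (W (rv z)) \<noteq> 0" using W(2)[OF x] by auto
    then have "cx (F (rv z)) / cx (W (rv z)) \<in> \<real>\<^sub>\<le>\<^sub>0 \<longleftrightarrow> (\<exists>r\<le>0. cx (F (rv z)) = of_real r * cx (W (rv z)))"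
      by (auto simp: nonpos_Reals_def field_simps image_iff)
    also have "\<dots> \<longleftrightarrow> (\<exists>r\<le>0. F (rv z) = r *\<^sub>R W (rv z))"
      by (metis cx_simps(3) inj_cx inj_eq)
    finally show "cx (F (rv z)) / cx (W (rv z)) \<in> \<real>\<^sub>\<le>\<^sub>0 \<longleftrightarrow> z \<in> cx ` E"
      using E(3)[OF x] by (simp add: cx_image)
    show "z - of_real t * cx (n (rv z)) \<in> cx ` U" if "0 < t" "t \<le> e" for t
    proof -
      have "z - of_real t * cx (n (rv z)) = cx (rv z - t *\<^sub>R n (rv z))" by simp
      then show ?thesis using e(2)[OF x that] by blast
    qed
  next
    fix z assume z: "z \<in> cx ` E"
    then have p: "rv z \<in> E" by (simp add: cx_image)
    show "sg (rv z) = 1 \<or> sg (rv z) = -1" by (rule sg(1)[OF p])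
    obtain d where d: "d > 0" "\<And>x. x \<in> K - U \<Longrightarrow> x \<noteq> rv z \<Longrightarrow> dist x (rv z) < d \<Longrightarrow>
        sgn (F x \<bullet> rot (W x)) = of_int (sg (rv z)) * sgn ((x - rv z) \<bullet> rot (n (rv z)))"
      using sg(2)[OF p] by (auto simp: eventually_at)
    show "\<forall>\<^sub>F y in at z within cx ` K - cx ` U. sgn (Im (cx (F (rv y)) / cx (W (rv y)))) =
        of_int (sg (rv z)) * sgn (Im (cnj (cx (n (rv z))) * (y - z)))"
      unfolding eventually_at
    proof (intro exI[of _ d] conjI ballI impI)
      fix y assume "y \<in> cx ` K - cx ` U" and y: "y \<noteq> z \<and> dist y z < d"
      then have "rv y \<in> K - U" by (simp add: cx_image)
      moreover have "rv y \<noteq> rv z" using y by (metis cx_rv)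
      moreover have "dist (rv y) (rv z) < d" using y by (metis cx_rv dist_cx)
      ultimately have "sgn (F (rv y) \<bullet> rot (W (rv y))) =
          of_int (sg (rv z)) * sgn ((rv y - rv z) \<bullet> rot (n (rv z)))"
        by (rule d(2))
      moreover have "Im (cnj (cx (n (rv z))) * (y - z)) = (rv y - rv z) \<bullet> rot (n (rv z))"
        using cx_inner(2)[of "rv y - rv z" "n (rv z)"] by (simp add: mult.commute)
      ultimately show "sgn (Im (cx (F (rv y)) / cx (W (rv y)))) =
        of_int (sg (rv z)) * sgn (Im (cnj (cx (n (rv z))) * (y - z)))"
        unfolding sgn_Im_divide cx_inner by (simp only:)
    qed (use d in auto)
    have x: "rv z \<in> K - U" using p E by blast
    let ?v = "cx (n (rv z))"
    have "(cx ` K - cx ` U) \<inter> closed_segment (z - of_real e * ?v) (z + of_real e * ?v) \<subseteq> {z}"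
    proof
      fix y assume y: "y \<in> (cx ` K - cx ` U) \<inter> closed_segment (z - of_real e * ?v) (z + of_real e * ?v)"
      then obtain u where u: "0 \<le> u" "u \<le> 1" "y = (1 - u) *\<^sub>R (z - of_real e * ?v) + u *\<^sub>R (z + of_real e * ?v)"
        by (auto simp: in_segment)
      \<comment> \<open>Signed position on the segment, from \<open>- e\<close> to \<open>e\<close>:
        for \<open>t < 0\<close> the point lies in \<open>U\<close>, for \<open>t > 0\<close>
        outside \<open>K\<close>.\<close>
      define t where "t = (2 * u - 1) * e"
      have "y = z + of_real t * ?v"
        by (simp add: u(3) t_def scaleR_conv_of_real algebra_simps)
      then have yt: "rv y = rv z + t *\<^sub>R n (rv z)"
        by (metis cx_rv cx_simps(1,3) rv_cx)
      have "rv y \<in> K" "rv y \<notin> U" using y by (auto simp: cx_image)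
      have "(2 * u - 1) * e \<le> 1 * e" "(1 - 2 * u) * e \<le> 1 * e"
        using u(1,2) e(1) by (intro mult_right_mono; simp)+
      then have te: "t \<le> e" "- t \<le> e"
        by (simp_all add: t_def algebra_simps)
      have "\<not> 0 < t"
        using e(2)[OF x _ te(1)] \<open>rv y \<in> K\<close> yt by auto
      moreover have "\<not> 0 < - t"
        using e(2)[OF x _ te(2)] \<open>rv y \<notin> U\<close> yt by auto
      ultimately have "t = 0" by simp
      then show "y \<in> {z}" using \<open>y = z + of_real t * ?v\<close> by simp
    qed
    moreover have "z - of_real e * ?v = cx (rv z - e *\<^sub>R n (rv z))" "z + of_real e * ?v = cx (rv z + e *\<^sub>R n (rv z))"
      by simp_all
    then have "z - of_real e * ?v \<in> cx ` U" "z + of_real e * ?v \<notin> cx ` K"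
      using e(2)[OF x e(1)] by (simp_all only: cx_image rv_cx) auto
    ultimately show "0 < e \<and> z - of_real e * ?v \<in> cx ` U \<and> z + of_real e * ?v \<notin> cx ` K \<and>
      (cx ` K - cx ` U) \<inter> closed_segment (z - of_real e * ?v) (z + of_real e * ?v) \<subseteq> {z}"
      using e(1) by blast
  qed (use U K E F cont[OF n] cont[OF F(1)] cont[OF W(1)] e KU in \<open>auto simp: cx_image\<close>)
  then show ?thesis
    by (simp add: sum.reindex inj_on_subset[OF inj_cx])
qed

text \<open>The simplifier would turn \<open>transpose (g x) *v n x\<close> into
  \<open>n x v* g x\<close>, and facts about \<open>q x\<close> would no longer match.\<close>

declare transpose_matrix_vector [simp del]

section \<open>The planar filtered system\<close>

locale planar_safety_filter =
  fixes f :: "real^2 \<Rightarrow> real^2" and g :: "real^2 \<Rightarrow> real^'m^2" and k :: "real^2 \<Rightarrow> real^'m"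
    and h :: "real^2 \<Rightarrow> real" and \<alpha> :: "real \<Rightarrow> real" and G :: "real^2 \<Rightarrow> real^'m^'m"
    and C :: "(real^2) set"
  assumes f_lipschitz: "locally_lipschitz_on UNIV f"
    and g_lipschitz: "locally_lipschitz_on UNIV g"
    and k_lipschitz: "locally_lipschitz_on UNIV k"
    and unique_equilibrium: "\<And>x. nominal_field f g k x = 0 \<longleftrightarrow> x = 0"
    and alpha_K_inf: "extended_class_K_inf \<alpha>"
    and alpha_differentiable: "\<And>s. \<alpha> differentiable (at s)"
    and alpha_deriv_pos: "deriv \<alpha> 0 > 0"
    and h_C1: "C1_on UNIV h"
    and C_superlevel: "C = {x. h x \<ge> 0}"
    and C_frontier: "frontier C = {x. h x = 0}"
    and strict_CBF: "strict_CBF f g h \<alpha> C"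
    and G_C1: "C1_on UNIV G"
    and G_pos_def: "\<And>x. positive_definite (G x)"
    and X_C1: "\<And>p. p \<in> undesired_equilibria (nominal_field f g k) g h G \<Longrightarrow>
      \<exists>U. open U \<and> p \<in> U \<and> C1_on U (filtered_field (nominal_field f g k) g h \<alpha> G)"
    and h_origin: "h 0 > 0"
    and unsafe_nonempty: "- C \<noteq> {}"
    and unsafe_bounded: "bounded (- C)"
    and unsafe_connected: "connected (- C)"
    and safe_connected: "connected C"
    and finite_E: "finite (undesired_equilibria (nominal_field f g k) g h G)"
begin

abbreviation "F \<equiv> nominal_field f g k"
abbreviation "X \<equiv> filtered_field F g h \<alpha> G"
abbreviation "E \<equiv> undesired_equilibria F g h G"
abbreviation "n \<equiv> gradient h"
abbreviation "q x \<equiv> transpose (g x) *v n x"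
abbreviation "y x \<equiv> matrix_inv (G x) *v q x"
abbreviation "a \<equiv> deriv \<alpha> 0"

text \<open>\<open>W\<close> is transversal to \<open>h = 0\<close>; the second summand keeps it so where the actuation vanishes, and
  is absent wherever the filter is active.\<close>

definition W :: "real^2 \<Rightarrow> real^2"
  where "W x = g x *v y x + max 0 (n x \<bullet> F x) *\<^sub>R n x"

lemma alpha: "strict_mono \<alpha>" "\<alpha> 0 = 0" "(\<alpha> has_real_derivative a) (at 0)"
proof -
  show "strict_mono \<alpha>" "\<alpha> 0 = 0"
    using alpha_K_inf by (auto simp: extended_class_K_inf_def)
  show "(\<alpha> has_real_derivative a) (at 0)"
    using alpha_differentiable[of 0]
    by (metis DERIV_deriv_iff_real_differentiable)
qed

lemma continuity:
  "continuous_on UNIV F" "continuous_on UNIV g" "continuous_on UNIV q" "continuous_on UNIV \<alpha>"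
  "continuous_on UNIV h" "continuous_on UNIV n" "continuous_on UNIV (\<lambda>x. g x *v y x)"
proof -
  have c: "continuous_on UNIV f" "continuous_on UNIV k"
    using local_lipschitz_continuous_on[OF f_lipschitz UNIV_I] local_lipschitz_continuous_on[OF k_lipschitz UNIV_I] .
  show g: "continuous_on UNIV g"
    by (rule local_lipschitz_continuous_on[OF g_lipschitz UNIV_I])
  have "continuous_on UNIV (\<lambda>x. f x + g x *v k x)"
    by (intro continuous_on_add continuous_on_matrix_vector_mult c g)
  then show "continuous_on UNIV F"
    by (simp add: nominal_field_def[abs_def])
  show "continuous_on UNIV \<alpha>"
    using alpha_K_inf by (auto simp: extended_class_K_inf_def)
  show n: "continuous_on UNIV n"
    by (rule C1_on_gradient(2)[OF h_C1])
  show "continuous_on UNIV h"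
    using C1_on_gradient(1)[OF h_C1] unfolding gderiv_def
    by (meson has_derivative_continuous continuous_at_imp_continuous_on)
  have "continuous_on UNIV (\<lambda>x. transpose (g x))"
    unfolding transpose_def by (intro continuous_on_vec_lambda continuous_intros g)
  then show q: "continuous_on UNIV q"
    by (intro continuous_on_matrix_vector_mult n)
  have "continuous_on UNIV G"
    using G_C1 unfolding C1_on_def by (meson has_derivative_continuous continuous_at_imp_continuous_on UNIV_I)
  then have "continuous_on UNIV y"
    by (intro continuous_on_matrix_inv_mult q G_pos_def)
  with g show "continuous_on UNIV (\<lambda>x. g x *v y x)"
    by (rule continuous_on_matrix_vector_mult)
qed

lemma normal_actuation: "n x \<bullet> (g x *v u) = q x \<bullet> u"
  by (simp only: inner_transpose_mult)

lemma y_pos: "q x \<noteq> 0 \<Longrightarrow> q x \<bullet> y x > 0"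
  by (rule positive_definite_inv_pos[OF G_pos_def])

text \<open>Where \<open>q x = 0\<close> no input affects the derivative of \<open>h\<close>, so the
  strict barrier condition, with \<open>\<alpha> (h x) = 0\<close>, holds whatever the input, in
  particular for the nominal one.\<close>

lemma inflow_if_unactuated:
  assumes "h x = 0" "q x = 0"
  shows "n x \<bullet> F x > 0"
proof -
  have "x \<in> C" using assms(1) by (simp add: C_superlevel)
  then obtain u where "n x \<bullet> (f x + g x *v u) + \<alpha> (h x) > 0"
    using strict_CBF unfolding strict_CBF_def by blast
  then have "n x \<bullet> f x > 0"
    using assms alpha(2) by (simp only: inner_add_right normal_actuation) simp
  then show ?thesis
    using assms(2) unfolding nominal_field_def inner_add_right normal_actuation by simp
qed

lemma W_pos:
  assumes "h x = 0"
  shows "W x \<bullet> n x > 0"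
proof -
  have eq: "W x \<bullet> n x = q x \<bullet> y x + max 0 (n x \<bullet> F x) * (n x \<bullet> n x)"
    unfolding inner_commute[of "W x" "n x"]
    by (simp only: W_def inner_add_right normal_actuation inner_scaleR_right)
  show ?thesis
  proof (cases "q x = 0")
    case True
    from inflow_if_unactuated[OF assms this] have "n x \<bullet> F x > 0" "n x \<noteq> 0" by auto
    then show ?thesis unfolding eq True by simp
  next
    case False
    then show ?thesis
      unfolding eq using y_pos[OF False] by (intro add_pos_nonneg) auto
  qed
qed

lemma n_nonzero: "h x = 0 \<Longrightarrow> n x \<noteq> 0"
  using W_pos by fastforce

lemma undesired_equilibria_iff:
  assumes "h x = 0"
  shows "(\<exists>r\<le>0. F x = r *\<^sub>R W x) \<longleftrightarrow> x \<in> E"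
proof
  assume "\<exists>r\<le>0. F x = r *\<^sub>R W x"
  then obtain r where r: "r \<le> 0" "F x = r *\<^sub>R W x" by blast
  have "F x \<noteq> 0" using unique_equilibrium h_origin assms by fastforce
  then have "r < 0" using r by (cases "r = 0") auto
  moreover have "n x \<bullet> F x \<le> 0"
    using r W_pos[OF assms] by (simp add: inner_commute mult_nonpos_nonneg)
  then have "W x = g x *v y x" by (simp add: W_def)
  ultimately show "x \<in> E"
    using r assms unfolding undesired_equilibria_def by auto
next
  assume "x \<in> E"
  then obtain \<delta> where \<delta>: "\<delta> < 0" "F x = \<delta> *\<^sub>R (g x *v y x)"
    unfolding undesired_equilibria_def by blast
  have "q x \<bullet> y x \<ge> 0" using y_pos[of x] by (cases "q x = 0") auto
  then have "n x \<bullet> F x \<le> 0"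
    unfolding \<delta>(2) inner_scaleR_right normal_actuation using \<delta>(1) by (simp add: mult_nonpos_nonneg)
  then have "W x = g x *v y x" by (simp add: W_def)
  then show "\<exists>r\<le>0. F x = r *\<^sub>R W x"
    using \<delta> by (intro exI[of _ \<delta>]) auto
qed

lemma at_equilibrium:
  assumes "p \<in> E"
  shows "h p = 0" "q p \<noteq> 0" "n p \<bullet> F p < 0"
proof -
  obtain \<delta> where \<delta>: "\<delta> < 0" "F p = \<delta> *\<^sub>R (g p *v y p)" and hp: "h p = 0"
    using assms unfolding undesired_equilibria_def by blast
  show "h p = 0" by (rule hp)
  have "F p \<noteq> 0" using unique_equilibrium h_origin hp by fastforce
  then show q: "q p \<noteq> 0"
    using \<delta> by (metis matrix_vector_mult_0_right scaleR_zero_right)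
  show "n p \<bullet> F p < 0"
    unfolding \<delta>(2) inner_scaleR_right normal_actuation using \<delta>(1) y_pos[OF q] by (simp add: mult_neg_pos)
qed

lemma X_active:
  assumes "q x \<noteq> 0" "n x \<bullet> F x + \<alpha> (h x) < 0"
  shows "X x = F x - ((n x \<bullet> F x + \<alpha> (h x)) / (q x \<bullet> y x)) *\<^sub>R (g x *v y x)"
    and "n x \<bullet> X x = - \<alpha> (h x)"
proof -
  show X: "X x = F x - ((n x \<bullet> F x + \<alpha> (h x)) / (q x \<bullet> y x)) *\<^sub>R (g x *v y x)"
    unfolding filtered_field_def safety_filter_active[where F = F and g = g and h = h and \<alpha> = \<alpha> and G = G, OF G_pos_def assms] matrix_vector_mult_scaleR
    by (simp only: minus_divide_left[symmetric] scaleR_minus_left diff_conv_add_uminus)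
  show "n x \<bullet> X x = - \<alpha> (h x)"
    unfolding X inner_diff_right inner_scaleR_right normal_actuation
    using y_pos[OF assms(1)] by simp
qed

text \<open>\<open>n x \<bullet> X x = - \<alpha> (h x)\<close> and injectivity of
  \<open>\<alpha>\<close> put a zero of \<open>X\<close> on \<open>h = 0\<close>. Together with
  \<open>finite_E\<close> this isolates the zeros of \<open>X\<close> near each undesired
  equilibrium.\<close>

lemma X_zero_imp_equilibrium:
  assumes "q x \<noteq> 0" "n x \<bullet> F x + \<alpha> (h x) < 0" "X x = 0"
  shows "x \<in> E"
proof -
  have "\<alpha> (h x) = \<alpha> 0"
    using X_active(2)[OF assms(1,2)] assms(3) alpha(2) by simp
  then have hx: "h x = 0"
    using strict_mono_eq[OF alpha(1)] by simp
  moreover have "F x = ((n x \<bullet> F x) / (q x \<bullet> y x)) *\<^sub>R (g x *v y x)"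
    using X_active(1)[OF assms(1,2)] assms(3) hx alpha(2) by simp
  moreover have "(n x \<bullet> F x) / (q x \<bullet> y x) < 0"
    using assms(2) hx alpha(2) y_pos[OF assms(1)] by (simp add: divide_neg_pos)
  ultimately show ?thesis
    unfolding undesired_equilibria_def by blast
qed

lemma eventually_active:
  assumes "p \<in> E"
  shows "\<forall>\<^sub>F x in nhds p. q x \<noteq> 0 \<and> n x \<bullet> F x + \<alpha> (h x) < 0"
proof -
  note cont = continuity[unfolded continuous_on_eq_continuous_at[OF open_UNIV], rule_format, OF UNIV_I]
  have "isCont (\<lambda>x. \<alpha> (h x)) p"
    using continuity by (metis cont(4,5) isCont_o2)
  then have "isCont (\<lambda>x. n x \<bullet> F x + \<alpha> (h x)) p"
    using cont(1,6) by (intro continuous_intros)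
  moreover have "n p \<bullet> F p + \<alpha> (h p) < 0"
    using at_equilibrium[OF assms] alpha(2) by simp
  ultimately have "\<forall>\<^sub>F x in at p. n x \<bullet> F x + \<alpha> (h x) < 0"
    unfolding isCont_def by (rule order_tendstoD(2))
  moreover have "\<forall>\<^sub>F x in at p. q x \<noteq> 0"
    using cont(3)[of p] at_equilibrium(2)[OF assms]
    unfolding isCont_def by (rule tendsto_imp_eventually_ne)
  ultimately have "\<forall>\<^sub>F x in at p. q x \<noteq> 0 \<and> n x \<bullet> F x + \<alpha> (h x) < 0"
    by eventually_elim simp
  then show ?thesis
    using at_equilibrium[OF assms] alpha(2) by (simp add: eventually_nhds_conv_at)
qed

lemma barrier_equilibrium_at:
  assumes p: "p \<in> E"
  obtains R L where "barrier_equilibrium X n h \<alpha> a R L p (frechet_derivative X (at p))"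
    "\<And>x. x \<in> ball p R \<Longrightarrow> q x \<noteq> 0 \<and> n x \<bullet> F x + \<alpha> (h x) < 0"
proof -
  obtain U where U: "open U" "p \<in> U" "C1_on U X"
    using X_C1[OF p] by blast
  obtain R0 L where R0: "R0 > 0" "ball p R0 \<subseteq> U"
    "\<And>x y. x \<in> ball p R0 \<Longrightarrow> y \<in> ball p R0 \<Longrightarrow> norm (X x - X y) \<le> L * norm (x - y)"
    using C1_on_imp_lipschitz_ball[OF U] by metis
  obtain R1 where R1: "R1 > 0" "\<And>x. dist x p < R1 \<Longrightarrow> q x \<noteq> 0 \<and> n x \<bullet> F x + \<alpha> (h x) < 0"
    using eventually_active[OF p] unfolding eventually_nhds_metric by blast
  obtain R2 where R2: "R2 > 0" "\<And>x. x \<in> E \<Longrightarrow> x \<noteq> p \<Longrightarrow> R2 \<le> dist p x"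
    using finite_set_avoid[OF finite_E, of p] by blast
  define R where "R = Min {R0, R1, R2}"
  have R: "R > 0" "R \<le> R0" "R \<le> R1" "R \<le> R2" using R0 R1 R2 by (auto simp: R_def)
  have act: "q x \<noteq> 0 \<and> n x \<bullet> F x + \<alpha> (h x) < 0" if "x \<in> ball p R" for x
    using R1(2)[of x] that R by (simp add: dist_commute)
  have zero: "x \<in> E" if "x \<in> ball p R" "X x = 0" for x
    using X_zero_imp_equilibrium act that by blast
  have "barrier_equilibrium X n h \<alpha> a R L p (frechet_derivative X (at p))"
  proof
    show "R > 0" by (rule R)
    show "norm (X x - X y) \<le> L * norm (x - y)" if "x \<in> ball p R" "y \<in> ball p R" for x y
      using that R by (intro R0(3)) auto
    show "X x \<noteq> 0" if x: "x \<in> ball p R" "x \<noteq> p" for x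
    proof
      assume "X x = 0"
      from R2(2)[OF zero[OF x(1) this] x(2)] show False using x R by simp
    qed
    show "X p = 0"
    proof -
      obtain \<delta> where \<delta>: "F p = \<delta> *\<^sub>R (g p *v y p)"
        using p unfolding undesired_equilibria_def by blast
      have "n p \<bullet> F p = \<delta> * (q p \<bullet> y p)"
        unfolding \<delta> inner_scaleR_right normal_actuation ..
      then show ?thesis
        using X_active(1)[of p] act[of p] R(1) at_equilibrium[OF p] alpha(2) y_pos[of p]
        by (simp flip: \<delta>)
    qed
    show "(X has_derivative frechet_derivative X (at p)) (at p)"
      using U unfolding C1_on_def by (metis differentiableI frechet_derivative_works)
    show "GDERIV h x :> n x" for x by (rule C1_on_gradient(1)[OF h_C1])
    show "n p \<noteq> 0" by (rule n_nonzero[OF at_equilibrium(1)[OF p]])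
    show "n x \<bullet> X x = - \<alpha> (h x)" if "x \<in> ball p R" for x
      using X_active(2) act[OF that] by blast
  qed (use continuity alpha alpha_deriv_pos at_equilibrium[OF p] in auto)
  then show ?thesis
    using that act by blast
qed

text \<open>On \<open>h = 0\<close>, \<open>F x\<close> and \<open>X x\<close> differ by a multiple
  of \<open>W x\<close>, which is orthogonal to \<open>rot (W x)\<close>. As \<open>X x\<close> is
  tangent and \<open>W x \<bullet> n x > 0\<close>, replacing \<open>W x\<close> by
  \<open>n x\<close> keeps the sign. This links the crossings of \<open>F / W\<close> with the flow
  on the curve.\<close>

lemma W_velocity:
  assumes "h x = 0" "q x \<noteq> 0" "n x \<bullet> F x + \<alpha> (h x) < 0"
  shows "sgn (F x \<bullet> rot (W x)) = sgn (X x \<bullet> rot (n x))"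
proof -
  have nF: "n x \<bullet> F x < 0" using assms alpha(2) by simp
  then have W: "W x = g x *v y x" by (simp add: W_def)
  define \<beta> where "\<beta> = (n x \<bullet> F x) / (q x \<bullet> y x)"
  have "F x = X x + \<beta> *\<^sub>R W x"
    using X_active(1)[OF assms(2,3)] assms(1) alpha(2) by (simp add: W \<beta>_def)
  then have "F x \<bullet> rot (W x) = X x \<bullet> rot (W x)"
    by (simp add: inner_add_left)
  moreover have "n x \<bullet> X x = 0"
    using X_active(2)[OF assms(2,3)] assms(1) alpha(2) by simp
  then have "(n x \<bullet> n x) * (X x \<bullet> rot (W x)) = (X x \<bullet> rot (n x)) * (W x \<bullet> n x)"
    using inner_normal_tangent[of "n x" "rot (W x)" "X x"] by (simp add: inner_commute)
  then have "sgn ((n x \<bullet> n x) * (X x \<bullet> rot (W x))) = sgn ((X x \<bullet> rot (n x)) * (W x \<bullet> n x))"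
    by (rule arg_cong)
  then have "sgn (X x \<bullet> rot (W x)) = sgn (X x \<bullet> rot (n x))"
    unfolding sgn_mult using n_nonzero[OF assms(1)] W_pos[OF assms(1)] by simp
  ultimately show ?thesis by simp
qed

lemma crossing_types:
  assumes p: "p \<in> E"
  shows "saddle_type X a p \<Longrightarrow> \<forall>\<^sub>F x in at p within {x. h x = 0}.
      sgn (F x \<bullet> rot (W x)) = sgn ((x - p) \<bullet> rot (n p))"
    and "asymptotically_stable_type X a p \<Longrightarrow> \<forall>\<^sub>F x in at p within {x. h x = 0}.
      sgn (F x \<bullet> rot (W x)) = - sgn ((x - p) \<bullet> rot (n p))"
    and "\<not> (saddle_type X a p \<and> asymptotically_stable_type X a p)"
proof -
  obtain R L where be: "barrier_equilibrium X n h \<alpha> a R L p (frechet_derivative X (at p))"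
    and act: "\<And>x. x \<in> ball p R \<Longrightarrow> q x \<noteq> 0 \<and> n x \<bullet> F x + \<alpha> (h x) < 0"
    using barrier_equilibrium_at[OF p] by blast
  interpret barrier_equilibrium X n h \<alpha> a R L p "frechet_derivative X (at p)" by (rule be)
  have lin: "linear (frechet_derivative X (at p))"
    using X_deriv by (rule has_derivative_linear)
  have A: "frechet_derivative X (at p) = (*v) (jacobian X (at p))"
    unfolding jacobian_def by (rule matrix_vector_mul(2)[OF lin, symmetric])
  note types = crossing_stable_saddle[OF A]
  have transfer: "\<forall>\<^sub>F x in at p within {x. h x = 0}.
      sgn (F x \<bullet> rot (W x)) = \<sigma> * sgn ((x - p) \<bullet> rot (n p))" if "crossing \<sigma>" for \<sigma>
  proof -
    have "\<forall>\<^sub>F x in at p within {x. h x = 0}. h x = 0"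
      by (simp add: eventually_at_filter)
    with that[unfolded crossing_def] eventually_near[OF R_pos] show ?thesis
    proof eventually_elim
      case (elim x)
      then show ?case
        using W_velocity[of x] act[of x] by simp
    qed
  qed
  show "\<forall>\<^sub>F x in at p within {x. h x = 0}. sgn (F x \<bullet> rot (W x)) = sgn ((x - p) \<bullet> rot (n p))"
    if "saddle_type X a p"
    using transfer[OF types(2)[OF that]] by simp
  show "\<forall>\<^sub>F x in at p within {x. h x = 0}. sgn (F x \<bullet> rot (W x)) = - sgn ((x - p) \<bullet> rot (n p))"
    if "asymptotically_stable_type X a p"
    using transfer[OF types(1)[OF that]] by simp
  show "\<not> (saddle_type X a p \<and> asymptotically_stable_type X a p)"
    using types crossing_unique[of "-1" 1] by auto
qed

lemma saddle_stable_count: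
  assumes types: "\<And>p. p \<in> E \<Longrightarrow> asymptotically_stable_type X a p \<or> saddle_type X a p"
  shows "card {p \<in> E. saddle_type X a p} = card {p \<in> E. asymptotically_stable_type X a p} + 1"
proof -
  define K where "K = {x. h x \<le> 0}"
  have mC: "- C = {x. h x < 0}" by (auto simp: C_superlevel)
  have KU: "K - (- C) = {x. h x = 0}" by (auto simp: K_def mC)
  \<comment> \<open>The level set is the frontier of the unsafe set, so \<open>K\<close> lies in the
    closure of a bounded set.\<close>
  have K_eq: "K = - C \<union> frontier (- C)"
    unfolding frontier_complement C_frontier by (auto simp: K_def mC)
  have "bounded (closure (- C))" using unsafe_bounded by (rule bounded_closure)
  then have bdd: "bounded K"
    unfolding K_eq by (rule bounded_subset) (auto simp: frontier_def intro: closure_subset[THEN subsetD])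
  have closed_K: "closed K" and closed_0: "closed {x. h x = 0}"
    unfolding K_def using continuity(5)
    by (auto intro!: closed_Collect_le closed_Collect_eq continuous_on_const)
  have "compact K" using bdd closed_K by (simp add: compact_eq_bounded_closed)
  have cpt: "compact {x. h x = 0}"
    unfolding compact_eq_bounded_closed using closed_0 KU bounded_subset[OF bdd] by blast
  have zero: "\<And>x. x \<in> {x. h x = 0} \<Longrightarrow> h x = 0" "\<And>x. x \<in> {x. h x = 0} \<Longrightarrow> n x \<noteq> 0"
    using n_nonzero by simp_all
  from uniform_gradient_transversal[OF C1_on_gradient(1)[OF h_C1] continuity(6) cpt zero]
  obtain e where e: "e > 0" "\<forall>x\<in>{x. h x = 0}. \<forall>t. 0 < t \<longrightarrow> t \<le> e \<longrightarrow>
      h (x - t *\<^sub>R n x) < 0 \<and> h (x + t *\<^sub>R n x) > 0"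
    by blast
  \<comment> \<open>By \<open>types\<close> and \<open>crossing_types(3)\<close>, the points that
    are not saddles are exactly the stable ones, so the sum of the signs is the difference of the
    two counts.\<close>
  define sg :: "real^2 \<Rightarrow> int" where "sg p = (if saddle_type X a p then 1 else -1)" for p
  have "(\<Sum>p\<in>E. sg p) = 1"
  proof (rule sum_crossing_signs_planar[where U = "- C" and K = K and n = n and F = F and W = W and e = e])
    show "open (- C)"
      unfolding mC using continuity(5) by (intro open_Collect_less continuous_on_const)
    show "connected (- C)" "bounded (- C)" "- C \<noteq> {}" "compact K" "e > 0"
      by (rule unsafe_connected unsafe_bounded unsafe_nonempty \<open>compact K\<close> e(1))+
    show "connected (- (- C))"
      using safe_connected by simp
    show "- C \<subseteq> K"
      unfolding mC K_def by auto
    show "continuous_on (K - (- C)) n" "continuous_on K F"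
      using continuity by (auto intro: continuous_on_subset)
    show "x - t *\<^sub>R n x \<in> - C \<and> x + t *\<^sub>R n x \<notin> K" if "x \<in> K - (- C)" "0 < t" "t \<le> e" for x t
      using e(2)[rule_format, of x t] that unfolding KU mC K_def by auto
    show "F x \<noteq> 0" if "x \<in> K" for x
      using that unique_equilibrium h_origin by (force simp: K_def)
    have "continuous_on UNIV W"
      unfolding W_def[abs_def] by (intro continuous_intros continuity)
    then show "continuous_on (K - (- C)) W"
      by (rule continuous_on_subset) simp
    show "W x \<bullet> n x > 0" if "x \<in> K - (- C)" for x
      using that W_pos unfolding KU by simp
    show "finite E" by (rule finite_E)
    show "E \<subseteq> K - (- C)" unfolding KU using at_equilibrium(1) by blast
    show "(\<exists>r\<le>0. F x = r *\<^sub>R W x) \<longleftrightarrow> x \<in> E" if "x \<in> K - (- C)" for x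
      using that unfolding KU by (intro undesired_equilibria_iff) simp
    fix p assume p: "p \<in> E"
    show "sg p = 1 \<or> sg p = -1" by (simp add: sg_def)
    show "\<forall>\<^sub>F x in at p within K - (- C). sgn (F x \<bullet> rot (W x)) = of_int (sg p) * sgn ((x - p) \<bullet> rot (n p))"
      unfolding KU using crossing_types(1,2)[OF p] types[OF p] by (auto simp: sg_def)
  qed
  moreover have "(\<Sum>p\<in>E. sg p) = int (card {p \<in> E. saddle_type X a p}) - int (card {p \<in> E. \<not> saddle_type X a p})"
    unfolding sg_def using finite_E by (simp add: sum.If_cases Int_def)
  moreover have "{p \<in> E. \<not> saddle_type X a p} = {p \<in> E. asymptotically_stable_type X a p}"
    using types crossing_types(3) by blast
  ultimately show ?thesis by simp
qed

end

theorem proposition4p9: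
  fixes f :: "real^2 \<Rightarrow> real^2"
    and g :: "real^2 \<Rightarrow> real^'m^2"
    and k :: "real^2 \<Rightarrow> real^'m"
    and h :: "real^2 \<Rightarrow> real"
    and \<alpha> :: "real \<Rightarrow> real"
    and G :: "real^2 \<Rightarrow> real^'m^'m"
    and C :: "(real^2) set"
    and F X :: "real^2 \<Rightarrow> real^2"
    and E :: "(real^2) set"
  defines "F \<equiv> nominal_field f g k"
    and "X \<equiv> filtered_field F g h \<alpha> G"
    and "E \<equiv> undesired_equilibria F g h G"
  assumes f_lipschitz: "locally_lipschitz_on UNIV f"
    and g_lipschitz: "locally_lipschitz_on UNIV g"
    and k_lipschitz: "locally_lipschitz_on UNIV k"
    and unique_equilibrium: "\<And>x. F x = 0 \<longleftrightarrow> x = 0"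
    and nominal_GAS: "globally_asymptotically_stable_origin F"
    and alpha_K_inf: "extended_class_K_inf \<alpha>"
    and alpha_differentiable: "\<And>s. \<alpha> differentiable (at s)"
    and alpha_deriv_pos: "deriv \<alpha> 0 > 0"
    and h_C1: "C1_on UNIV h"
    and C_superlevel: "C = {x. h x \<ge> 0}"
    and C_frontier: "frontier C = {x. h x = 0}"
    and strict_CBF: "strict_CBF f g h \<alpha> C"
    and G_C1: "C1_on UNIV G"
    and G_pos_def: "\<And>x. positive_definite (G x)"
    and filter_lipschitz: "\<exists>U. open U \<and> C \<subseteq> U \<and> locally_lipschitz_on U (safety_filter F g h \<alpha> G)"
    and X_C1: "\<And>p. p \<in> E \<Longrightarrow> \<exists>U. open U \<and> p \<in> U \<and> C1_on U X"
    and h_origin: "h 0 > 0"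
    and unsafe_nonempty: "- C \<noteq> {}"
    and unsafe_bounded: "bounded (- C)"
    and unsafe_connected: "connected (- C)"
    and safe_connected: "connected C"
    and finite_E: "finite E"
    and types: "\<And>p. p \<in> E \<Longrightarrow>
      asymptotically_stable_type X (deriv \<alpha> 0) p \<or> saddle_type X (deriv \<alpha> 0) p"
  shows "odd (card E)
    \<and> card {p \<in> E. saddle_type X (deriv \<alpha> 0) p} = (card E + 1) div 2
    \<and> card {p \<in> E. asymptotically_stable_type X (deriv \<alpha> 0) p} = (card E - 1) div 2"
proof -
  interpret psf: planar_safety_filter f g k h \<alpha> G C
    using assms by unfold_locales (auto simp: F_def X_def E_def)
  let ?S = "{p \<in> E. saddle_type X (deriv \<alpha> 0) p}"
  let ?A = "{p \<in> E. asymptotically_stable_type X (deriv \<alpha> 0) p}"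
  have count: "card ?S = card ?A + 1"
    using psf.saddle_stable_count types unfolding F_def X_def E_def by blast
  have "E = ?S \<union> ?A" using types by blast
  moreover have "?S \<inter> ?A = {}"
    using psf.crossing_types(3) unfolding F_def X_def E_def by blast
  ultimately have "card E = card ?S + card ?A"
    using finite_E by (metis (no_types, lifting) card_Un_disjoint finite_Un)
  then show ?thesis
    using count by simp
qed

end
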